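(* Let $d\ge 3$. For any $\beta>1$ and $u\in\mathbb{R}$, as $t\to\infty$ (through real values), respectively $n\to\infty$ (through integers), \[ \mathbb{P}\bigl(\ell^*(t)>\beta\gamma^{-1}\log t+u\bigr)=(1+o(1))\,\gamma e^{-\gamma u}\,t^{-(\beta-1)}, \] \[ \mathbb{P}\bigl(\xi^*(n)>\beta\alpha\log n+u\bigr)=(1+o(1))\,\gamma\, n\,(1-\gamma)^{\lfloor \beta\alpha\log n+u\rfloor}. \]
   Context: $(S_n)_{n\ge0}$ is the discrete-time simple (nearest-neighbour, symmetric) random walk on $\mathbb{Z}^d$, $d\ge3$, started at $S_0=0$. $(Y_t)_{t\ge0}$ is the continuous-time walk obtained by attaching i.i.d. $\mathrm{Exp}(1)$ holding times (independent of the walk) to $(S_n)$. $\mathbb{P}$ denotes the law governing both walks. Local times: $\xi(n,x)=\sum_{k=0}^n\mathbf 1_{\{S_k=x\}}$, $\ell(t,x)=\int_0^t\mathbf 1_{\{Y_s=x\}}ds$, and $\xi^*(n)=\max_{x\in\mathbb{Z}^d}\xi(n,x)$, $\ell^*(t)=\max_{x\in\mathbb{Z}^d}\ell(t,x)$. Constants: $\gamma=\gamma_d=\mathbb{P}(S_n\ne0\text{ for all }n\ge1)$ and $\alpha=\alpha_d=-1/\log(1-\gamma)$. *)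

theory Defs
  imports "HOL-Probability.Probability" "HOL-Library.Landau_Symbols"
begin

definition unit_steps :: "(int ^ 'd) set" where
  "unit_steps = {v. \<exists>i. v = axis i 1 \<or> v = axis i (-1)}"

definition simple_walk_steps :: "'a measure \<Rightarrow> (nat \<Rightarrow> 'a \<Rightarrow> int ^ 'd) \<Rightarrow> bool" where
  "simple_walk_steps M X \<longleftrightarrow>
     prob_space.indep_vars M (\<lambda>_. count_space UNIV) X UNIV \<and>
     (\<forall>k. distr M (count_space UNIV) (X k) = measure_pmf (pmf_of_set unit_steps))"

definition exp_holding_times :: "'a measure \<Rightarrow> (nat \<Rightarrow> 'a \<Rightarrow> real) \<Rightarrow> bool" where
  "exp_holding_times M T \<longleftrightarrow>
     prob_space.indep_vars M (\<lambda>_. borel) T UNIV \<and>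
     (\<forall>k. distributed M lborel (T k) (exponential_density 1))"

text \<open>Independence of the whole step sequence from the whole sequence of holding times,
  stated for the generated \<open>\<sigma>\<close>-algebras because the library's \<open>indep_var\<close> needs both
  variables to have the same type.\<close>

definition steps_indep_times ::
    "'a measure \<Rightarrow> (nat \<Rightarrow> 'a \<Rightarrow> int ^ 'd) \<Rightarrow> (nat \<Rightarrow> 'a \<Rightarrow> real) \<Rightarrow> bool" where
  "steps_indep_times M X T \<longleftrightarrow>
     prob_space.indep_set M
       {(\<lambda>\<omega> k. X k \<omega>) -` A \<inter> space M | A. A \<in> sets (PiM UNIV (\<lambda>_. count_space UNIV))}
       {(\<lambda>\<omega> k. T k \<omega>) -` B \<inter> space M | B. B \<in> sets (PiM UNIV (\<lambda>_. borel))}"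

definition walk :: "(nat \<Rightarrow> 'a \<Rightarrow> int ^ 'd) \<Rightarrow> nat \<Rightarrow> 'a \<Rightarrow> int ^ 'd" where
  "walk X n \<omega> = (\<Sum>k<n. X k \<omega>)"

text \<open>\<open>T k\<close> is the time spent at \<open>walk X k\<close>, so the \<open>n\<close>-th jump occurs at time
  \<open>\<Sum>k<n. T k\<close>. Almost surely only finitely many jumps occur before time \<open>s\<close>; on the
  exceptional null set the cardinality below is 0 by convention.\<close>

definition num_jumps :: "(nat \<Rightarrow> 'a \<Rightarrow> real) \<Rightarrow> real \<Rightarrow> 'a \<Rightarrow> nat" where
  "num_jumps T s \<omega> = card {n. n \<ge> 1 \<and> (\<Sum>k<n. T k \<omega>) \<le> s}"

definition ct_walk ::
    "(nat \<Rightarrow> 'a \<Rightarrow> int ^ 'd) \<Rightarrow> (nat \<Rightarrow> 'a \<Rightarrow> real) \<Rightarrow> real \<Rightarrow> 'a \<Rightarrow> int ^ 'd" where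
  "ct_walk X T s \<omega> = walk X (num_jumps T s \<omega>) \<omega>"

definition local_time :: "(nat \<Rightarrow> 'a \<Rightarrow> int ^ 'd) \<Rightarrow> nat \<Rightarrow> int ^ 'd \<Rightarrow> 'a \<Rightarrow> nat" where
  "local_time X n x \<omega> = (\<Sum>k\<le>n. if walk X k \<omega> = x then 1 else 0)"

definition max_local_time :: "(nat \<Rightarrow> 'a \<Rightarrow> int ^ 'd) \<Rightarrow> nat \<Rightarrow> 'a \<Rightarrow> nat" where
  "max_local_time X n \<omega> = Max (range (\<lambda>x. local_time X n x \<omega>))"

definition ct_local_time ::
    "(nat \<Rightarrow> 'a \<Rightarrow> int ^ 'd) \<Rightarrow> (nat \<Rightarrow> 'a \<Rightarrow> real) \<Rightarrow> real \<Rightarrow> int ^ 'd \<Rightarrow> 'a \<Rightarrow> real" where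
  "ct_local_time X T t x \<omega> = (LINT s:{0..t}|lborel. indicator {x} (ct_walk X T s \<omega>))"

text \<open>The family of local times lies in \<open>{0..t}\<close>, so the supremum is a genuine one; it is
  attained whenever the path visits finitely many sites in \<open>{0..t}\<close>, that is, almost surely.\<close>

definition max_ct_local_time ::
    "(nat \<Rightarrow> 'a \<Rightarrow> int ^ 'd) \<Rightarrow> (nat \<Rightarrow> 'a \<Rightarrow> real) \<Rightarrow> real \<Rightarrow> 'a \<Rightarrow> real" where
  "max_ct_local_time X T t \<omega> = (SUP x. ct_local_time X T t x \<omega>)"

definition escape_prob :: "'a measure \<Rightarrow> (nat \<Rightarrow> 'a \<Rightarrow> int ^ 'd) \<Rightarrow> real" where
  "escape_prob M X = measure M {\<omega> \<in> space M. \<forall>n\<ge>1. walk X n \<omega> \<noteq> 0}"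

definition alpha_const :: "'a measure \<Rightarrow> (nat \<Rightarrow> 'a \<Rightarrow> int ^ 'd) \<Rightarrow> real" where
  "alpha_const M X = - 1 / ln (1 - escape_prob M X)"

end

theory Submission
  imports Defs "HOL-Real_Asymp.Real_Asymp"
begin

text \<open>Let \<open>\<rho> = 1 - \<gamma>\<close> be the return probability. A site first visited at time \<open>k\<close> accumulates at least
  \<open>i + 1\<close> visits with probability \<open>\<rho>^i\<close>, and by time reversal time \<open>k\<close> is a first visit with probability
  close to \<open>\<gamma>\<close>. The union bound over first visits gives the upper bound. For the lower bound the visits
  are counted only in a window of polylogarithmic length after the first visit, and Bonferroni's
  inequality is applied. Windows that do not overlap are independent and contribute
  \<open>n\<^sup>2 \<rho>^(2 m) = o(n \<rho>^m)\<close> because \<open>\<beta> > 1\<close>. For two distinct sites with overlapping windows, the pair of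
  sites is visited more than \<open>2 m\<close> times; the probability of returning to a pair is at most
  \<open>q = 2 \<rho> / (1 + \<rho>)\<close>, since hitting a given point other than the origin is at most as likely as returning,
  and \<open>q\<^sup>2 < \<rho>\<close>.

  A sum of \<open>c\<close> holding times exceeds \<open>s\<close> with probability \<open>P(Poisson(s) < c)\<close>, so the bounds on visit
  counts are mixed with Poisson weights, \<open>\<rho>^m\<close> becoming \<open>exp (- \<gamma> s)\<close>. The Chernoff bound shows that up
  to super-polynomially small errors the walk makes \<open>t \<plusminus> t^(2/3)\<close> jumps by time \<open>t\<close>.

  Transience, and a rate for it, come from the decay \<open>O(n^(-3/2))\<close> of the probability of being at the
  origin at time \<open>n\<close>.\<close>

subsection \<open>Finite paths\<close>

text \<open>A union bound over all times would lose the constant, since a site would be counted at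
  each of its visits. Counting first visits makes \<gamma> appear: as their limiting mean frequency
  in the upper bound and, because the chance of a first visit at time k decreases to \<gamma>, as a
  bound valid at every k in the lower one. The window is the delicate point. It replaces \<rho> by
  the probability r of returning within the window, and (r / \<rho>)^N must tend to 1 at levels N of
  order log n. This requires \<rho> - r = o(1 / N), hence a rate of transience and not transience
  alone. On the other hand the number of overlapping pairs and of their displacements grows like a
  power of the window length, which must therefore stay polylogarithmic. The constant q comes from
  an identity: if h is the probability of ever hitting x, the pair of 0 and x is revisited with
  probability (\<rho> + h) / (1 + h), which increases with h and equals q at h = \<rho>. The cruder
  bound \<rho> + h \<le> 2 \<rho> would have a square below \<rho> only for \<rho> < 1 / 4.\<close>

primrec path_expect :: "nat \<Rightarrow> ((int ^ 'd) list \<Rightarrow> real) \<Rightarrow> real" where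
  "path_expect 0 f = f []"
| "path_expect (Suc n) f =
     (\<Sum>v\<in>unit_steps. path_expect n (\<lambda>w. f (v # w))) / real (card (unit_steps :: (int ^ 'd) set))"

definition step_lists :: "nat \<Rightarrow> (int ^ 'd) list set" where
  "step_lists n = {w. set w \<subseteq> unit_steps \<and> length w = n}"

definition path_prob :: "nat \<Rightarrow> ((int ^ 'd) list \<Rightarrow> bool) \<Rightarrow> real" where
  "path_prob n P = path_expect n (\<lambda>w. of_bool (P w))"

lemma unit_steps_eq:
  "unit_steps = (\<lambda>i. axis i 1) ` UNIV \<union> (\<lambda>i. axis i (-1)) ` (UNIV :: 'd::finite set)"
  by (auto simp: unit_steps_def)

lemma finite_unit_steps [simp]: "finite (unit_steps :: (int ^ 'd) set)"
  by (simp add: unit_steps_eq)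

lemma unit_steps_nonempty [simp]: "unit_steps \<noteq> ({} :: (int ^ 'd) set)"
  by (simp add: unit_steps_eq)

lemma zero_notin_unit_steps [simp]: "0 \<notin> (unit_steps :: (int ^ 'd) set)"
  by (auto simp: unit_steps_def vec_eq_iff axis_def)

lemma uminus_unit_steps [simp]: "- v \<in> unit_steps \<longleftrightarrow> v \<in> (unit_steps :: (int ^ 'd) set)"
proof -
  have "- axis i a = axis i (- a)" for i :: 'd and a :: int
    by (simp add: vec_eq_iff axis_def)
  then have "- v \<in> unit_steps" if "v \<in> unit_steps" for v :: "int ^ 'd"
    using that by (auto simp: unit_steps_def)
  from this[of v] this[of "- v"] show ?thesis by auto
qed

lemma card_unit_steps_pos [simp]: "0 < card (unit_steps :: (int ^ 'd) set)"
  by (simp add: card_gt_0_iff)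

lemma step_avg_const:
  "(\<Sum>v\<in>(unit_steps :: (int ^ 'd) set). c :: real) / real (card (unit_steps :: (int ^ 'd) set)) = c"
  by (simp add: card_gt_0_iff)

lemma path_expect_mono:
  assumes "\<And>w. w \<in> step_lists n \<Longrightarrow> f w \<le> g w"
  shows "path_expect n f \<le> path_expect n g"
  using assms
proof (induction n arbitrary: f g)
  case (Suc n)
  show ?case unfolding path_expect.simps
    by (intro divide_right_mono sum_mono Suc.IH Suc.prems) (auto simp: step_lists_def)
qed (simp add: step_lists_def)

lemma path_expect_cong:
  assumes "\<And>w. w \<in> step_lists n \<Longrightarrow> f w = g w"
  shows "path_expect n f = path_expect n g"
  by (intro antisym path_expect_mono) (simp_all add: assms)

lemma path_expect_const [simp]: "path_expect n (\<lambda>w :: (int ^ 'd) list. c) = c"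
  by (induction n) (simp_all add: card_gt_0_iff)

lemma path_expect_add:
  "path_expect n (\<lambda>w. f w + g w) = path_expect n f + path_expect n g"
  by (induction n arbitrary: f g) (simp_all add: sum.distrib add_divide_distrib)

lemma path_expect_cmult: "path_expect n (\<lambda>w. c * f w) = c * path_expect n f"
  by (induction n arbitrary: f) (simp_all flip: sum_distrib_left)

lemma path_expect_multc: "path_expect n (\<lambda>w. f w * c) = path_expect n f * c"
  using path_expect_cmult[of n c f] by (simp add: mult.commute)

lemma path_expect_diff:
  "path_expect n (\<lambda>w. f w - g w) = path_expect n f - path_expect n g"
  using path_expect_add[of n f "\<lambda>w. (-1) * g w"] path_expect_cmult[of n "-1" g] by simp

lemma path_expect_sum:
  "path_expect n (\<lambda>w. \<Sum>i\<in>I. f i w) = (\<Sum>i\<in>I. path_expect n (f i))"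
  by (induction I rule: infinite_finite_induct) (simp_all add: path_expect_add)

lemma path_expect_nonneg:
  "(\<And>w. w \<in> step_lists n \<Longrightarrow> 0 \<le> f w) \<Longrightarrow> 0 \<le> path_expect n f"
  using path_expect_mono[of n "\<lambda>_. 0" f] by simp

lemma path_expect_append:
  "path_expect (m + n) f = path_expect m (\<lambda>u. path_expect n (\<lambda>w. f (u @ w)))"
  by (induction m arbitrary: f) simp_all

text \<open>The recursion peels off the first step; peeling off the last one makes reversal of paths
  provable by induction.\<close>

lemma path_expect_snoc:
  "path_expect (Suc n) f =
    (\<Sum>v\<in>unit_steps. path_expect n (\<lambda>w. f (w @ [v]))) / real (card (unit_steps :: (int ^ 'd) set))"
  for f :: "(int ^ 'd) list \<Rightarrow> real"
proof -
  have "path_expect (Suc n) f = path_expect n (\<lambda>u. path_expect 1 (\<lambda>w. f (u @ w)))"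
    using path_expect_append[of n 1 f] by simp
  also have "\<dots> = path_expect n (\<lambda>u. (\<Sum>v\<in>unit_steps. f (u @ [v])) * (1 / real (card (unit_steps :: (int ^ 'd) set))))"
    by simp
  also have "\<dots> = (\<Sum>v\<in>unit_steps. path_expect n (\<lambda>w. f (w @ [v]))) / real (card (unit_steps :: (int ^ 'd) set))"
    by (simp only: path_expect_multc path_expect_sum) simp
  finally show ?thesis .
qed

lemma path_expect_rev: "path_expect n (\<lambda>w. f (rev w)) = path_expect n f"
proof (induction n arbitrary: f)
  case (Suc n)
  show ?case unfolding path_expect_snoc[of n f] using Suc.IH[of "\<lambda>w. f (w @ [v])" for v] by simp
qed simp

text \<open>Permuting uniformly distributed steps preserves the law of the path; all lattice
  symmetries enter through this.\<close>

lemma path_expect_reindex: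
  fixes \<sigma> :: "int ^ 'd \<Rightarrow> int ^ 'd"
  assumes "bij_betw \<sigma> unit_steps unit_steps"
  shows "path_expect n (\<lambda>w. f (map \<sigma> w)) = path_expect n f"
proof (induction n arbitrary: f)
  case (Suc n)
  have "(\<Sum>v\<in>unit_steps. path_expect n (\<lambda>w. f (\<sigma> v # w))) = (\<Sum>v\<in>unit_steps. path_expect n (\<lambda>w. f (v # w)))"
    using sum.reindex_bij_betw[OF assms, of "\<lambda>v. path_expect n (\<lambda>w. f (v # w))"] .
  then show ?case using Suc.IH[of "\<lambda>w. f (\<sigma> v # w)" for v] by simp
qed simp

lemma path_prob_mono:
  "(\<And>w. w \<in> step_lists n \<Longrightarrow> P w \<Longrightarrow> Q w) \<Longrightarrow> path_prob n P \<le> path_prob n Q"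
  unfolding path_prob_def by (intro path_expect_mono) auto

lemma path_prob_cong:
  "(\<And>w. w \<in> step_lists n \<Longrightarrow> P w \<longleftrightarrow> Q w) \<Longrightarrow> path_prob n P = path_prob n Q"
  by (intro antisym path_prob_mono) auto

lemma path_prob_nonneg [simp]: "0 \<le> path_prob n P"
  unfolding path_prob_def by (intro path_expect_nonneg) auto

lemma path_prob_le_1 [simp]: "path_prob n P \<le> 1"
  using path_prob_mono[of n P "\<lambda>_. True"] by (simp add: path_prob_def)

lemma path_prob_compl: "path_prob n (\<lambda>w. \<not> P w) = 1 - path_prob n P"
  using path_expect_diff[of n "\<lambda>_. 1" "\<lambda>w. of_bool (P w)"] by (simp add: path_prob_def of_bool_not_iff)

lemma path_prob_Suc:
  "path_prob (Suc n) P =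
    (\<Sum>v\<in>unit_steps. path_prob n (\<lambda>w. P (v # w))) / real (card (unit_steps :: (int ^ 'd) set))"
  for P :: "(int ^ 'd) list \<Rightarrow> bool"
  by (simp add: path_prob_def)

lemma path_prob_append:
  "path_prob (m + n) (\<lambda>w. P (take m w) \<and> Q (drop m w)) = path_prob m P * path_prob n Q"
proof -
  have "path_prob (m + n) (\<lambda>w. P (take m w) \<and> Q (drop m w))
    = path_expect m (\<lambda>u. path_expect n (\<lambda>w. of_bool (P u \<and> Q w)))"
    unfolding path_prob_def path_expect_append
    by (intro path_expect_cong) (auto simp: step_lists_def)
  also have "\<dots> = path_expect m (\<lambda>u. of_bool (P u) * path_prob n Q)"
    by (simp add: path_prob_def of_bool_conj path_expect_cmult)
  also have "\<dots> = path_prob m P * path_prob n Q"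
    by (simp add: path_expect_multc path_prob_def)
  finally show ?thesis .
qed

lemma path_prob_take: "path_prob (m + n) (\<lambda>w. P (take m w)) = path_prob m P"
  using path_prob_append[of m n P "\<lambda>_. True"] by (simp add: path_prob_def)

lemma path_prob_Un:
  assumes "finite I"
  shows "path_prob n (\<lambda>w. \<exists>i\<in>I. P i w) \<le> (\<Sum>i\<in>I. path_prob n (P i))"
proof -
  have "of_bool (\<exists>i\<in>I. P i w) \<le> (\<Sum>i\<in>I. of_bool (P i w) :: real)" for w
  proof (cases "\<exists>i\<in>I. P i w")
    case True
    then obtain i where "i \<in> I" "P i w" by blast
    then have "of_bool (P i w) \<le> (\<Sum>i\<in>I. of_bool (P i w) :: real)"
      using assms by (intro member_le_sum) auto
    with True \<open>P i w\<close> show ?thesis by simp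
  qed (simp add: sum_nonneg)
  then show ?thesis
    unfolding path_prob_def path_expect_sum[symmetric] by (intro path_expect_mono)
qed

subsection \<open>Counting visits\<close>

text \<open>The starting point is not counted, so \<open>1 \<le> visits {0} 0 w\<close> means a
  genuine return.\<close>

primrec visits :: "(int ^ 'd) set \<Rightarrow> int ^ 'd \<Rightarrow> (int ^ 'd) list \<Rightarrow> nat" where
  "visits A x [] = 0"
| "visits A x (v # w) = (if x + v \<in> A then Suc (visits A (x + v) w) else visits A (x + v) w)"

definition visit_prob :: "(int ^ 'd) set \<Rightarrow> nat \<Rightarrow> int ^ 'd \<Rightarrow> nat \<Rightarrow> real" where
  "visit_prob A n x i = path_prob n (\<lambda>w. i \<le> visits A x w)"

lemma visit_prob_0_right [simp]: "visit_prob A n x 0 = 1"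
  by (simp add: visit_prob_def path_prob_def)

lemma visit_prob_0_left: "visit_prob A 0 x (Suc i) = 0"
  by (simp add: visit_prob_def path_prob_def)

lemma visit_prob_Suc:
  "visit_prob A (Suc n) x (Suc i) =
    (\<Sum>v\<in>unit_steps. if x + v \<in> A then visit_prob A n (x + v) i else visit_prob A n (x + v) (Suc i))
      / real (card (unit_steps :: (int ^ 'd) set))" for x :: "int ^ 'd"
  unfolding visit_prob_def path_prob_Suc
  by (intro arg_cong2[where f = "(/)"] sum.cong) auto

lemma visit_prob_nonneg [simp]: "0 \<le> visit_prob A n x i"
  by (simp add: visit_prob_def)

lemma visit_prob_le_1 [simp]: "visit_prob A n x i \<le> 1"
  by (simp add: visit_prob_def)

lemma visit_prob_Suc_le: "visit_prob A n x i \<le> visit_prob A (Suc n) x i"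
proof (induction n arbitrary: x i)
  case 0
  show ?case by (cases i) (simp_all add: visit_prob_0_left)
next
  case (Suc n)
  show ?case
  proof (cases i)
    case (Suc j)
    show ?thesis unfolding Suc visit_prob_Suc[of A "Suc n" x j] visit_prob_Suc[of A n x j]
      using Suc.IH by (intro divide_right_mono sum_mono) (simp_all del: of_nat_Suc)
  qed simp
qed

lemma visit_prob_mono: "m \<le> n \<Longrightarrow> visit_prob A m x i \<le> visit_prob A n x i"
  by (rule lift_Suc_mono_le[of "\<lambda>n. visit_prob A n x i"]) (rule visit_prob_Suc_le)

text \<open>The strong Markov property at successive visits to \<open>A\<close>, by induction on the
  horizon: after a step into \<open>A\<close> the remaining visits start from a point of
  \<open>A\<close> with one step less. The bound \<open>Q\<close> is therefore assumed at every
  point of \<open>A\<close> and for every horizon.\<close>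

lemma visit_prob_upper:
  assumes "0 \<le> Q" "\<And>a n. a \<in> A \<Longrightarrow> visit_prob A n a 1 \<le> Q"
  shows "visit_prob A n x (Suc i) \<le> visit_prob A n x 1 * Q ^ i"
proof (induction n arbitrary: x i)
  case 0
  show ?case using assms(1) by (simp add: visit_prob_0_left)
next
  case (Suc n)
  have at_A: "visit_prob A n a i \<le> Q ^ i" if "a \<in> A" for a
  proof (cases i)
    case (Suc j)
    have "visit_prob A n a i \<le> visit_prob A n a 1 * Q ^ j"
      using Suc.IH Suc by blast
    also have "\<dots> \<le> Q * Q ^ j"
      using assms that by (intro mult_right_mono) auto
    finally show ?thesis using Suc by simp
  qed simp
  have "(if x + v \<in> A then visit_prob A n (x + v) i else visit_prob A n (x + v) (Suc i))
     \<le> (if x + v \<in> A then visit_prob A n (x + v) 0 else visit_prob A n (x + v) (Suc 0)) * Q ^ i" for v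
    using at_A[of "x + v"] Suc.IH[of "x + v" i] by simp
  then show ?case
    unfolding One_nat_def visit_prob_Suc times_divide_eq_left sum_distrib_right
    by (intro divide_right_mono sum_mono) auto
qed

lemma visit_prob_le_power:
  assumes "0 \<le> Q" "\<And>a n. a \<in> A \<Longrightarrow> visit_prob A n a 1 \<le> Q" "x \<in> A"
  shows "visit_prob A n x i \<le> Q ^ i"
proof (cases i)
  case (Suc j)
  have "visit_prob A n x i \<le> visit_prob A n x 1 * Q ^ j"
    using visit_prob_upper[OF assms(1,2)] Suc by blast
  also have "\<dots> \<le> Q * Q ^ j"
    using assms by (intro mult_right_mono) auto
  finally show ?thesis using Suc by simp
qed simp

text \<open>The first visit may use up to \<open>m\<close> steps; the horizon \<open>n + m\<close>
  then leaves at least \<open>n\<close> steps for the others. With a single target the position at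
  the first visit is known.\<close>

lemma visit_prob_split:
  "visit_prob {a} m x 1 * visit_prob {a} n a i \<le> visit_prob {a} (n + m) x (Suc i)"
proof (induction m arbitrary: x)
  case 0
  show ?case by (simp add: visit_prob_0_left)
next
  case (Suc m)
  have "(if x + v \<in> {a} then visit_prob {a} m (x + v) 0 else visit_prob {a} m (x + v) (Suc 0)) * visit_prob {a} n a i
     \<le> (if x + v \<in> {a} then visit_prob {a} (n + m) (x + v) i else visit_prob {a} (n + m) (x + v) (Suc i))" for v
    using Suc.IH[of "x + v"] visit_prob_mono[of n "n + m" "{a}" a i] by simp
  then show ?case
    unfolding One_nat_def add_Suc_right visit_prob_Suc times_divide_eq_left sum_distrib_right
    by (intro divide_right_mono sum_mono) auto
qed

text \<open>Each return gets \<open>m\<close> steps of its own. All lower bounds for returns within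
  a window come from this.\<close>

lemma power_le_visit_prob: "visit_prob {a} m a 1 ^ i \<le> visit_prob {a} (i * m) a i"
proof (induction i)
  case (Suc i)
  have "visit_prob {a} m a 1 ^ Suc i \<le> visit_prob {a} m a 1 * visit_prob {a} (i * m) a i"
    using Suc by (simp add: mult_left_mono)
  also have "\<dots> \<le> visit_prob {a} (i * m + m) a (Suc i)"
    by (rule visit_prob_split)
  finally show ?case by (simp add: add.commute)
qed simp


text \<open>In the applications \<open>\<tau>\<close> is an affine symmetry of the lattice and
  \<open>\<sigma>\<close> its action on steps; besides the linear case this covers the point
  reflections sending \<open>y\<close> to \<open>x - y\<close>.\<close>

lemma visit_prob_image:
  fixes \<sigma> :: "int ^ 'd \<Rightarrow> int ^ 'd"
  assumes "bij_betw \<sigma> unit_steps unit_steps" "\<And>y v. \<tau> (y + v) = \<tau> y + \<sigma> v" "\<And>y. \<tau> y \<in> B \<longleftrightarrow> y \<in> A"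
  shows "visit_prob B n (\<tau> x) i = visit_prob A n x i"
proof -
  have "visits B (\<tau> x) (map \<sigma> w) = visits A x w" for w
    by (induction w arbitrary: x) (simp_all add: assms(2)[symmetric] assms(3))
  then show ?thesis
    using path_expect_reindex[OF assms(1), of n "\<lambda>w. of_bool (i \<le> visits B (\<tau> x) w)"]
    by (simp add: visit_prob_def path_prob_def)
qed

section \<open>Lattice symmetry, hitting probabilities and returns to a pair of sites\<close>

abbreviation return_prob :: "'d::finite itself \<Rightarrow> nat \<Rightarrow> real" where
  "return_prob t n \<equiv> visit_prob {0} n (0 :: int ^ 'd) 1"

lemma unit_steps_transitive:
  assumes "e \<in> unit_steps" "e' \<in> unit_steps"
  obtains \<sigma> :: "int ^ 'd \<Rightarrow> int ^ 'd" where "bij_betw \<sigma> unit_steps unit_steps"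
    "\<And>x y. \<sigma> (x + y) = \<sigma> x + \<sigma> y" "\<And>y. \<sigma> y = 0 \<longleftrightarrow> y = 0" "\<sigma> e = e'"
proof -
  obtain i a where e: "e = axis i a" "a = 1 \<or> a = -1" using assms(1) by (auto simp: unit_steps_def)
  obtain j b where e': "e' = axis j b" "b = 1 \<or> b = -1" using assms(2) by (auto simp: unit_steps_def)
  define t where "t = Transposition.transpose i j"
  \<comment> \<open>The swap carries the value \<open>a\<close> to coordinate \<open>j\<close>,
    where the factor \<open>a * b\<close> turns it into \<open>a * b * a = b\<close>, because
    \<open>a\<close> is a sign.\<close>
  define c where "c k = (if k = j then a * b else 1)" for k
  define \<sigma> where "\<sigma> = (\<lambda>x :: int ^ 'd. \<chi> k. c k * x $ t k)"
  have c: "c k = 1 \<or> c k = -1" for k using e e' by (auto simp: c_def)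
  then have c0: "c k \<noteq> 0" for k by (metis zero_neq_neg_one zero_neq_one)
  have t: "t (t k) = k" "t k = l \<longleftrightarrow> k = t l" for k l by (auto simp: t_def)
  have axis: "\<sigma> (axis l d) = axis (t l) (c (t l) * d)" for l d
    by (auto simp: \<sigma>_def vec_eq_iff axis_def t(2))
  have zero: "\<sigma> y = 0 \<longleftrightarrow> y = 0" for y
  proof
    assume "\<sigma> y = 0"
    then have "c (t k) * y $ t (t k) = 0" for k by (simp add: \<sigma>_def vec_eq_iff)
    then show "y = 0" using c0 by (simp add: t vec_eq_iff)
  qed (simp add: \<sigma>_def vec_eq_iff)
  have add: "\<sigma> (x + y) = \<sigma> x + \<sigma> y" for x y by (simp add: \<sigma>_def vec_eq_iff algebra_simps)
  have "inj \<sigma>"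
  proof (rule injI)
    fix x y assume "\<sigma> x = \<sigma> y"
    with add[of "x - y" y] have "\<sigma> (x - y) = 0" by simp
    then show "x = y" using zero by simp
  qed
  moreover have "\<sigma> ` unit_steps \<subseteq> unit_steps"
    using c by (auto simp: unit_steps_def axis) (metis mult.right_neutral mult_minus1_right minus_minus)+
  ultimately have "bij_betw \<sigma> unit_steps unit_steps"
    using endo_inj_surj[of unit_steps \<sigma>] by (auto simp: bij_betw_def intro: inj_on_subset)
  moreover have "\<sigma> e = e'" using e e' by (auto simp: axis t_def c_def)
  ultimately show ?thesis using add zero that by blast
qed

text \<open>The first step of a return ends at a neighbour of the origin, and by symmetry all
  neighbours have the same hitting probability. That step accounts for the
  \<open>Suc\<close>.\<close>

lemma visit_prob_unit_step:
  fixes e :: "int ^ 'd"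
  assumes "e \<in> unit_steps"
  shows "visit_prob {0} n e 1 = return_prob TYPE('d) (Suc n)"
proof -
  have eq: "visit_prob {0} n v (Suc 0) = visit_prob {0} n e (Suc 0)" if v: "v \<in> unit_steps" for v :: "int ^ 'd"
  proof -
    obtain \<sigma> :: "int ^ 'd \<Rightarrow> int ^ 'd" where "bij_betw \<sigma> unit_steps unit_steps"
      "\<And>x y. \<sigma> (x + y) = \<sigma> x + \<sigma> y" "\<And>y. \<sigma> y = 0 \<longleftrightarrow> y = 0" "\<sigma> e = v"
      using unit_steps_transitive[OF assms v] by blast
    then show ?thesis using visit_prob_image[of \<sigma> \<sigma> "{0}" "{0}" n e "Suc 0"] by simp
  qed
  have "return_prob TYPE('d) (Suc n) =
      (\<Sum>v\<in>(unit_steps :: (int ^ 'd) set). visit_prob {0} n v (Suc 0)) / real (card (unit_steps :: (int ^ 'd) set))"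
    unfolding One_nat_def visit_prob_Suc
    by (intro arg_cong2[where f = "(/)"] sum.cong) auto
  also have "\<dots> = (\<Sum>v\<in>(unit_steps :: (int ^ 'd) set). visit_prob {0} n e (Suc 0)) / real (card (unit_steps :: (int ^ 'd) set))"
    by (intro arg_cong2[where f = "(/)"] sum.cong) (auto intro: eq)
  finally show ?thesis by (simp add: card_gt_0_iff)
qed

text \<open>To hit the origin the walk must first enter its neighbourhood, and from there the hitting
  probability is the return probability.\<close>

lemma hit_prob_le:
  fixes x :: "int ^ 'd"
  assumes "\<And>n. return_prob TYPE('d) n \<le> \<rho>"
  shows "visit_prob {0} n x 1 \<le> \<rho>"
proof (induction n arbitrary: x)
  case 0
  have "0 \<le> \<rho>" using assms[of 0] visit_prob_nonneg order_trans by blast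
  then show ?case by (simp add: visit_prob_0_left)
next
  case (Suc n)
  show ?case
  proof (cases "- x \<in> unit_steps")
    case True
    then show ?thesis using visit_prob_unit_step[of x "Suc n"] assms by simp
  next
    case False
    have "x + v \<noteq> 0" if "v \<in> unit_steps" for v
      using False that by (metis add_eq_0_iff)
    then have "visit_prob {0} (Suc n) x 1 \<le> (\<Sum>v\<in>(unit_steps :: (int ^ 'd) set). \<rho>) / real (card (unit_steps :: (int ^ 'd) set))"
      unfolding One_nat_def visit_prob_Suc
      using Suc.IH by (intro divide_right_mono sum_mono) auto
    then show ?thesis by (simp only: step_avg_const)
  qed
qed

lemma bij_betw_uminus_unit_steps: "bij_betw uminus unit_steps (unit_steps :: (int ^ 'd) set)"
  by (rule bij_betwI[of _ _ _ uminus]) auto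

lemma visit_prob_reflect: "visit_prob {x} n 0 i = visit_prob {0} n x i" for x :: "int ^ 'd"
  using visit_prob_image[OF bij_betw_uminus_unit_steps, of "\<lambda>y. x - y" "{x}" "{0}" n x i] by simp

lemma visit_prob_pair_reflect: "visit_prob {0, x} n x i = visit_prob {0, x} n 0 i" for x :: "int ^ 'd"
  using visit_prob_image[OF bij_betw_uminus_unit_steps, of "\<lambda>y. x - y" "{0, x}" "{0, x}" n 0 i]
  by auto

text \<open>Decompose at the first entrance into the pair: the entered site is hit for certain, and
  the other one afterwards with probability at least \<open>visit_prob {0} n x 1\<close>, by
  reflection from either site. The horizon \<open>n + k\<close> leaves \<open>n\<close> steps after
  an entrance within \<open>k\<close>.\<close>

lemma visit_prob_pair_split:
  fixes x y :: "int ^ 'd"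
  assumes "x \<noteq> 0"
  shows "visit_prob {0, x} k y 1 * (1 + visit_prob {0} n x 1)
    \<le> visit_prob {0} (n + k) y 1 + visit_prob {x} (n + k) y 1"
proof (induction k arbitrary: y)
  case 0
  show ?case by (simp add: visit_prob_0_left)
next
  case (Suc k)
  have mono: "visit_prob A n z i \<le> visit_prob A (n + k) z i" for A i and z :: "int ^ 'd"
    by (intro visit_prob_mono) simp
  have step: "(if y + v \<in> {0, x} then visit_prob {0, x} k (y + v) 0 else visit_prob {0, x} k (y + v) (Suc 0))
      * (1 + visit_prob {0} n x (Suc 0))
    \<le> (if y + v \<in> {0} then visit_prob {0} (n + k) (y + v) 0 else visit_prob {0} (n + k) (y + v) (Suc 0)) +
      (if y + v \<in> {x} then visit_prob {x} (n + k) (y + v) 0 else visit_prob {x} (n + k) (y + v) (Suc 0))" for v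
    using Suc.IH[of "y + v"] assms mono[of "{x}" 0 "Suc 0"] mono[of "{0}" x "Suc 0"]
      visit_prob_reflect[of x n "Suc 0"] by (cases "y + v = 0"; cases "y + v = x") simp_all
  show ?case
    unfolding One_nat_def add_Suc_right visit_prob_Suc[of _ k y] visit_prob_Suc[of _ "n + k" y]
      times_divide_eq_left sum_distrib_right add_divide_distrib[symmetric] sum.distrib[symmetric]
    by (intro divide_right_mono sum_mono step) simp
qed

lemma pair_return_prob_le:
  fixes x :: "int ^ 'd"
  assumes "x \<noteq> 0" and le: "\<And>n. return_prob TYPE('d) n \<le> \<rho>" and "\<rho> \<le> 1" and "a \<in> {0, x}"
  shows "visit_prob {0, x} k a 1 \<le> 2 * \<rho> / (1 + \<rho>)"
proof -
  define h where "h n = visit_prob {0} n x 1" for n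
  define q where "q = visit_prob {0, x} k 0 1"
  have \<rho>: "0 \<le> \<rho>" using le[of 0] visit_prob_nonneg order_trans by blast
  have h_le: "h n \<le> \<rho>" for n unfolding h_def by (rule hit_prob_le[OF le])
  have "incseq h" unfolding h_def by (intro incseq_SucI visit_prob_Suc_le)
  then obtain l where l: "h \<longlonglongrightarrow> l" using incseq_convergent[of h \<rho>] h_le by blast
  have l_le: "l \<le> \<rho>" using l h_le by (intro LIMSEQ_le_const2[OF l]) auto
  have l0: "0 \<le> l" by (intro LIMSEQ_le_const[OF l]) (auto simp: h_def)
  \<comment> \<open>The hitting probability occurs at the horizons \<open>n\<close> and
    \<open>n + k\<close>; they agree only in the limit of large \<open>n\<close>, taken with
    \<open>k\<close> fixed.\<close>
  have "q * (1 + h n) \<le> h (n + k) + \<rho>" for n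
    using visit_prob_pair_split[OF assms(1), of k 0 n] le[of "n + k"]
    visit_prob_reflect[of x "n + k" 1] unfolding q_def h_def by linarith
  moreover have "(\<lambda>n. q * (1 + h n)) \<longlonglongrightarrow> q * (1 + l)" by (intro tendsto_intros l)
  moreover have "(\<lambda>n. h (n + k) + \<rho>) \<longlonglongrightarrow> l + \<rho>"
    by (intro tendsto_intros LIMSEQ_ignore_initial_segment l)
  ultimately have "q * (1 + l) \<le> l + \<rho>" by (intro LIMSEQ_le) auto
  then have "q * (1 + \<rho>) * (1 + l) \<le> (l + \<rho>) * (1 + \<rho>)"
    using mult_right_mono[of "q * (1 + l)" "l + \<rho>" "1 + \<rho>"] \<rho> by (simp add: algebra_simps)
  \<comment> \<open>Since \<open>(l + \<rho>) / (1 + l)\<close> increases with \<open>l\<close> when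
    \<open>\<rho> \<le> 1\<close>, the limit \<open>l\<close> may be replaced by its bound
    \<open>\<rho>\<close>; with denominators cleared the slack is
    \<open>(\<rho> - l) * (1 - \<rho>)\<close>.\<close>
  also have "\<dots> = 2 * \<rho> * (1 + l) - (\<rho> - l) * (1 - \<rho>)" by (simp add: algebra_simps)
  also have "\<dots> \<le> 2 * \<rho> * (1 + l)" using l_le assms(3) by simp
  finally have "q * (1 + \<rho>) \<le> 2 * \<rho>" using l0 by simp
  then have "q \<le> 2 * \<rho> / (1 + \<rho>)" using \<rho> by (simp add: field_simps)
  then show ?thesis using assms(4) by (auto simp: q_def visit_prob_pair_reflect)
qed

lemma pair_visit_prob_le:
  fixes x :: "int ^ 'd"
  assumes "x \<noteq> 0" "\<And>n. return_prob TYPE('d) n \<le> \<rho>" "\<rho> \<le> 1"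
  shows "visit_prob {0, x} n 0 i \<le> (2 * \<rho> / (1 + \<rho>)) ^ i"
proof -
  have "0 \<le> \<rho>" using assms(2)[of 0] visit_prob_nonneg order_trans by blast
  then show ?thesis
    by (intro visit_prob_le_power pair_return_prob_le[OF assms]) auto
qed

subsection \<open>Decay of return probabilities\<close>

lemma card_unit_steps: "card (unit_steps :: (int ^ 'd) set) = 2 * CARD('d)"
  and sum_unit_steps: "(\<Sum>v\<in>(unit_steps :: (int ^ 'd) set). f v) = (\<Sum>i\<in>UNIV. f (axis i 1) + f (axis i (-1)) :: real)"
proof -
  have inj: "inj (\<lambda>i :: 'd. axis i a :: int ^ 'd)" if "a \<noteq> 0" for a :: int
    using that by (intro injI) (simp add: axis_eq_axis)
  have disj: "(\<lambda>i. axis i 1 :: int ^ 'd) ` UNIV \<inter> (\<lambda>i. axis i (-1)) ` UNIV = {}"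
    by (auto simp: axis_eq_axis)
  show "card (unit_steps :: (int ^ 'd) set) = 2 * CARD('d)"
    unfolding unit_steps_eq by (subst card_Un_disjoint) (simp_all add: disj card_image inj)
  show "(\<Sum>v\<in>(unit_steps :: (int ^ 'd) set). f v) = (\<Sum>i\<in>UNIV. f (axis i 1) + f (axis i (-1)))"
    unfolding unit_steps_eq
    by (subst sum.union_disjoint) (simp_all add: disj sum.reindex inj sum.distrib)
qed

text \<open>The law of one coordinate in its own clock, that is, after \<open>n\<close> steps along
  its axis.\<close>

primrec line_walk :: "nat \<Rightarrow> int \<Rightarrow> real" where
  "line_walk 0 y = of_bool (y = 0)"
| "line_walk (Suc n) y = (line_walk n (y - 1) + line_walk n (y + 1)) / 2"

lemma line_walk_nonneg: "0 \<le> line_walk n y"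
  by (induction n arbitrary: y) auto

lemma line_walk_le_1: "line_walk n y \<le> 1"
proof (induction n arbitrary: y)
  case (Suc n)
  show ?case using Suc[of "y - 1"] Suc[of "y + 1"] by simp
qed simp

lemma line_walk_outside: "int n < \<bar>y\<bar> \<Longrightarrow> line_walk n y = 0"
  by (induction n arbitrary: y) auto

lemma line_walk_odd: "odd (int n + y) \<Longrightarrow> line_walk n y = 0"
  by (induction n arbitrary: y) auto

lemma line_walk_eq_choose: "line_walk n (2 * int m - int n) = real (n choose m) / 2 ^ n"
proof (induction n arbitrary: m)
  case 0
  show ?case by (cases m) auto
next
  case (Suc n)
  show ?case
  proof (cases m)
    case 0
    have "line_walk n (- int n - 2) = 0" by (rule line_walk_outside) simp
    moreover have "line_walk n (- int n) = 1 / 2 ^ n" using Suc[of 0] by simp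
    ultimately show ?thesis using 0 by (simp add: algebra_simps)
  next
    case m: (Suc k)
    have "2 * int m - int (Suc n) - 1 = 2 * int k - int n" "2 * int m - int (Suc n) + 1 = 2 * int m - int n"
      using m by simp_all
    then have "line_walk (Suc n) (2 * int m - int (Suc n)) = (real (n choose k) / 2 ^ n + real (n choose m) / 2 ^ n) / 2"
      unfolding line_walk.simps using Suc[of k] Suc[of m] by (simp only:)
    then show ?thesis using m by (simp add: add_divide_distrib)
  qed
qed

text \<open>A Wallis product: \<open>a k = (2 k choose k) / 4 ^ k\<close> satisfies
  \<open>a (k + 1) = a k * (2 k + 1) / (2 k + 2)\<close>, and
  \<open>(2 k + 1) * (2 k + 3) \<le> (2 k + 2) ^ 2\<close> makes \<open>a k ^ 2 * (2 k + 1)\<close>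
  nonincreasing from the value 1. Odd times are excluded by parity.\<close>

lemma line_walk_return_sq: "(line_walk n 0)\<^sup>2 \<le> 1 / (real n + 1)"
proof (cases "even n")
  case False
  then have "line_walk n 0 = 0" by (intro line_walk_odd) simp
  then show ?thesis by simp
next
  case True
  then obtain k where n: "n = 2 * k" by blast
  have "(real (2 * k choose k) / 2 ^ (2 * k))\<^sup>2 * (2 * real k + 1) \<le> 1"
  proof (induction k)
    case (Suc k)
    define c where "c = real (2 * k choose k) / 2 ^ (2 * k)"
    define B where "B = (2 * Suc k choose Suc k)"
    have B: "B = (Suc (Suc (2 * k)) choose Suc k)" by (simp add: B_def)
    have "Suc k * B = Suc (Suc (2 * k)) * (Suc (2 * k) choose k)"
      unfolding B using Suc_times_binomial_eq[of "Suc (2 * k)" k] by (simp only: mult.commute)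
    then have "Suc k * (Suc k * B) = Suc k * (Suc (Suc (2 * k)) * (Suc (2 * k) choose k))"
      by (simp only:)
    also have "\<dots> = Suc (Suc (2 * k)) * (Suc k * (Suc (2 * k) choose Suc k))"
      using binomial_symmetric[of k "Suc (2 * k)"] by (simp add: Suc_diff_le)
    also have "\<dots> = Suc k * (2 * (Suc (2 * k) * (2 * k choose k)))"
      using Suc_times_binomial_eq[of "2 * k" k] by (simp only: mult.commute) simp
    finally have "Suc k * B = 2 * (Suc (2 * k) * (2 * k choose k))"
      by (simp only: mult_cancel1) simp
    then have "real (Suc k * B) = real (2 * (Suc (2 * k) * (2 * k choose k)))" by (simp only:)
    then have "(2 * real k + 2) * real B = 4 * (2 * real k + 1) * real (2 * k choose k)" by (simp add: algebra_simps)
    then have "real B = 4 * (2 * real k + 1) * real (2 * k choose k) / (2 * real k + 2)" by (simp add: field_simps)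
    then have eq: "real (2 * Suc k choose Suc k) / 2 ^ (2 * Suc k) = c * ((2 * real k + 1) / (2 * real k + 2))"
      unfolding B_def[symmetric] c_def by (simp add: divide_simps)
    have "(c * ((2 * real k + 1) / (2 * real k + 2)))\<^sup>2 * (2 * real (Suc k) + 1)
      = (c\<^sup>2 * (2 * real k + 1)) * (((2 * real k + 1) * (2 * real k + 3)) / (2 * real k + 2)\<^sup>2)"
      by (simp add: power2_eq_square field_simps)
    also have "\<dots> \<le> 1 * 1"
    proof (intro mult_mono)
      show "c\<^sup>2 * (2 * real k + 1) \<le> 1" using Suc by (simp add: c_def)
      have "(2 * real k + 1) * (2 * real k + 3) \<le> (2 * real k + 2)\<^sup>2"
        by (simp add: power2_eq_square algebra_simps)
      then show "(2 * real k + 1) * (2 * real k + 3) / (2 * real k + 2)\<^sup>2 \<le> 1"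
        by (intro divide_le_eq_1_pos[THEN iffD2]) auto
    qed auto
    finally show ?case using eq by simp
  qed simp
  moreover have "line_walk n 0 = real (2 * k choose k) / 2 ^ (2 * k)"
    using line_walk_eq_choose[of n k] by (simp add: n)
  ultimately show ?thesis by (simp add: n pos_le_divide_eq)
qed

lemma line_walk_return_le: "line_walk n 0 \<le> sqrt (1 / (real n + 1))"
  using line_walk_return_sq by (rule real_le_rsqrt)

text \<open>\<open>coord_avg n\<close> averages over the numbers of steps taken along each axis, a multinomial vector.\<close>

primrec coord_avg :: "nat \<Rightarrow> (('d::finite \<Rightarrow> nat) \<Rightarrow> real) \<Rightarrow> real" where
  "coord_avg 0 f = f (\<lambda>_. 0)"
| "coord_avg (Suc n) f = (\<Sum>i\<in>UNIV. coord_avg n (\<lambda>N. f (N(i := Suc (N i))))) / real CARD('d)"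

lemma coord_avg_mono: "(\<And>N. f N \<le> g N) \<Longrightarrow> coord_avg n f \<le> coord_avg n g"
  by (induction n arbitrary: f g) (auto intro!: divide_right_mono sum_mono)

lemma coord_avg_add: "coord_avg n (\<lambda>N. f N + g N) = coord_avg n f + coord_avg n g"
  by (induction n arbitrary: f g) (simp_all add: sum.distrib add_divide_distrib)

lemma coord_avg_cmult: "coord_avg n (\<lambda>N. c * f N) = c * coord_avg n f"
  by (induction n arbitrary: f) (simp_all flip: sum_distrib_left)

lemma coord_avg_const: "coord_avg n (\<lambda>N. c) = c"
  by (induction n) simp_all

lemma prob_sum_list_Suc:
  "path_prob (Suc n) (\<lambda>w. sum_list w = x) =
    (\<Sum>i\<in>UNIV. path_prob n (\<lambda>w. sum_list w = x - axis i 1) + path_prob n (\<lambda>w. sum_list w = x + axis i 1))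
      / (2 * real CARD('d))" for x :: "int ^ 'd"
proof -
  have "axis i (-1) = - axis i (1 :: int)" for i :: 'd by (simp add: axis_def vec_eq_iff)
  then show ?thesis
    unfolding path_prob_Suc card_unit_steps sum_unit_steps by (simp add: algebra_simps eq_diff_eq)
qed

lemma prob_sum_list_eq:
  "path_prob n (\<lambda>w. sum_list w = x) = coord_avg n (\<lambda>N. \<Prod>i\<in>UNIV. line_walk (N i) (x $ i))"
  for x :: "int ^ 'd"
proof (induction n arbitrary: x)
  case 0
  show ?case by (auto simp: path_prob_def vec_eq_iff)
next
  case (Suc n)
  \<comment> \<open>A step along axis \<open>i\<close> advances only the clock of that coordinate;
    its fair sign gives the two halves.\<close>
  have split: "(\<Prod>k\<in>UNIV. line_walk ((N(i := Suc (N i))) k) (x $ k)) =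
     1 / 2 * (\<Prod>k\<in>UNIV. line_walk (N k) ((x - axis i 1) $ k)) +
     1 / 2 * (\<Prod>k\<in>UNIV. line_walk (N k) ((x + axis i 1) $ k))" for N :: "'d \<Rightarrow> nat" and i
  proof -
    have "(\<Prod>k\<in>UNIV - {i}. line_walk ((N(i := Suc (N i))) k) (x $ k)) = (\<Prod>k\<in>UNIV - {i}. line_walk (N k) (x $ k))"
      "(\<Prod>k\<in>UNIV - {i}. line_walk (N k) ((x - axis i 1) $ k)) = (\<Prod>k\<in>UNIV - {i}. line_walk (N k) (x $ k))"
      "(\<Prod>k\<in>UNIV - {i}. line_walk (N k) ((x + axis i 1) $ k)) = (\<Prod>k\<in>UNIV - {i}. line_walk (N k) (x $ k))"
      by (auto intro!: prod.cong simp: axis_def)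
    then show ?thesis
      by (simp add: prod.remove[of UNIV i] axis_def algebra_simps)
  qed
  show ?case
    unfolding prob_sum_list_Suc coord_avg.simps split coord_avg_add coord_avg_cmult Suc
    by (simp add: sum_divide_distrib add_divide_distrib)
qed

text \<open>Size biasing of the multinomial vector: the left side marks one of the
  \<open>N i\<close> steps along axis \<open>i\<close>. Each of the \<open>n + 1\<close> steps has
  axis \<open>i\<close> with probability \<open>1 / CARD('d)\<close>, and the unmarked ones form a
  vector for \<open>n\<close> steps.\<close>

lemma coord_avg_size_bias:
  fixes f :: "('d::finite \<Rightarrow> nat) \<Rightarrow> real"
  shows "coord_avg (Suc n) (\<lambda>N. real (N i) * f N) = (real n + 1) / real CARD('d) * coord_avg n (\<lambda>N. f (N(i := Suc (N i))))"
proof (induction n arbitrary: f)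
  case 0
  have "(\<Sum>j\<in>UNIV. real (((\<lambda>_. 0)(j := Suc 0)) i) * f ((\<lambda>_. 0)(j := Suc 0))) = f ((\<lambda>_. 0)(i := Suc 0))"
    by (subst sum.remove[of _ i]) (auto intro: sum.neutral)
  then show ?case by (simp add: fun_upd_def)
next
  case (Suc n)
  let ?D = "real CARD('d)"
  define e where "e = (\<lambda>j (N :: 'd \<Rightarrow> nat). N(j := Suc (N j)))"
  have e: "N(j := Suc (N j)) = e j N" for j N by (simp add: e_def)
  have comm: "e j (e i N) = e i (e j N)" for j N by (auto simp: e_def fun_eq_iff)
  have "real (e j N i) * f (e j N) = real (N i) * f (e j N) + of_bool (j = i) * f (e i N)" for j N
    by (auto simp: e_def algebra_simps)
  then have "coord_avg (Suc (Suc n)) (\<lambda>N. real (N i) * f N) =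
     (\<Sum>j\<in>UNIV. coord_avg (Suc n) (\<lambda>N. real (N i) * f (e j N)) + of_bool (j = i) * coord_avg (Suc n) (\<lambda>N. f (e i N))) / ?D"
    unfolding coord_avg.simps(2)[of "Suc n"] e by (simp only: coord_avg_add coord_avg_cmult)
  also have "\<dots> = (\<Sum>j\<in>UNIV. coord_avg (Suc n) (\<lambda>N. real (N i) * f (e j N))) / ?D + coord_avg (Suc n) (\<lambda>N. f (e i N)) / ?D"
  proof -
    have "(\<Sum>j\<in>UNIV. of_bool (j = i) * c) = c" for c :: real
      by (subst sum.remove[of _ i]) (auto intro: sum.neutral)
    then show ?thesis by (simp only: sum.distrib add_divide_distrib)
  qed
  also have "(\<Sum>j\<in>UNIV. coord_avg (Suc n) (\<lambda>N. real (N i) * f (e j N))) / ?D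
     = (real n + 1) / ?D * coord_avg (Suc n) (\<lambda>N. f (e i N))"
    unfolding Suc.IH e coord_avg.simps(2)[of n] comm by (simp add: sum_distrib_left)
  finally show ?case unfolding e by (simp add: field_simps del: coord_avg.simps)
qed

text \<open>Size biasing read from right to left: \<open>1 / (N i + 1)\<close> after
  \<open>n\<close> steps becomes \<open>N i / N i \<le> 1\<close> after \<open>n + 1\<close> steps,
  so each factor contributes \<open>CARD('d) / (n + 1)\<close>.\<close>

lemma coord_avg_prod_le:
  fixes F :: "'d::finite set"
  shows "coord_avg n (\<lambda>N. \<Prod>i\<in>F. 1 / (real (N i) + 1)) \<le> (real CARD('d) / (real n + 1)) ^ card F"
proof (induction F arbitrary: n rule: finite_induct[OF finite])
  case 1
  show ?case by (simp add: coord_avg_const)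
next
  case (2 i F)
  let ?g = "\<lambda>N :: 'd \<Rightarrow> nat. \<Prod>k\<in>F. 1 / (real (N k) + 1)"
  let ?D = "real CARD('d)"
  have upd: "?g (N(i := Suc (N i))) = ?g N" for N
    using 2(2) by (intro prod.cong) auto
  have "coord_avg n (\<lambda>N. \<Prod>k\<in>insert i F. 1 / (real (N k) + 1))
     = coord_avg n (\<lambda>N. ?g (N(i := Suc (N i))) / real ((N(i := Suc (N i))) i))"
    using 2(1,2) upd by (simp add: mult.commute add.commute)
  also have "\<dots> = ?D / (real n + 1) * coord_avg (Suc n) (\<lambda>N. real (N i) * (?g N / real (N i)))"
    unfolding coord_avg_size_bias by simp
  \<comment> \<open>The averaged product equals \<open>?g N\<close> except at
    \<open>N i = 0\<close>, where division by zero makes it 0.\<close>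
  also have "\<dots> \<le> ?D / (real n + 1) * coord_avg (Suc n) ?g"
    by (intro mult_left_mono coord_avg_mono) (auto intro!: prod_nonneg)
  also have "\<dots> \<le> ?D / (real n + 1) * (?D / (real (Suc n) + 1)) ^ card F"
    by (intro mult_left_mono 2) auto
  also have "\<dots> \<le> ?D / (real n + 1) * (?D / (real n + 1)) ^ card F"
    by (intro mult_left_mono power_mono divide_left_mono) auto
  finally show ?case using 2(1,2) by simp
qed

text \<open>Given the numbers of steps along each axis the coordinates are independent; keeping three of
  them and averaging with \<open>2 * sqrt y \<le> y / a + a\<close> gives the decay \<open>n powr (- 3 / 2)\<close>.\<close>

lemma prob_return_le:
  assumes "CARD('d) \<ge> 3"
  shows "path_prob n (\<lambda>w :: (int ^ 'd) list. sum_list w = 0) \<le> sqrt ((real CARD('d) / (real n + 1)) ^ 3)"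
proof -
  obtain F :: "'d set" where F: "card F = 3" using obtain_subset_with_card_n[OF assms] by blast
  define a where "a = sqrt ((real CARD('d) / (real n + 1)) ^ 3)"
  have a: "a > 0" "(real CARD('d) / (real n + 1)) ^ 3 = a\<^sup>2" by (simp_all add: a_def)
  let ?g = "\<lambda>N :: 'd \<Rightarrow> nat. \<Prod>i\<in>F. 1 / (real (N i) + 1)"
  have "(\<Prod>i\<in>UNIV. line_walk (N i) ((0 :: int ^ 'd) $ i)) \<le> 1 / (2 * a) * ?g N + a / 2" for N
  proof -
    have "(\<Prod>i\<in>UNIV. line_walk (N i) ((0 :: int ^ 'd) $ i)) = (\<Prod>i\<in>F. line_walk (N i) 0) * (\<Prod>i\<in>-F. line_walk (N i) 0)"
      by (subst prod.union_disjoint[symmetric]) auto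
    also have "\<dots> \<le> (\<Prod>i\<in>F. sqrt (1 / (real (N i) + 1))) * 1"
      by (intro mult_mono prod_mono prod_le_1 prod_nonneg conjI line_walk_nonneg line_walk_le_1 line_walk_return_le) auto
    also have "\<dots> = sqrt (?g N)"
      by (induction F rule: infinite_finite_induct) (simp_all flip: real_sqrt_mult)
    also have "\<dots> \<le> 1 / (2 * a) * ?g N + a / 2"
    proof -
      have g: "0 \<le> ?g N" by (intro prod_nonneg) auto
      define r where "r = sqrt (?g N)"
      have r: "r\<^sup>2 = ?g N" using g by (simp add: r_def)
      have "2 * a * r \<le> r\<^sup>2 + a\<^sup>2" using sum_squares_bound[of r a] by (simp add: mult_ac)
      then have "2 * a * sqrt (?g N) \<le> ?g N + a\<^sup>2" unfolding r unfolding r_def .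
      then show ?thesis using a(1) by (simp add: field_simps power2_eq_square)
    qed
    finally show ?thesis .
  qed
  then have "path_prob n (\<lambda>w :: (int ^ 'd) list. sum_list w = 0) \<le> coord_avg n (\<lambda>N. 1 / (2 * a) * ?g N + a / 2)"
    unfolding prob_sum_list_eq by (rule coord_avg_mono)
  also have "\<dots> = 1 / (2 * a) * coord_avg n ?g + a / 2"
    by (simp only: coord_avg_add coord_avg_cmult coord_avg_const)
  also have "\<dots> \<le> 1 / (2 * a) * a\<^sup>2 + a / 2"
    using coord_avg_prod_le[of n F] a F by (intro add_right_mono mult_left_mono) auto
  also have "\<dots> = a" using a(1) by (simp add: power2_eq_square)
  finally show ?thesis by (simp add: a_def)
qed

text \<open>Telescoping: \<open>(k + 1) powr (- 3 / 2) \<le> 2 * (1 / sqrt k - 1 / sqrt (k +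
  1))\<close>.\<close>

lemma sum_prob_return_le:
  assumes "CARD('d) \<ge> 3"
  shows "(\<Sum>k\<in>{m<..n}. path_prob k (\<lambda>w :: (int ^ 'd) list. sum_list w = 0)) \<le> 2 * sqrt (real CARD('d) ^ 3) / sqrt (real m + 1)"
proof -
  let ?c = "sqrt (real CARD('d) ^ 3)"
  have bound: "path_prob k (\<lambda>w :: (int ^ 'd) list. sum_list w = 0) \<le> 2 * ?c * (1 / sqrt (real k) - 1 / sqrt (real k + 1))"
    if "k \<ge> 1" for k
  proof -
    define x where "x = sqrt (real k)" define y where "y = sqrt (real k + 1)"
    have xy: "0 < x" "x \<le> y" "y\<^sup>2 = x\<^sup>2 + 1" using that by (auto simp: x_def y_def)
    have "1 / y ^ 3 \<le> 2 * (1 / x - 1 / y)"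
    proof -
      have "(y - x) * (y + x) = 1" using xy by (simp add: power2_eq_square algebra_simps)
      then have "1 \<le> (y - x) * (2 * y)" using xy mult_left_mono[of "y + x" "2 * y" "y - x"] by simp
      then have "x \<le> (y - x) * (2 * y) * x" using xy by simp
      also have "\<dots> \<le> (y - x) * (2 * y) * y" using xy by (intro mult_left_mono) auto
      finally have "x / (x * y ^ 3) \<le> (y - x) * (2 * y) * y / (x * y ^ 3)"
        using xy by (intro divide_right_mono) auto
      then show ?thesis using xy by (simp add: divide_simps power3_eq_cube) (simp add: algebra_simps)
    qed
    moreover have "sqrt ((real CARD('d) / (real k + 1)) ^ 3) = ?c * (1 / y ^ 3)"
      by (simp add: y_def power_divide real_sqrt_divide real_sqrt_power)
    ultimately show ?thesis
      using prob_return_le[OF assms, of k] mult_left_mono[of "1 / y ^ 3" "2 * (1 / x - 1 / y)" ?c]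
      by (simp add: x_def y_def algebra_simps)
  qed
  have "(\<Sum>k\<in>{m<..n}. path_prob k (\<lambda>w :: (int ^ 'd) list. sum_list w = 0)) \<le> 2 * ?c * (1 / sqrt (real m + 1) - 1 / sqrt (real n + 1))" if "m \<le> n" for n
    using that
  proof (induction n rule: dec_induct)
    case (step n)
    have "{m<..Suc n} = insert (Suc n) {m<..n}" using step by auto
    then show ?case using step bound[of "Suc n"] by (simp add: algebra_simps)
  qed simp
  then have "(\<Sum>k\<in>{m<..n}. path_prob k (\<lambda>w :: (int ^ 'd) list. sum_list w = 0)) \<le> 2 * ?c * (1 / sqrt (real m + 1) - 1 / sqrt (real n + 1))" if "m \<le> n"
    using that by blast
  also have "\<dots> \<le> 2 * ?c * (1 / sqrt (real m + 1))" by (intro mult_left_mono) auto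
  finally have "m \<le> n \<Longrightarrow> ?thesis" by simp
  then show ?thesis by (cases "m \<le> n") simp_all
qed

subsection \<open>First visits and visits in a window\<close>

definition pos :: "(int ^ 'd) list \<Rightarrow> nat \<Rightarrow> int ^ 'd" where
  "pos w k = sum_list (take k w)"

definition fresh :: "(int ^ 'd) list \<Rightarrow> nat \<Rightarrow> bool" where
  "fresh w k \<longleftrightarrow> (\<forall>j<k. pos w j \<noteq> pos w k)"

text \<open>Time \<open>k\<close> itself belongs to the window, so the cardinality exceeds the
  number of returns by one; hence \<open>i < card\<close> here corresponds to
  \<open>i \<le> visits\<close>.\<close>

definition revisits :: "(int ^ 'd) list \<Rightarrow> nat \<Rightarrow> nat \<Rightarrow> nat set" where
  "revisits w k L = {j \<in> {k..k + L}. pos w j = pos w k}"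

lemma finite_revisits [simp]: "finite (revisits w k L)"
  by (simp add: revisits_def)

lemma card_revisits_le: "card (revisits w k L) \<le> Suc L"
proof -
  have "card (revisits w k L) \<le> card {k..k + L}" by (intro card_mono) (auto simp: revisits_def)
  then show ?thesis by simp
qed

lemma pos_0 [simp]: "pos w 0 = 0"
  by (simp add: pos_def)

lemma pos_Cons [simp]: "pos (v # w) (Suc k) = v + pos w k"
  by (simp add: pos_def)

lemma pos_add: "pos w (k + j) = pos w k + pos (drop k w) j"
  by (simp add: pos_def take_add)

lemma pos_take: "j \<le> k \<Longrightarrow> pos (take k w) j = pos w j"
  by (simp add: pos_def min_def)

lemma visits_eq_card: "visits A x w = card {j \<in> {1..length w}. x + pos w j \<in> A}"
proof (induction w arbitrary: x)
  case (Cons v w)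
  have "{j \<in> {1..length (v # w)}. x + pos (v # w) j \<in> A}
     = (if x + v \<in> A then {1} else {}) \<union> Suc ` {j \<in> {1..length w}. x + v + pos w j \<in> A}"
    (is "?L = ?R")
  proof (rule set_eqI)
    fix j
    show "j \<in> ?L \<longleftrightarrow> j \<in> ?R"
    proof (cases j)
      case (Suc i)
      then show ?thesis by (cases i) (auto simp: add.assoc)
    qed auto
  qed
  also have "card \<dots> = visits A x (v # w)"
    by (subst card_Un_disjoint) (auto simp: card_image Cons)
  finally show ?case by simp
qed simp

lemma one_le_visits_iff: "1 \<le> visits A x w \<longleftrightarrow> (\<exists>j\<in>{1..length w}. x + pos w j \<in> A)"
proof -
  have "1 \<le> card S \<longleftrightarrow> S \<noteq> {}" if "finite S" for S :: "nat set"
    using that card_gt_0_iff[of S] by (simp add: Suc_le_eq)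
  then have "1 \<le> visits A x w \<longleftrightarrow> {j \<in> {1..length w}. x + pos w j \<in> A} \<noteq> {}"
    unfolding visits_eq_card by simp
  then show ?thesis by blast
qed

lemma card_window:
  assumes "k + L \<le> length w" "0 \<in> A"
  shows "card {j \<in> {k..k + L}. pos w j - pos w k \<in> A} = Suc (visits A 0 (take L (drop k w)))"
proof -
  let ?V = "{j \<in> {1..L}. pos (drop k w) j \<in> A}"
  have "{j \<in> {k..k + L}. pos w j - pos w k \<in> A} = insert k ((+) k ` ?V)" (is "?L = ?R")
  proof (rule set_eqI)
    fix j
    show "j \<in> ?L \<longleftrightarrow> j \<in> ?R"
    proof (cases "k < j")
      case True
      then obtain i where "j = k + i" "i \<ge> 1" by (metis less_iff_Suc_add add_Suc_right le_add1 plus_1_eq_Suc)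
      then show ?thesis by (auto simp: pos_add)
    qed (use assms(2) in auto)
  qed
  also have "card \<dots> = Suc (card ?V)"
    by (subst card_insert_disjoint) (auto simp: card_image)
  also have "?V = {j \<in> {1..length (take L (drop k w))}. 0 + pos (take L (drop k w)) j \<in> A}"
    using assms(1) by (auto simp: pos_take)
  finally show ?thesis by (simp only: visits_eq_card)
qed

lemma card_revisits:
  "k + L \<le> length w \<Longrightarrow> card (revisits w k L) = Suc (visits {0} 0 (take L (drop k w)))"
  using card_window[of k L w "{0}"] by (simp add: revisits_def)

lemma path_prob_window:
  assumes "k + L \<le> n"
  shows "path_prob n (\<lambda>w. P (take k w) \<and> Q (take L (drop k w))) = path_prob k P * path_prob L Q"
  using path_prob_append[of k "n - k" P "\<lambda>w. Q (take L w)"] path_prob_take[of L "n - k - L" Q] assms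
  by simp

lemma path_prob_window':
  "k + L \<le> n \<Longrightarrow> path_prob n (\<lambda>w. Q (take L (drop k w))) = path_prob L Q"
  using path_prob_window[of k L n "\<lambda>_. True" Q] by (simp add: path_prob_def)

text \<open>Read backwards from time \<open>k\<close>, a first visit is the absence of a return.\<close>

lemma fresh_rev:
  assumes "length w = k"
  shows "fresh (rev w) k \<longleftrightarrow> \<not> 1 \<le> visits {0} 0 w"
proof -
  have sum_rev: "sum_list (rev u) = sum_list u" for u :: "(int ^ 'd) list"
    by (induction u) (simp_all add: add.commute)
  have "pos (rev w) j = pos (rev w) k \<longleftrightarrow> pos w (k - j) = 0" if "j < k" for j
  proof -
    have "pos (rev w) k = sum_list w" "pos (rev w) j = sum_list (drop (k - j) w)"
      using assms by (simp_all add: pos_def sum_rev take_rev)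
    moreover have "sum_list w = sum_list (take (k - j) w) + sum_list (drop (k - j) w)"
      by (metis append_take_drop_id sum_list_append)
    ultimately show ?thesis by (auto simp: pos_def)
  qed
  then have "fresh (rev w) k \<longleftrightarrow> (\<forall>j<k. pos w (k - j) \<noteq> 0)" by (simp add: fresh_def)
  also have "\<dots> \<longleftrightarrow> (\<forall>j\<in>{1..k}. pos w j \<noteq> 0)"
  proof (intro iffI ballI allI impI)
    fix j assume "\<forall>j<k. pos w (k - j) \<noteq> 0" "j \<in> {1..k}"
    then show "pos w j \<noteq> 0" by (auto dest!: spec[of _ "k - j"])
  qed auto
  also have "\<dots> \<longleftrightarrow> \<not> 1 \<le> visits {0} 0 w"
    using assms unfolding one_le_visits_iff by auto
  finally show ?thesis .
qed

lemma prob_fresh: "path_prob k (\<lambda>w :: (int ^ 'd) list. fresh w k) = 1 - return_prob TYPE('d) k"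
proof -
  have "path_prob k (\<lambda>w :: (int ^ 'd) list. fresh w k) = path_prob k (\<lambda>w :: (int ^ 'd) list. fresh (rev w) k)"
    unfolding path_prob_def by (rule path_expect_rev[symmetric])
  also have "\<dots> = path_prob k (\<lambda>w :: (int ^ 'd) list. \<not> 1 \<le> visits {0} 0 w)"
    by (intro path_prob_cong fresh_rev) (auto simp: step_lists_def)
  finally show ?thesis by (simp add: path_prob_compl visit_prob_def)
qed

text \<open>A first visit at \<open>k\<close> is decided by the steps before \<open>k\<close>, the
  number of revisits by the \<open>L\<close> steps after it, so the probability is an exact
  product.\<close>

lemma prob_fresh_revisits:
  assumes "k + L \<le> n"
  shows "path_prob n (\<lambda>w :: (int ^ 'd) list. fresh w k \<and> i < card (revisits w k L)) =
    (1 - return_prob TYPE('d) k) * visit_prob {0} L (0 :: int ^ 'd) i"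
proof -
  have "path_prob n (\<lambda>w :: (int ^ 'd) list. fresh w k \<and> i < card (revisits w k L))
    = path_prob n (\<lambda>w :: (int ^ 'd) list. fresh (take k w) k \<and> i \<le> visits {0} 0 (take L (drop k w)))"
    using assms by (intro path_prob_cong) (auto simp: step_lists_def card_revisits fresh_def pos_take)
  then show ?thesis
    using path_prob_window[OF assms, of "\<lambda>w. fresh w k" "\<lambda>w. i \<le> visits {0} (0 :: int ^ 'd) w"]
    by (simp add: prob_fresh visit_prob_def)
qed

text \<open>Revisits depend only on the steps inside their window, and these two blocks of steps are
  disjoint. The two sites may well coincide.\<close>

lemma prob_revisits_far:
  assumes "j + L \<le> k" "k + L \<le> n"
  shows "path_prob n (\<lambda>w :: (int ^ 'd) list. i < card (revisits w j L) \<and> i' < card (revisits w k L)) =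
    visit_prob {0} L (0 :: int ^ 'd) i * visit_prob {0} L (0 :: int ^ 'd) i'"
proof -
  have "path_prob n (\<lambda>w :: (int ^ 'd) list. i < card (revisits w j L) \<and> i' < card (revisits w k L))
    = path_prob n (\<lambda>w :: (int ^ 'd) list. i \<le> visits {0} 0 (take L (drop j (take k w))) \<and> i' \<le> visits {0} 0 (take L (drop k w)))"
    using assms by (intro path_prob_cong) (auto simp: step_lists_def card_revisits drop_take min_def)
  then show ?thesis
    using path_prob_window[OF assms(2), of "\<lambda>w. i \<le> visits {0} (0 :: int ^ 'd) (take L (drop j w))" "\<lambda>w. i' \<le> visits {0} (0 :: int ^ 'd) w"]
      path_prob_window'[OF assms(1), of "\<lambda>w. i \<le> visits {0} (0 :: int ^ 'd) w"]
    by (simp add: visit_prob_def)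
qed

definition coord_box :: "nat \<Rightarrow> (int ^ 'd) set" where
  "coord_box L = {x. \<forall>i. \<bar>x $ i\<bar> \<le> int L}"

lemma finite_coord_box: "finite (coord_box L :: (int ^ 'd) set)"
  and card_coord_box_le: "card (coord_box L :: (int ^ 'd) set) \<le> (2 * L + 1) ^ CARD('d)"
proof -
  let ?F = "PiE (UNIV :: 'd set) (\<lambda>_. {- int L..int L})"
  have sub: "coord_box L \<subseteq> (\<lambda>f. \<chi> i. f i) ` ?F"
  proof
    fix x :: "int ^ 'd" assume "x \<in> coord_box L"
    then have "($) x \<in> ?F" by (auto simp: coord_box_def abs_le_iff PiE_def minus_le_iff)
    then show "x \<in> (\<lambda>f. \<chi> i. f i) ` ?F" by (intro image_eqI[of _ _ "($) x"]) auto
  qed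
  have fin: "finite ?F" by (intro finite_PiE) auto
  show "finite (coord_box L :: (int ^ 'd) set)" using finite_subset[OF sub] fin by blast
  have "card (coord_box L :: (int ^ 'd) set) \<le> card ?F"
    using card_mono[OF _ sub] card_image_le[OF fin, of "\<lambda>f. (\<chi> i. f i) :: int ^ 'd"] fin by (meson finite_imageI order_trans)
  also have "card ?F = (2 * L + 1) ^ CARD('d)" by (simp add: card_PiE nat_add_distrib nat_mult_distrib)
  finally show "card (coord_box L :: (int ^ 'd) set) \<le> (2 * L + 1) ^ CARD('d)" .
qed

lemma sum_list_steps_in_coord_box:
  assumes "set w \<subseteq> unit_steps" "length w \<le> L"
  shows "sum_list w \<in> coord_box L"
proof -
  have "\<bar>sum_list w $ i\<bar> \<le> int (length w)" for i
    using assms(1)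
  proof (induction w)
    case (Cons v w)
    have "\<bar>v $ i\<bar> \<le> 1" using Cons.prems by (auto simp: unit_steps_def axis_def)
    then show ?case using Cons by auto
  qed simp
  also have "int (length w) \<le> int L" using assms(2) by simp
  finally show ?thesis by (simp add: coord_box_def)
qed

text \<open>The displacement \<open>x\<close> of the second site is not known when the first window
  opens, so a union is taken over a box of possible values, at polynomial cost. For fixed
  \<open>x\<close> both windows lie in one stretch of \<open>R\<close> steps from time
  \<open>j\<close>, in which the visits to the pair, seen from \<open>pos w j\<close>, are
  counted.\<close>

lemma prob_revisits_near:
  assumes "\<And>n. return_prob TYPE('d) n \<le> \<rho>" "\<rho> \<le> 1"
  assumes "j < k" "k \<le> j + L" "k + L \<le> n"
  shows "path_prob n (\<lambda>w :: (int ^ 'd) list. pos w j \<noteq> pos w k \<and> i < card (revisits w j L \<union> revisits w k L))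
    \<le> (2 * real L + 1) ^ CARD('d) * (2 * \<rho> / (1 + \<rho>)) ^ i"
proof -
  define R where "R = k + L - j"
  have R: "j + R = k + L" using assms(3) by (simp add: R_def)
  let ?B = "coord_box L - {0 :: int ^ 'd}"
  have \<rho>: "0 \<le> \<rho>" using assms(1)[of 0] visit_prob_nonneg order_trans by blast
  have "path_prob n (\<lambda>w :: (int ^ 'd) list. pos w j \<noteq> pos w k \<and> i < card (revisits w j L \<union> revisits w k L))
    \<le> path_prob n (\<lambda>w. \<exists>x\<in>?B. i \<le> visits {0, x} 0 (take R (drop j w)))"
  proof (rule path_prob_mono)
    fix w :: "(int ^ 'd) list"
    assume w: "w \<in> step_lists n" and ne: "pos w j \<noteq> pos w k \<and> i < card (revisits w j L \<union> revisits w k L)"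
    define x where "x = pos w k - pos w j"
    have "x = sum_list (take (k - j) (drop j w))"
      using pos_add[of w j "k - j"] assms(3) by (simp add: x_def pos_def)
    also have "\<dots> \<in> coord_box L"
    proof (rule sum_list_steps_in_coord_box)
      show "set (take (k - j) (drop j w)) \<subseteq> unit_steps"
        using w by (auto simp: step_lists_def dest!: in_set_takeD in_set_dropD)
    qed (use assms(4) in auto)
    finally have x: "x \<in> ?B" using ne by (auto simp: x_def)
    have "i < card (revisits w j L \<union> revisits w k L)" using ne by blast
    also have "\<dots> \<le> card {l \<in> {j..j + R}. pos w l - pos w j \<in> {0, x}}"
      using assms(3) R by (intro card_mono) (auto simp: revisits_def x_def)
    also have "\<dots> = Suc (visits {0, x} 0 (take R (drop j w)))"
      using w assms(5) R by (intro card_window) (auto simp: step_lists_def)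
    finally show "\<exists>x\<in>?B. i \<le> visits {0, x} 0 (take R (drop j w))" using x by (intro bexI[of _ x]) simp_all
  qed
  also have "\<dots> \<le> (\<Sum>x\<in>?B. path_prob n (\<lambda>w. i \<le> visits {0, x} 0 (take R (drop j w))))"
    by (intro path_prob_Un) (simp add: finite_coord_box)
  also have "\<dots> = (\<Sum>x\<in>?B. visit_prob {0, x} R 0 i)"
    unfolding visit_prob_def using R assms(5) by (intro sum.cong refl path_prob_window') simp
  also have "\<dots> \<le> (\<Sum>x\<in>?B. (2 * \<rho> / (1 + \<rho>)) ^ i)"
    by (intro sum_mono pair_visit_prob_le assms(1,2)) auto
  also have "\<dots> = real (card ?B) * (2 * \<rho> / (1 + \<rho>)) ^ i" by simp
  also have "\<dots> \<le> (2 * real L + 1) ^ CARD('d) * (2 * \<rho> / (1 + \<rho>)) ^ i"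
  proof (intro mult_right_mono)
    have "card ?B \<le> (2 * L + 1) ^ CARD('d)"
      using card_coord_box_le[where 'd = 'd, of L] card_mono[of "coord_box L" ?B] finite_coord_box[where 'd = 'd, of L] by fastforce
    then have "real (card ?B) \<le> real ((2 * L + 1) ^ CARD('d))" by (simp only: of_nat_le_iff)
    then show "real (card ?B) \<le> (2 * real L + 1) ^ CARD('d)" by (simp add: add.commute)
  qed (use \<rho> in auto)
  finally show ?thesis .
qed

subsection \<open>Transience\<close>

text \<open>A return after time \<open>k\<close> is charged to the expected number of visits to the
  origin after time \<open>k\<close>.\<close>

lemma return_prob_diff_le:
  assumes "CARD('d::finite) \<ge> 3" "k \<le> n"
  shows "return_prob TYPE('d) n \<le> return_prob TYPE('d) k + 2 * sqrt (real CARD('d) ^ 3) / sqrt (real k + 1)"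
proof -
  \<comment> \<open>The index 0 is a marker for a return by time \<open>k\<close>; it differs from
    every index in \<open>{k<..n}\<close>, so a single union bound serves both cases.\<close>
  have "return_prob TYPE('d) n \<le> path_prob n (\<lambda>w :: (int ^ 'd) list. \<exists>j\<in>insert 0 {k<..n}. if j = 0 then 1 \<le> visits {0} 0 (take k w) else pos w j = 0)"
    unfolding visit_prob_def
  proof (rule path_prob_mono)
    fix w :: "(int ^ 'd) list" assume w: "w \<in> step_lists n" and "1 \<le> visits {0} 0 w"
    then obtain j where j: "1 \<le> j" "j \<le> n" "pos w j = 0"
      unfolding one_le_visits_iff by (auto simp: step_lists_def)
    show "\<exists>j\<in>insert 0 {k<..n}. if j = 0 then 1 \<le> visits {0} 0 (take k w) else pos w j = 0"
    proof (cases "j \<le> k")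
      case True
      then have "1 \<le> visits {0} 0 (take k w)"
        unfolding one_le_visits_iff using j w assms(2) by (intro bexI[of _ j]) (auto simp: step_lists_def pos_take)
      then show ?thesis by auto
    next
      case False
      then show ?thesis using j by (intro bexI[of _ j]) auto
    qed
  qed
  also have "\<dots> \<le> (\<Sum>j\<in>insert 0 {k<..n}. path_prob n (\<lambda>w :: (int ^ 'd) list. if j = 0 then 1 \<le> visits {0} 0 (take k w) else pos w j = 0))"
    by (intro path_prob_Un) simp
  also have "\<dots> = path_prob n (\<lambda>w :: (int ^ 'd) list. 1 \<le> visits {0} 0 (take k w)) + (\<Sum>j\<in>{k<..n}. path_prob n (\<lambda>w :: (int ^ 'd) list. pos w j = 0))"
    by simp
  also have "path_prob n (\<lambda>w :: (int ^ 'd) list. 1 \<le> visits {0} 0 (take k w)) = return_prob TYPE('d) k"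
    unfolding visit_prob_def using path_prob_take[of k "n - k" "\<lambda>w :: (int ^ 'd) list. 1 \<le> visits {0} 0 w"] assms(2) by simp
  also have "(\<Sum>j\<in>{k<..n}. path_prob n (\<lambda>w :: (int ^ 'd) list. pos w j = 0)) = (\<Sum>j\<in>{k<..n}. path_prob j (\<lambda>w :: (int ^ 'd) list. sum_list w = 0))"
  proof (intro sum.cong refl)
    fix j assume "j \<in> {k<..n}"
    then show "path_prob n (\<lambda>w :: (int ^ 'd) list. pos w j = 0) = path_prob j (\<lambda>w :: (int ^ 'd) list. sum_list w = 0)"
      using path_prob_take[of j "n - j" "\<lambda>w :: (int ^ 'd) list. sum_list w = 0"] by (simp add: pos_def)
  qed
  also have "\<dots> \<le> 2 * sqrt (real CARD('d) ^ 3) / sqrt (real k + 1)"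
    by (rule sum_prob_return_le[OF assms(1)])
  finally show ?thesis by simp
qed

text \<open>Both sides are the expected number of returns by time \<open>n\<close>, computed from
  its tail probabilities and from the times of return.\<close>

lemma expected_visits:
  "(\<Sum>i\<in>{1..n}. visit_prob {0} n (0 :: int ^ 'd) i) = (\<Sum>k\<in>{0<..n}. path_prob k (\<lambda>w :: (int ^ 'd) list. sum_list w = 0))"
proof -
  have visits: "(\<Sum>i\<in>{1..n}. of_bool (i \<le> visits {0} 0 w)) = (\<Sum>k\<in>{0<..n}. of_bool (pos w k = 0) :: real)"
    if "w \<in> step_lists n" for w :: "(int ^ 'd) list"
  proof -
    have le: "visits {0} 0 w \<le> n"
    proof -
      have "card {j \<in> {1..length w}. 0 + pos w j \<in> {0}} \<le> card {1..length w}" by (intro card_mono) auto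
      then show ?thesis using that by (simp add: visits_eq_card step_lists_def)
    qed
    have "(\<Sum>i\<in>{1..n}. of_bool (i \<le> visits {0} 0 w) :: real) = real (card {i \<in> {1..n}. i \<le> visits {0} 0 w})"
      by (simp add: Int_def)
    also have "{i \<in> {1..n}. i \<le> visits {0} 0 w} = {1..visits {0} 0 w}" using le by auto
    also have "card \<dots> = card {j \<in> {0<..n}. pos w j = 0}"
      using that by (simp add: visits_eq_card step_lists_def Suc_le_eq)
    finally show ?thesis by (simp add: Int_def)
  qed
  have "(\<Sum>i\<in>{1..n}. visit_prob {0} n (0 :: int ^ 'd) i) = path_expect n (\<lambda>w :: (int ^ 'd) list. \<Sum>i\<in>{1..n}. of_bool (i \<le> visits {0} 0 w))"
    by (simp only: path_expect_sum visit_prob_def path_prob_def)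
  also have "\<dots> = path_expect n (\<lambda>w :: (int ^ 'd) list. \<Sum>k\<in>{0<..n}. of_bool (pos w k = 0))"
    by (intro path_expect_cong visits)
  also have "\<dots> = (\<Sum>k\<in>{0<..n}. path_prob n (\<lambda>w :: (int ^ 'd) list. pos w k = 0))"
    by (simp only: path_expect_sum path_prob_def)
  also have "\<dots> = (\<Sum>k\<in>{0<..n}. path_prob k (\<lambda>w :: (int ^ 'd) list. sum_list w = 0))"
  proof (intro sum.cong refl)
    fix k assume "k \<in> {0<..n}"
    then show "path_prob n (\<lambda>w :: (int ^ 'd) list. pos w k = 0) = path_prob k (\<lambda>w :: (int ^ 'd) list. sum_list w = 0)"
      using path_prob_take[of k "n - k" "\<lambda>w :: (int ^ 'd) list. sum_list w = 0"] by (simp add: pos_def)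
  qed
  finally show ?thesis .
qed

text \<open>If returns were certain in the limit, any number \<open>I\<close> of returns would be
  too, whereas the expected number of returns is at most \<open>C\<close> for every horizon.\<close>

lemma return_prob_limit_less_1:
  assumes "CARD('d::finite) \<ge> 3" and lim: "(\<lambda>n. return_prob TYPE('d) n) \<longlonglongrightarrow> \<rho>"
  shows "\<rho> < 1"
proof -
  define C where "C = 2 * sqrt (real CARD('d) ^ 3)"
  have "real I * return_prob TYPE('d) k ^ I \<le> C" for I k
  proof -
    have "real I * return_prob TYPE('d) k ^ I \<le> (\<Sum>i\<in>{1..I}. return_prob TYPE('d) k ^ i)"
      using sum_mono[of "{1..I}" "\<lambda>_. return_prob TYPE('d) k ^ I" "\<lambda>i. return_prob TYPE('d) k ^ i"]
      by (simp add: power_decreasing)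
    also have "\<dots> \<le> (\<Sum>i\<in>{1..I}. visit_prob {0} (I * k) (0 :: int ^ 'd) i)"
    proof (intro sum_mono)
      fix i assume "i \<in> {1..I}"
      then have "visit_prob {0} (i * k) (0 :: int ^ 'd) i \<le> visit_prob {0} (I * k) (0 :: int ^ 'd) i"
        by (intro visit_prob_mono) simp
      then show "return_prob TYPE('d) k ^ i \<le> visit_prob {0} (I * k) (0 :: int ^ 'd) i"
        using power_le_visit_prob[of "0 :: int ^ 'd" k i] by linarith
    qed
    \<comment> \<open>In \<open>expected_visits\<close> one number is both horizon and summation
      range; \<open>I + I * k\<close> is large enough for both roles.\<close>
    also have "\<dots> \<le> (\<Sum>i\<in>{1..I + I * k}. visit_prob {0} (I + I * k) (0 :: int ^ 'd) i)"
      by (intro order_trans[OF sum_mono[of _ _ "\<lambda>i. visit_prob {0} (I + I * k) (0 :: int ^ 'd) i"] sum_mono2] visit_prob_mono) auto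
    also have "\<dots> \<le> C / sqrt (real 0 + 1)"
      unfolding expected_visits C_def by (rule sum_prob_return_le[OF assms(1)])
    finally show ?thesis by simp
  qed
  then have bound: "real I * \<rho> ^ I \<le> C" for I
    by (intro LIMSEQ_le_const2[OF tendsto_mult[OF tendsto_const tendsto_power[OF lim]]]) auto
  show ?thesis
  proof (rule ccontr)
    assume "\<not> \<rho> < 1"
    then have "real I \<le> C" for I
      using bound[of I] mult_left_mono[of 1 "\<rho> ^ I" "real I"] by (simp add: one_le_power)
    then show False using reals_Archimedean2[of C] by (meson not_le)
  qed
qed

text \<open>One step out and one step back has positive probability. Thus
  \<open>\<gamma> < 1\<close>, and the logarithm defining \<open>\<alpha>\<close> is that of a
  positive number.\<close>

lemma return_prob_limit_pos:
  assumes "(\<lambda>n. return_prob TYPE('d::finite) n) \<longlonglongrightarrow> \<rho>"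
  shows "0 < \<rho>"
proof -
  obtain e :: "int ^ 'd" where e: "e \<in> unit_steps" using unit_steps_nonempty by blast
  have "0 < (\<Sum>v\<in>unit_steps. if e + v \<in> {0} then visit_prob {0} 0 (e + v) 0 else visit_prob {0} 0 (e + v) (Suc 0))"
    using e by (intro sum_pos2[of _ "- e"]) auto
  then have "0 < visit_prob {0} (Suc 0) e 1"
    unfolding One_nat_def visit_prob_Suc[of _ 0 e 0] by (intro divide_pos_pos) (simp_all only: of_nat_0_less_iff card_unit_steps_pos)
  also have "\<dots> = return_prob TYPE('d) 2"
    using visit_prob_unit_step[OF e, of 1] by (simp add: numeral_2_eq_2)
  also have "\<dots> \<le> \<rho>"
    by (intro LIMSEQ_le_const[OF assms] exI[of _ 2]) (auto intro: visit_prob_mono)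
  finally show ?thesis .
qed

lemma return_prob_le_limit:
  assumes "(\<lambda>n. return_prob TYPE('d::finite) n) \<longlonglongrightarrow> \<rho>"
  shows "return_prob TYPE('d) k \<le> \<rho>"
  by (intro LIMSEQ_le_const[OF assms] exI[of _ k]) (auto intro: visit_prob_mono)

lemma return_prob_tail_le:
  assumes "CARD('d::finite) \<ge> 3" and lim: "(\<lambda>n. return_prob TYPE('d) n) \<longlonglongrightarrow> \<rho>"
  shows "\<rho> \<le> return_prob TYPE('d) k + 2 * sqrt (real CARD('d) ^ 3) / sqrt (real k + 1)"
  using return_prob_diff_le[OF assms(1), of k] by (intro LIMSEQ_le_const2[OF lim]) auto

subsection \<open>First and second moment bounds\<close>

text \<open>Replaces a random range of summation by indicators over a fixed range, so that
  expectations can be taken term by term.\<close>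

lemma sum_lessThan_eq_of_bool:
  fixes p :: "nat \<Rightarrow> real"
  assumes "c \<le> Suc n"
  shows "(\<Sum>i<c. p i) = (\<Sum>i\<le>n. p i * of_bool (i < c))"
proof -
  have "(\<Sum>i\<le>n. p i * of_bool (i < c)) = (\<Sum>i\<in>{..n} \<inter> {i. i < c}. p i)"
    by (simp add: sum.inter_restrict of_bool_def if_distrib cong: if_cong)
  also have "{..n} \<inter> {i. i < c} = {..<c}" using assms by auto
  finally show ?thesis by simp
qed

lemma visit_prob_le_return_power:
  assumes "\<And>n. return_prob TYPE('d) n \<le> \<rho>"
  shows "visit_prob {0} n (0 :: int ^ 'd) i \<le> \<rho> ^ i"
proof -
  have "0 \<le> \<rho>" using assms[of 0] visit_prob_nonneg order_trans by blast
  then show ?thesis using assms by (intro visit_prob_le_power) auto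
qed

text \<open>In the applications \<open>p i\<close> is the increase in the exceedance probability
  when the number of summands grows from \<open>i\<close> to \<open>i + 1\<close>; it is weighted by
  the chance of at least \<open>i\<close> returns. The exact first-visit probabilities are kept,
  because their mean yields the sharp constant.\<close>

lemma path_expect_union_bound:
  fixes \<tau> :: "(int ^ 'd) list \<Rightarrow> real"
  assumes \<rho>: "\<And>n. return_prob TYPE('d) n \<le> \<rho>" and p: "\<And>i. 0 \<le> p i"
    and \<tau>: "\<And>w. w \<in> step_lists n \<Longrightarrow>
      \<tau> w \<le> (\<Sum>k\<le>n. of_bool (fresh w k) * (\<Sum>i<card (revisits w k (n - k)). p i))"
  shows "path_expect n \<tau> \<le> (\<Sum>k\<le>n. 1 - return_prob TYPE('d) k) * (\<Sum>i\<le>n. p i * \<rho> ^ i)"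
proof -
  have "path_expect n \<tau> \<le> path_expect n (\<lambda>w :: (int ^ 'd) list. \<Sum>k\<le>n. \<Sum>i\<le>n. p i * of_bool (fresh w k \<and> i < card (revisits w k (n - k))))"
  proof (intro path_expect_mono order_trans[OF \<tau>])
    fix w :: "(int ^ 'd) list"
    have c: "card (revisits w k (n - k)) \<le> Suc n" for k
      using card_revisits_le[of w k "n - k"] by linarith
    show "(\<Sum>k\<le>n. of_bool (fresh w k) * (\<Sum>i<card (revisits w k (n - k)). p i)) \<le>
       (\<Sum>k\<le>n. \<Sum>i\<le>n. p i * of_bool (fresh w k \<and> i < card (revisits w k (n - k))))"
      by (simp only: sum_lessThan_eq_of_bool[OF c] sum_distrib_left of_bool_conj mult_ac order_refl)
  qed
  also have "\<dots> = (\<Sum>k\<le>n. \<Sum>i\<le>n. p i * path_prob n (\<lambda>w :: (int ^ 'd) list. fresh w k \<and> i < card (revisits w k (n - k))))"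
    by (simp only: path_expect_sum path_expect_cmult path_prob_def)
  also have "\<dots> \<le> (\<Sum>k\<le>n. \<Sum>i\<le>n. p i * ((1 - return_prob TYPE('d) k) * \<rho> ^ i))"
  proof (intro sum_mono mult_left_mono p)
    fix k i assume "k \<in> {..n}"
    then show "path_prob n (\<lambda>w :: (int ^ 'd) list. fresh w k \<and> i < card (revisits w k (n - k))) \<le> (1 - return_prob TYPE('d) k) * \<rho> ^ i"
      using visit_prob_le_return_power[OF \<rho>, of "n - k" i]
      by (subst prob_fresh_revisits) (auto intro!: mult_left_mono)
  qed
  also have "\<dots> = (\<Sum>k\<le>n. 1 - return_prob TYPE('d) k) * (\<Sum>i\<le>n. p i * \<rho> ^ i)"
    by (simp only: sum_product) (simp add: mult_ac)
  finally show ?thesis .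
qed

text \<open>The three terms are first visits, disjoint windows, and overlapping windows at distinct
  sites. A first visit has probability at least \<open>1 - \<rho>\<close>; in the pair terms the
  first-visit condition is dropped. By \<open>m + L \<le> Suc n\<close> the last window, which
  starts at \<open>m - 1\<close>, ends within \<open>n\<close> steps.\<close>

lemma path_expect_bonferroni:
  fixes \<tau> :: "(int ^ 'd) list \<Rightarrow> real"
  assumes \<rho>: "\<And>n. return_prob TYPE('d) n \<le> \<rho>" "\<rho> \<le> 1"
    and p: "\<And>i. 0 \<le> p i" and p': "\<And>i. 0 \<le> p' i" and mL: "m + L \<le> Suc n"
    and \<tau>: "\<And>w. w \<in> step_lists n \<Longrightarrow>
      (\<Sum>k<m. of_bool (fresh w k) * (\<Sum>i<card (revisits w k L). p i))
      - (\<Sum>k<m. \<Sum>j<k. if j + L < k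
           then (\<Sum>i<card (revisits w j L). p i) * (\<Sum>i<card (revisits w k L). p i)
           else of_bool (pos w j \<noteq> pos w k) * (\<Sum>i<card (revisits w j L \<union> revisits w k L). p' i)) \<le> \<tau> w"
  shows "real m * (1 - \<rho>) * (\<Sum>i\<le>L. p i * visit_prob {0} L (0 :: int ^ 'd) i)
      - (real m)\<^sup>2 * (\<Sum>i\<le>L. p i * \<rho> ^ i)\<^sup>2
      - real m * real L * (2 * real L + 1) ^ CARD('d) * (\<Sum>i\<le>n. p' i * (2 * \<rho> / (1 + \<rho>)) ^ i)
    \<le> path_expect n \<tau>"
proof -
  let ?c = "\<lambda>w :: (int ^ 'd) list. \<lambda>k. card (revisits w k L)"
  let ?u = "\<lambda>w :: (int ^ 'd) list. \<lambda>j k. card (revisits w j L \<union> revisits w k L)"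
  define V where "V i = visit_prob {0} L (0 :: int ^ 'd) i" for i
  define A where "A = (\<Sum>i\<le>L. p i * \<rho> ^ i)"
  define B where "B = (2 * real L + 1) ^ CARD('d) * (\<Sum>i\<le>n. p' i * (2 * \<rho> / (1 + \<rho>)) ^ i)"
  have \<rho>0: "0 \<le> \<rho>" using \<rho>(1)[of 0] visit_prob_nonneg order_trans by blast
  have A0: "0 \<le> A" using p \<rho>0 by (auto simp: A_def intro!: sum_nonneg)
  have B0: "0 \<le> B" using p' \<rho>0 by (auto simp: B_def intro!: sum_nonneg mult_nonneg_nonneg)
  have V: "0 \<le> V i" "V i \<le> \<rho> ^ i" for i
    using visit_prob_le_return_power[OF \<rho>(1), of L i] by (simp_all add: V_def)
  have VA: "(\<Sum>i\<le>L. p i * V i) \<le> A" "0 \<le> (\<Sum>i\<le>L. p i * V i)"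
    using V p by (auto simp: A_def intro!: sum_mono mult_left_mono sum_nonneg)
  have phi: "(\<Sum>i<?c w k. p i) = (\<Sum>i\<le>L. p i * of_bool (i < ?c w k))" for w k
    by (intro sum_lessThan_eq_of_bool card_revisits_le)
  have single: "real m * (1 - \<rho>) * (\<Sum>i\<le>L. p i * V i)
    \<le> path_expect n (\<lambda>w. \<Sum>k<m. of_bool (fresh w k) * (\<Sum>i<?c w k. p i))"
  proof -
    have "path_expect n (\<lambda>w. \<Sum>k<m. of_bool (fresh w k) * (\<Sum>i<?c w k. p i))
      = path_expect n (\<lambda>w. \<Sum>k<m. \<Sum>i\<le>L. p i * of_bool (fresh w k \<and> i < ?c w k))"
      by (simp only: phi sum_distrib_left of_bool_conj mult_ac)
    also have "\<dots> = (\<Sum>k<m. \<Sum>i\<le>L. p i * path_prob n (\<lambda>w. fresh w k \<and> i < ?c w k))"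
      by (simp only: path_expect_sum path_expect_cmult path_prob_def)
    also have "\<dots> = (\<Sum>k<m. \<Sum>i\<le>L. p i * ((1 - return_prob TYPE('d) k) * V i))"
      using mL unfolding V_def by (intro sum.cong refl arg_cong2[where f = "(*)"] prob_fresh_revisits) auto
    finally have eq: "path_expect n (\<lambda>w. \<Sum>k<m. of_bool (fresh w k) * (\<Sum>i<?c w k. p i))
      = (\<Sum>k<m. \<Sum>i\<le>L. p i * ((1 - return_prob TYPE('d) k) * V i))" .
    have "(\<Sum>k<m. \<Sum>i\<le>L. p i * ((1 - \<rho>) * V i)) \<le> (\<Sum>k<m. \<Sum>i\<le>L. p i * ((1 - return_prob TYPE('d) k) * V i))"
      using \<rho> V p by (intro sum_mono mult_left_mono mult_right_mono) auto
    moreover have "(\<Sum>k<m. \<Sum>i\<le>L. p i * ((1 - \<rho>) * V i)) = real m * (1 - \<rho>) * (\<Sum>i\<le>L. p i * V i)"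
      by (simp add: sum_distrib_left mult_ac)
    ultimately show ?thesis unfolding eq by (simp only:)
  qed
  have far: "path_expect n (\<lambda>w. (\<Sum>i<?c w j. p i) * (\<Sum>i<?c w k. p i)) \<le> A\<^sup>2" if "j + L < k" "k < m" for j k
  proof -
    have "path_expect n (\<lambda>w. (\<Sum>i<?c w j. p i) * (\<Sum>i<?c w k. p i))
      = path_expect n (\<lambda>w. \<Sum>i\<le>L. \<Sum>i'\<le>L. (p i * p i') * of_bool (i < ?c w j \<and> i' < ?c w k))"
      by (simp only: phi sum_product of_bool_conj mult_ac)
    also have "\<dots> = (\<Sum>i\<le>L. \<Sum>i'\<le>L. (p i * p i') * path_prob n (\<lambda>w. i < ?c w j \<and> i' < ?c w k))"
      by (simp only: path_expect_sum path_expect_cmult path_prob_def)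
    also have "\<dots> = (\<Sum>i\<le>L. \<Sum>i'\<le>L. (p i * p i') * (V i * V i'))"
      using mL that unfolding V_def by (intro sum.cong refl arg_cong2[where f = "(*)"] prob_revisits_far) auto
    also have "\<dots> = (\<Sum>i\<le>L. p i * V i)\<^sup>2"
      by (simp add: power2_eq_square sum_product mult_ac)
    also have "\<dots> \<le> A\<^sup>2" using VA by (intro power_mono)
    finally show ?thesis .
  qed
  have near: "path_expect n (\<lambda>w. of_bool (pos w j \<noteq> pos w k) * (\<Sum>i<?u w j k. p' i)) \<le> B"
    if "j < k" "k \<le> j + L" "k < m" for j k
  proof -
    have "path_expect n (\<lambda>w. of_bool (pos w j \<noteq> pos w k) * (\<Sum>i<?u w j k. p' i))
      = path_expect n (\<lambda>w. \<Sum>i\<le>n. p' i * of_bool (pos w j \<noteq> pos w k \<and> i < ?u w j k))"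
    proof (intro path_expect_cong)
      fix w :: "(int ^ 'd) list"
      have "?u w j k \<le> card {0..n}"
        using mL that by (intro card_mono) (auto simp: revisits_def)
      then show "of_bool (pos w j \<noteq> pos w k) * (\<Sum>i<?u w j k. p' i) = (\<Sum>i\<le>n. p' i * of_bool (pos w j \<noteq> pos w k \<and> i < ?u w j k))"
        by (simp add: sum_lessThan_eq_of_bool[of _ n] sum_distrib_left of_bool_conj mult_ac)
    qed
    also have "\<dots> = (\<Sum>i\<le>n. p' i * path_prob n (\<lambda>w. pos w j \<noteq> pos w k \<and> i < ?u w j k))"
      by (simp only: path_expect_sum path_expect_cmult path_prob_def)
    also have "\<dots> \<le> (\<Sum>i\<le>n. p' i * ((2 * real L + 1) ^ CARD('d) * (2 * \<rho> / (1 + \<rho>)) ^ i))"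
      using mL that by (intro sum_mono mult_left_mono p' prob_revisits_near \<rho>) auto
    also have "\<dots> = B" by (simp add: B_def sum_distrib_left mult_ac)
    finally show ?thesis .
  qed
  let ?pair = "\<lambda>w j k. if j + L < k then (\<Sum>i<?c w j. p i) * (\<Sum>i<?c w k. p i)
     else of_bool (pos w j \<noteq> pos w k) * (\<Sum>i<?u w j k. p' i)"
  have "path_expect n (\<lambda>w. \<Sum>k<m. \<Sum>j<k. ?pair w j k) = (\<Sum>k<m. \<Sum>j<k. path_expect n (\<lambda>w. ?pair w j k))"
    by (simp only: path_expect_sum)
  also have "\<dots> \<le> (\<Sum>k<m. \<Sum>j<k. A\<^sup>2 + (if j + L < k then 0 else B))"
  proof (intro sum_mono)
    fix k j assume "k \<in> {..<m}" "j \<in> {..<k}"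
    then show "path_expect n (\<lambda>w. ?pair w j k) \<le> A\<^sup>2 + (if j + L < k then 0 else B)"
      using far[of j k] near[of j k] by (cases "j + L < k") (auto intro: add_increasing)
  qed
  also have "\<dots> \<le> (\<Sum>k<m. real m * A\<^sup>2 + real L * B)"
  proof (intro sum_mono)
    fix k assume k: "k \<in> {..<m}"
    \<comment> \<open>Only the at most \<open>L\<close> starting times within distance
      \<open>L\<close> before \<open>k\<close> contribute \<open>B\<close>.\<close>
    have "(\<Sum>j<k. if j + L < k then 0 else B) = (\<Sum>j\<in>{..<k} \<inter> {j. \<not> j + L < k}. B)"
      by (subst sum.inter_restrict) (auto intro: sum.cong)
    also have "\<dots> = real (card ({..<k} \<inter> {j. \<not> j + L < k})) * B" by simp
    also have "\<dots> \<le> real L * B"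
    proof (intro mult_right_mono B0)
      have "card ({..<k} \<inter> {j. \<not> j + L < k}) \<le> card {k - L..<k}" by (intro card_mono) auto
      then show "real (card ({..<k} \<inter> {j. \<not> j + L < k})) \<le> real L" by simp
    qed
    finally show "(\<Sum>j<k. A\<^sup>2 + (if j + L < k then 0 else B)) \<le> real m * A\<^sup>2 + real L * B"
      using k mult_right_mono[of "real k" "real m" "A\<^sup>2"] by (simp add: sum.distrib)
  qed
  also have "\<dots> = (real m)\<^sup>2 * A\<^sup>2 + real m * real L * B"
    by (simp add: power2_eq_square algebra_simps)
  finally have pairs: "path_expect n (\<lambda>w. \<Sum>k<m. \<Sum>j<k. ?pair w j k) \<le> (real m)\<^sup>2 * A\<^sup>2 + real m * real L * B" .
  have "path_expect n (\<lambda>w. (\<Sum>k<m. of_bool (fresh w k) * (\<Sum>i<?c w k. p i)) - (\<Sum>k<m. \<Sum>j<k. ?pair w j k)) \<le> path_expect n \<tau>"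
    by (intro path_expect_mono \<tau>)
  then show ?thesis
    using single pairs unfolding path_expect_diff V_def A_def B_def by (simp add: mult.assoc)
qed

subsection \<open>The law of the path\<close>

lemma finite_step_lists [simp]: "finite (step_lists n :: (int ^ 'd) list set)"
  unfolding step_lists_def by (intro finite_lists_length_eq) simp

lemma path_expect_eq_sum:
  "path_expect n f = (\<Sum>w\<in>step_lists n. f w * (1 / real (card (unit_steps :: (int ^ 'd) set))) ^ n)"
  for f :: "(int ^ 'd) list \<Rightarrow> real"
proof (induction n arbitrary: f)
  case 0
  have "step_lists 0 = {[] :: (int ^ 'd) list}" by (auto simp: step_lists_def)
  then show ?case by simp
next
  case (Suc n)
  let ?U = "unit_steps :: (int ^ 'd) set"
  have eq: "step_lists (Suc n) = (\<lambda>(v, w). v # w) ` (?U \<times> step_lists n)"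
    by (auto simp: step_lists_def image_iff length_Suc_conv)
  have "(\<Sum>w\<in>step_lists (Suc n). f w * (1 / real (card ?U)) ^ Suc n)
    = (\<Sum>(v, w)\<in>?U \<times> step_lists n. f (v # w) * (1 / real (card ?U)) ^ Suc n)"
    unfolding eq by (subst sum.reindex) (auto simp: inj_on_def intro!: sum.cong)
  also have "\<dots> = (\<Sum>v\<in>?U. \<Sum>w\<in>step_lists n. f (v # w) * (1 / real (card ?U)) ^ Suc n)"
    by (simp add: sum.cartesian_product)
  also have "\<dots> = path_expect (Suc n) f"
    by (simp add: Suc sum_divide_distrib)
  finally show ?case by simp
qed

definition path_of :: "(nat \<Rightarrow> 'a \<Rightarrow> int ^ 'd) \<Rightarrow> nat \<Rightarrow> 'a \<Rightarrow> (int ^ 'd) list" where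
  "path_of X n \<omega> = map (\<lambda>k. X k \<omega>) [0..<n]"

lemma pos_path: "j \<le> n \<Longrightarrow> pos (path_of X n \<omega>) j = walk X j \<omega>"
  by (simp add: pos_def path_of_def walk_def take_map interv_sum_list_conv_sum_set_nat atLeast0LessThan)

lemma length_path_of [simp]: "length (path_of X n \<omega>) = n"
  by (simp add: path_of_def)

lemma path_of_eq_iff: "path_of X n \<omega> = w \<longleftrightarrow> length w = n \<and> (\<forall>k<n. X k \<omega> = w ! k)"
  by (auto simp: path_of_def list_eq_iff_nth_eq)

locale walk_space = prob_space M for M :: "'a measure" +
  fixes X :: "nat \<Rightarrow> 'a \<Rightarrow> int ^ 'd"
  assumes steps: "simple_walk_steps M X"
begin

lemma step_measurable [measurable]: "X k \<in> M \<rightarrow>\<^sub>M count_space UNIV"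
  using steps by (auto simp: simple_walk_steps_def indep_vars_def)

lemma path_measurable [measurable]: "path_of X n \<in> M \<rightarrow>\<^sub>M count_space UNIV"
proof (subst measurable_count_space_eq2_countable, intro conjI ballI)
  show "path_of X n -` {w} \<inter> space M \<in> sets M" for w
  proof -
    have "path_of X n -` {w} \<inter> space M = {\<omega> \<in> space M. path_of X n \<omega> = w}" by auto
    also have "\<dots> = {\<omega> \<in> space M. length w = n \<and> (\<forall>k<n. X k \<omega> = w ! k)}"
      unfolding path_of_eq_iff ..
    also have "\<dots> \<in> sets M" by measurable
    finally show ?thesis .
  qed
qed auto

lemma walk_measurable [measurable]: "walk X n \<in> M \<rightarrow>\<^sub>M count_space UNIV"
proof -
  have "(\<lambda>\<omega>. pos (path_of X n \<omega>) n) \<in> M \<rightarrow>\<^sub>M count_space UNIV" by measurable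
  then show ?thesis by (simp add: pos_path cong: measurable_cong)
qed

lemma prob_step: "v \<in> unit_steps \<Longrightarrow> prob {\<omega> \<in> space M. X k \<omega> = v} = 1 / real (card (unit_steps :: (int ^ 'd) set))"
proof -
  assume v: "v \<in> unit_steps"
  have "{\<omega> \<in> space M. X k \<omega> = v} = X k -` {v} \<inter> space M" by auto
  then have "prob {\<omega> \<in> space M. X k \<omega> = v} = measure (distr M (count_space UNIV) (X k)) {v}"
    by (simp add: measure_distr)
  also have "distr M (count_space UNIV) (X k) = measure_pmf (pmf_of_set unit_steps)"
    using steps by (simp add: simple_walk_steps_def)
  also have "measure \<dots> {v} = 1 / real (card (unit_steps :: (int ^ 'd) set))"
    using v by (simp add: measure_pmf_single)
  finally show ?thesis .
qed

lemma prob_path: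
  assumes "w \<in> step_lists n"
  shows "prob {\<omega> \<in> space M. path_of X n \<omega> = w} = (1 / real (card (unit_steps :: (int ^ 'd) set))) ^ n"
proof (cases "n = 0")
  case True
  then have "{\<omega> \<in> space M. path_of X n \<omega> = w} = space M" using assms by (auto simp: path_of_eq_iff step_lists_def)
  then show ?thesis using True by (simp add: prob_space)
next
  case False
  have w: "length w = n" "k < n \<Longrightarrow> w ! k \<in> unit_steps" for k
    using assms by (auto simp: step_lists_def)
  have "{\<omega> \<in> space M. path_of X n \<omega> = w} = (\<Inter>k\<in>{..<n}. X k -` {w ! k} \<inter> space M)"
    using w False by (auto simp: path_of_eq_iff)
  also have "prob \<dots> = (\<Prod>k<n. prob (X k -` {w ! k} \<inter> space M))"
    using steps False by (intro indep_varsD[where I = UNIV and M' = "\<lambda>_. count_space UNIV"]) (auto simp: simple_walk_steps_def)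
  also have "\<dots> = (\<Prod>k<n. 1 / real (card (unit_steps :: (int ^ 'd) set)))"
  proof (intro prod.cong refl)
    fix k assume "k \<in> {..<n}"
    moreover have "X k -` {w ! k} \<inter> space M = {\<omega> \<in> space M. X k \<omega> = w ! k}" by auto
    ultimately show "prob (X k -` {w ! k} \<inter> space M) = 1 / real (card (unit_steps :: (int ^ 'd) set))"
      using prob_step[of "w ! k" k] w by simp
  qed
  finally show ?thesis by (simp add: power_one_over)
qed

lemma AE_path: "AE \<omega> in M. path_of X n \<omega> \<in> step_lists n"
proof -
  have "{\<omega> \<in> space M. path_of X n \<omega> \<in> step_lists n} = (\<Union>w\<in>step_lists n. {\<omega> \<in> space M. path_of X n \<omega> = w})" by auto
  then have "prob {\<omega> \<in> space M. path_of X n \<omega> \<in> step_lists n} = (\<Sum>w\<in>step_lists n. prob {\<omega> \<in> space M. path_of X n \<omega> = w})"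
    by (simp only:) (intro finite_measure_finite_Union; auto simp: disjoint_family_on_def)
  also have "\<dots> = path_expect n (\<lambda>w :: (int ^ 'd) list. 1)"
    unfolding path_expect_eq_sum by (intro sum.cong) (auto simp: prob_path)
  finally show ?thesis by (subst AE_iff_emeasure_eq_1) (simp_all add: emeasure_eq_measure)
qed

text \<open>Conditioning on the path: lists of steps are countable, which gives measurability, and
  finitely many of them carry all the mass. Independence is required only for each frozen path
  \<open>w\<close>.\<close>

lemma prob_eq_path_expect:
  assumes meas: "\<And>w. {\<omega> \<in> space M. Q w \<omega>} \<in> events"
    and indep: "\<And>w. prob {\<omega> \<in> space M. path_of X n \<omega> = w \<and> Q w \<omega>}
      = prob {\<omega> \<in> space M. path_of X n \<omega> = w} * prob {\<omega> \<in> space M. Q w \<omega>}"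
  shows "{\<omega> \<in> space M. Q (path_of X n \<omega>) \<omega>} \<in> events"
    and "prob {\<omega> \<in> space M. Q (path_of X n \<omega>) \<omega>} = path_expect n (\<lambda>w. prob {\<omega> \<in> space M. Q w \<omega>})"
proof -
  note [measurable] = meas
  have "{\<omega> \<in> space M. Q (path_of X n \<omega>) \<omega>} = (\<Union>w. {\<omega> \<in> space M. path_of X n \<omega> = w \<and> Q w \<omega>})" by auto
  also have "\<dots> \<in> events" by (intro sets.countable_UN'') auto
  finally show ev: "{\<omega> \<in> space M. Q (path_of X n \<omega>) \<omega>} \<in> events" .
  have "prob {\<omega> \<in> space M. Q (path_of X n \<omega>) \<omega>}
     = prob (\<Union>w\<in>step_lists n. {\<omega> \<in> space M. path_of X n \<omega> = w \<and> Q w \<omega>})"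
    using AE_path[of n] by (intro finite_measure_eq_AE ev) auto
  also have "\<dots> = (\<Sum>w\<in>step_lists n. prob {\<omega> \<in> space M. path_of X n \<omega> = w \<and> Q w \<omega>})"
    by (intro finite_measure_finite_Union) (auto simp: disjoint_family_on_def)
  also have "\<dots> = path_expect n (\<lambda>w. prob {\<omega> \<in> space M. Q w \<omega>})"
    unfolding path_expect_eq_sum by (intro sum.cong) (auto simp: indep prob_path)
  finally show "prob {\<omega> \<in> space M. Q (path_of X n \<omega>) \<omega>} = path_expect n (\<lambda>w. prob {\<omega> \<in> space M. Q w \<omega>})" .
qed

lemma prob_path_event: "prob {\<omega> \<in> space M. P (path_of X n \<omega>)} = path_prob n P"
proof -
  have "prob {\<omega> \<in> space M. P (path_of X n \<omega>)} = path_expect n (\<lambda>w. prob {\<omega> \<in> space M. P w})"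
  proof (rule prob_eq_path_expect(2))
    show "prob {\<omega> \<in> space M. path_of X n \<omega> = w \<and> P w} = prob {\<omega> \<in> space M. path_of X n \<omega> = w} * prob {\<omega> \<in> space M. P w}" for w
      by (cases "P w") (simp_all add: prob_space)
  qed auto
  also have "(\<lambda>w. prob {\<omega> \<in> space M. P w}) = (\<lambda>w. of_bool (P w))"
    by (intro ext) (auto simp: prob_space)
  finally show ?thesis by (simp add: path_prob_def)
qed

text \<open>The bridge from finite paths to \<open>escape_prob\<close>, by continuity from above
  along the events of no return by time \<open>n\<close>.\<close>

lemma return_prob_tendsto: "(\<lambda>n. return_prob TYPE('d) n) \<longlonglongrightarrow> 1 - escape_prob M X"
proof -
  define E where "E n = {\<omega> \<in> space M. \<forall>j\<in>{1..n}. walk X j \<omega> \<noteq> 0}" for n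
  have "prob (E n) = 1 - return_prob TYPE('d) n" for n
  proof -
    have "E n = {\<omega> \<in> space M. \<not> 1 \<le> visits {0} 0 (path_of X n \<omega>)}"
      unfolding one_le_visits_iff by (auto simp: E_def pos_path)
    then show ?thesis using prob_path_event[of "\<lambda>w. \<not> 1 \<le> visits {0} 0 w" n] by (simp add: path_prob_compl visit_prob_def)
  qed
  moreover have "(\<lambda>n. prob (E n)) \<longlonglongrightarrow> prob (\<Inter>n. E n)"
    by (intro finite_Lim_measure_decseq) (auto simp: E_def decseq_def)
  moreover have "(\<Inter>n. E n) = {\<omega> \<in> space M. \<forall>n\<ge>1. walk X n \<omega> \<noteq> 0}"
    unfolding E_def by (auto, metis atLeastAtMost_iff order_refl)
  ultimately have "(\<lambda>n. 1 - return_prob TYPE('d) n) \<longlonglongrightarrow> escape_prob M X"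
    by (simp add: escape_prob_def)
  from tendsto_diff[OF tendsto_const[of 1] this] show ?thesis by simp
qed

end

section \<open>Bonferroni's inequality and sites of large weighted local time\<close>

lemma (in prob_space) bonferroni_lower:
  fixes A :: "nat \<Rightarrow> 'a set"
  assumes "\<And>k. A k \<in> events"
  shows "(\<Sum>k<m. prob (A k)) - (\<Sum>k<m. \<Sum>j<k. prob (A j \<inter> A k)) \<le> prob (\<Union>k<m. A k)"
proof (induction m)
  case (Suc m)
  let ?U = "\<Union>k<m. A k"
  have ev: "?U \<in> events" using assms by auto
  have "prob (?U \<inter> A m) = prob (\<Union>j<m. A j \<inter> A m)" by (intro arg_cong[where f = prob]) auto
  also have "\<dots> \<le> (\<Sum>j<m. prob (A j \<inter> A m))"
    using assms by (intro finite_measure_subadditive_finite) auto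
  finally have "prob (?U \<inter> A m) \<le> (\<Sum>j<m. prob (A j \<inter> A m))" .
  moreover have "prob (?U \<union> A m) = prob ?U + prob (A m) - prob (?U \<inter> A m)"
    using ev assms[of m] by (intro measure_Un3) (simp_all add: fmeasurable_eq_sets)
  moreover have "(\<Union>k<Suc m. A k) = ?U \<union> A m" by (auto simp: less_Suc_eq)
  ultimately show ?case using Suc by simp
qed simp

text \<open>The path is an argument separate from the sample point, so that it can be frozen while
  the weights stay random.\<close>

definition heavy :: "(nat \<Rightarrow> 'a \<Rightarrow> real) \<Rightarrow> real \<Rightarrow> (int ^ 'd) list \<Rightarrow> nat \<Rightarrow> 'a \<Rightarrow> bool" where
  "heavy T s w n \<omega> \<longleftrightarrow> (\<exists>x. s < (\<Sum>j\<in>{j \<in> {..n}. pos w j = x}. T j \<omega>))"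

text \<open>Common to both local times: unit weights give \<open>\<xi>\<close>, the holding times give \<open>\<ell>\<close>. The sequences
  \<open>p\<close> and \<open>p'\<close> are the increments, in the number of summands, of the probability that a sum of
  weights exceeds \<open>s\<close> and \<open>2 * s\<close>.\<close>

locale weighted_walk = walk_space M X for M :: "'a measure" and X :: "nat \<Rightarrow> 'a \<Rightarrow> int ^ 'd" +
  fixes T :: "nat \<Rightarrow> 'a \<Rightarrow> real" and s :: real and p p' :: "nat \<Rightarrow> real"
  assumes T_measurable [measurable]: "\<And>k. T k \<in> borel_measurable M"
    and T_nonneg: "\<And>k. AE \<omega> in M. 0 \<le> T k \<omega>"
    and path_indep: "\<And>n w B. B \<in> sets (PiM UNIV (\<lambda>_. borel)) \<Longrightarrow>
      prob {\<omega> \<in> space M. path_of X n \<omega> = w \<and> (\<lambda>k. T k \<omega>) \<in> B}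
      = prob {\<omega> \<in> space M. path_of X n \<omega> = w} * prob {\<omega> \<in> space M. (\<lambda>k. T k \<omega>) \<in> B}"
    and s_nonneg: "0 \<le> s"
    and tail: "\<And>J. finite J \<Longrightarrow> prob {\<omega> \<in> space M. s < (\<Sum>j\<in>J. T j \<omega>)} = (\<Sum>i<card J. p i)"
    and tail2: "\<And>J. finite J \<Longrightarrow> prob {\<omega> \<in> space M. 2 * s < (\<Sum>j\<in>J. T j \<omega>)} = (\<Sum>i<card J. p' i)"
    and pair_indep: "\<And>J K. finite J \<Longrightarrow> finite K \<Longrightarrow> J \<inter> K = {} \<Longrightarrow>
      prob {\<omega> \<in> space M. s < (\<Sum>j\<in>J. T j \<omega>) \<and> s < (\<Sum>j\<in>K. T j \<omega>)}
      = prob {\<omega> \<in> space M. s < (\<Sum>j\<in>J. T j \<omega>)} * prob {\<omega> \<in> space M. s < (\<Sum>j\<in>K. T j \<omega>)}"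
    and p_nonneg: "\<And>i. 0 \<le> p i" and p'_nonneg: "\<And>i. 0 \<le> p' i"
begin

lemma heavy_measurable [measurable]: "{\<omega> \<in> space M. heavy T s w n \<omega>} \<in> events"
  unfolding heavy_def by measurable

lemma prob_heavy_path:
  "prob {\<omega> \<in> space M. heavy T s (path_of X n \<omega>) n \<omega>} = path_expect n (\<lambda>w :: (int ^ 'd) list. prob {\<omega> \<in> space M. heavy T s w n \<omega>})"
proof (rule prob_eq_path_expect(2))
  fix w :: "(int ^ 'd) list"
  define B where "B = {t \<in> space (PiM UNIV (\<lambda>_. borel)). \<exists>x. s < (\<Sum>j\<in>{j \<in> {..n}. pos w j = x}. t j :: real)}"
  have "B \<in> sets (PiM UNIV (\<lambda>_. borel))" unfolding B_def by measurable
  moreover have "heavy T s w n \<omega> \<longleftrightarrow> (\<lambda>k. T k \<omega>) \<in> B" for \<omega>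
    by (simp add: heavy_def B_def space_PiM)
  ultimately show "prob {\<omega> \<in> space M. path_of X n \<omega> = w \<and> heavy T s w n \<omega>} = prob {\<omega> \<in> space M. path_of X n \<omega> = w} * prob {\<omega> \<in> space M. heavy T s w n \<omega>}"
    using path_indep by simp
qed (rule heavy_measurable)

text \<open>Since \<open>s \<ge> 0\<close>, a heavy site has been visited, and its visits up to time
  \<open>n\<close> are exactly the revisits counted from its first visit.\<close>

lemma prob_heavy_le:
  "prob {\<omega> \<in> space M. heavy T s w n \<omega>} \<le> (\<Sum>k\<le>n. of_bool (fresh w k) * (\<Sum>i<card (revisits w k (n - k)). p i))"
proof -
  let ?A = "\<lambda>k. {\<omega> \<in> space M. fresh w k \<and> s < (\<Sum>j\<in>revisits w k (n - k). T j \<omega>)}"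
  have "{\<omega> \<in> space M. heavy T s w n \<omega>} \<subseteq> (\<Union>k\<le>n. ?A k)"
  proof
    fix \<omega> assume "\<omega> \<in> {\<omega> \<in> space M. heavy T s w n \<omega>}"
    then obtain x where \<omega>: "\<omega> \<in> space M" and x: "s < (\<Sum>j\<in>{j \<in> {..n}. pos w j = x}. T j \<omega>)"
      by (auto simp: heavy_def)
    then have "{j \<in> {..n}. pos w j = x} \<noteq> {}" using s_nonneg by (metis sum.empty not_le)
    then obtain l where l: "l \<le> n" "pos w l = x" by auto
    define k where "k = (LEAST k. pos w k = x)"
    have k: "pos w k = x" unfolding k_def using l(2) by (rule LeastI)
    have le: "k \<le> j" if "pos w j = x" for j unfolding k_def using that by (rule Least_le)
    have kn: "k \<le> n" using le[OF l(2)] l(1) by simp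
    have "fresh w k" using k le by (force simp: fresh_def)
    moreover have "{j \<in> {..n}. pos w j = x} = revisits w k (n - k)"
      using k le kn by (auto simp: revisits_def)
    ultimately show "\<omega> \<in> (\<Union>k\<le>n. ?A k)" using x \<omega> kn by auto
  qed
  then have "prob {\<omega> \<in> space M. heavy T s w n \<omega>} \<le> prob (\<Union>k\<le>n. ?A k)"
    by (intro finite_measure_mono) auto
  also have "\<dots> \<le> (\<Sum>k\<le>n. prob (?A k))"
    by (intro finite_measure_subadditive_finite) auto
  also have "\<dots> = (\<Sum>k\<le>n. of_bool (fresh w k) * (\<Sum>i<card (revisits w k (n - k)). p i))"
    by (intro sum.cong refl) (auto simp: tail)
  finally show ?thesis .
qed

text \<open>Disjoint windows carry independent weights. For overlapping windows at distinct sites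
  only the total weight, exceeding \<open>2 * s\<close>, is used. Overlapping windows at the same
  site do not contribute, because the later start is not a first visit.\<close>

lemma prob_heavy_ge:
  assumes "m + L \<le> Suc n"
  shows "(\<Sum>k<m. of_bool (fresh w k) * (\<Sum>i<card (revisits w k L). p i))
      - (\<Sum>k<m. \<Sum>j<k. if j + L < k
           then (\<Sum>i<card (revisits w j L). p i) * (\<Sum>i<card (revisits w k L). p i)
           else of_bool (pos w j \<noteq> pos w k) * (\<Sum>i<card (revisits w j L \<union> revisits w k L). p' i))
    \<le> prob {\<omega> \<in> space M. heavy T s w n \<omega>}"
proof -
  define A where "A k = {\<omega> \<in> space M. fresh w k \<and> s < (\<Sum>j\<in>revisits w k L. T j \<omega>)}" for k
  have ev: "A k \<in> events" for k unfolding A_def by measurable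
  have single: "prob (A k) = of_bool (fresh w k) * (\<Sum>i<card (revisits w k L). p i)" for k
    by (auto simp: A_def tail)
  \<comment> \<open>The inequality is strict because a window contains both of its end
    times.\<close>
  have disj: "revisits w j L \<inter> revisits w k L = {}" if "pos w j \<noteq> pos w k \<or> j + L < k" for j k
    using that by (auto simp: revisits_def)
  have pair: "prob (A j \<inter> A k) \<le> (if j + L < k
      then (\<Sum>i<card (revisits w j L). p i) * (\<Sum>i<card (revisits w k L). p i)
      else of_bool (pos w j \<noteq> pos w k) * (\<Sum>i<card (revisits w j L \<union> revisits w k L). p' i))"
    if "j < k" for j k
  proof (cases "j + L < k")
    case True
    have "prob (A j \<inter> A k) \<le> prob {\<omega> \<in> space M. s < (\<Sum>i\<in>revisits w j L. T i \<omega>) \<and> s < (\<Sum>i\<in>revisits w k L. T i \<omega>)}"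
      by (intro finite_measure_mono) (auto simp: A_def)
    then show ?thesis using True by (simp add: pair_indep disj tail)
  next
    case False
    show ?thesis
    proof (cases "pos w j \<noteq> pos w k")
      case True
      have "(\<Sum>i\<in>revisits w j L \<union> revisits w k L. T i \<omega>) = (\<Sum>i\<in>revisits w j L. T i \<omega>) + (\<Sum>i\<in>revisits w k L. T i \<omega>)" for \<omega>
        using disj True by (intro sum.union_disjoint) auto
      then have "prob (A j \<inter> A k) \<le> prob {\<omega> \<in> space M. 2 * s < (\<Sum>i\<in>revisits w j L \<union> revisits w k L. T i \<omega>)}"
        by (intro finite_measure_mono) (auto simp: A_def)
      then show ?thesis using True False by (simp add: tail2)
    next
      case eq: False
      then have "\<not> fresh w k" using that by (auto simp: fresh_def)
      then show ?thesis using False eq by (simp add: A_def)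
    qed
  qed
  \<comment> \<open>Visits outside the window can only increase the weight of the site, since
    weights are almost surely nonnegative.\<close>
  have "AE \<omega> in M. \<forall>k. 0 \<le> T k \<omega>" using T_nonneg by (simp add: AE_all_countable)
  then have "AE \<omega> in M. \<omega> \<in> (\<Union>k<m. A k) \<longrightarrow> \<omega> \<in> {\<omega> \<in> space M. heavy T s w n \<omega>}"
  proof eventually_elim
    case (elim \<omega>)
    show ?case
    proof
      assume "\<omega> \<in> (\<Union>k<m. A k)"
      then obtain k where k: "k < m" "\<omega> \<in> space M" "s < (\<Sum>j\<in>revisits w k L. T j \<omega>)"
        by (auto simp: A_def)
      have "(\<Sum>j\<in>revisits w k L. T j \<omega>) \<le> (\<Sum>j\<in>{j \<in> {..n}. pos w j = pos w k}. T j \<omega>)"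
        using k(1) assms elim by (intro sum_mono2) (auto simp: revisits_def)
      then show "\<omega> \<in> {\<omega> \<in> space M. heavy T s w n \<omega>}" using k by (auto simp: heavy_def intro: less_le_trans)
    qed
  qed
  then have "prob (\<Union>k<m. A k) \<le> prob {\<omega> \<in> space M. heavy T s w n \<omega>}"
    by (intro finite_measure_mono_AE heavy_measurable)
  moreover have "(\<Sum>k<m. \<Sum>j<k. prob (A j \<inter> A k)) \<le> (\<Sum>k<m. \<Sum>j<k. if j + L < k
           then (\<Sum>i<card (revisits w j L). p i) * (\<Sum>i<card (revisits w k L). p i)
           else of_bool (pos w j \<noteq> pos w k) * (\<Sum>i<card (revisits w j L \<union> revisits w k L). p' i))"
    by (intro sum_mono pair) auto
  ultimately show ?thesis using bonferroni_lower[of A m, OF ev] by (simp add: single)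
qed

lemma prob_heavy_upper:
  assumes "\<And>n. return_prob TYPE('d) n \<le> \<rho>"
  shows "prob {\<omega> \<in> space M. heavy T s (path_of X n \<omega>) n \<omega>}
    \<le> (\<Sum>k\<le>n. 1 - return_prob TYPE('d) k) * (\<Sum>i\<le>n. p i * \<rho> ^ i)"
  unfolding prob_heavy_path by (intro path_expect_union_bound assms p_nonneg prob_heavy_le)

lemma prob_heavy_lower:
  assumes "\<And>n. return_prob TYPE('d) n \<le> \<rho>" "\<rho> \<le> 1" "m + L \<le> Suc n"
  shows "real m * (1 - \<rho>) * (\<Sum>i\<le>L. p i * visit_prob {0} L (0 :: int ^ 'd) i)
      - (real m)\<^sup>2 * (\<Sum>i\<le>L. p i * \<rho> ^ i)\<^sup>2
      - real m * real L * (2 * real L + 1) ^ CARD('d) * (\<Sum>i\<le>n. p' i * (2 * \<rho> / (1 + \<rho>)) ^ i)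
    \<le> prob {\<omega> \<in> space M. heavy T s (path_of X n \<omega>) n \<omega>}"
  unfolding prob_heavy_path
  by (intro path_expect_bonferroni assms p_nonneg p'_nonneg prob_heavy_ge)

end

subsection \<open>Exponential holding times\<close>

definition poisson_weight :: "real \<Rightarrow> nat \<Rightarrow> real" where
  "poisson_weight s i = exp (- s) * (s ^ i / fact i)"

lemma poisson_weight_nonneg: "0 \<le> s \<Longrightarrow> 0 \<le> poisson_weight s i"
  by (simp add: poisson_weight_def)

text \<open>The Poisson generating function. It converts \<open>\<rho> ^ i\<close> into
  \<open>exp (- \<gamma> * s)\<close> and, with \<open>a\<close> at choice, yields the Chernoff
  bounds.\<close>

lemma poisson_weight_sums: "(\<lambda>i. poisson_weight s i * a ^ i) sums exp ((a - 1) * s)"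
proof -
  have "(\<lambda>i. exp (- s) * ((a * s) ^ i /\<^sub>R fact i)) sums (exp (- s) * exp (a * s))"
    by (intro sums_mult exp_converges)
  moreover have "exp (- s) * exp (a * s) = exp ((a - 1) * s)"
    by (simp add: mult_exp_exp algebra_simps)
  moreover have "exp (- s) * ((a * s) ^ i /\<^sub>R fact i) = poisson_weight s i * a ^ i" for i
    by (simp add: poisson_weight_def power_mult_distrib field_simps)
  ultimately show ?thesis by simp
qed

lemma sum_poisson_weight_le:
  assumes "0 \<le> s" "0 \<le> a" "finite I"
  shows "(\<Sum>i\<in>I. poisson_weight s i * a ^ i) \<le> exp ((a - 1) * s)"
  using sum_le_suminf[OF sums_summable[OF poisson_weight_sums[of s a]] assms(3)]
    sums_unique[OF poisson_weight_sums[of s a]] assms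
  by (simp add: poisson_weight_nonneg)

lemma sum_poisson_weight_lower_tail:
  assumes "0 \<le> s" "0 < a" "a \<le> 1"
  shows "(\<Sum>i<m. poisson_weight s i) \<le> exp ((a - 1) * s) / a ^ m"
proof -
  have "(\<Sum>i<m. poisson_weight s i) * a ^ m = (\<Sum>i<m. poisson_weight s i * a ^ m)"
    by (simp add: sum_distrib_right)
  also have "\<dots> \<le> (\<Sum>i<m. poisson_weight s i * a ^ i)"
    using assms by (intro sum_mono mult_left_mono poisson_weight_nonneg power_decreasing) auto
  also have "\<dots> \<le> exp ((a - 1) * s)" using assms by (intro sum_poisson_weight_le) auto
  finally show ?thesis using assms(2) by (simp add: field_simps)
qed

lemma sum_poisson_weight_upper_tail:
  assumes "0 \<le> s" "1 \<le> a"
  shows "1 - (\<Sum>i<m. poisson_weight s i) \<le> exp ((a - 1) * s) / a ^ m"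
proof -
  have sums: "(\<lambda>i. poisson_weight s (i + m)) sums (1 - (\<Sum>i<m. poisson_weight s i))"
    using poisson_weight_sums[of s 1] by (subst sums_iff_shift) simp
  have sums_a: "(\<lambda>i. poisson_weight s (i + m) * a ^ (i + m)) sums (exp ((a - 1) * s) - (\<Sum>i<m. poisson_weight s i * a ^ i))"
    using poisson_weight_sums[of s a] by (subst sums_iff_shift[of "\<lambda>i. poisson_weight s i * a ^ i"]) simp
  have "(1 - (\<Sum>i<m. poisson_weight s i)) * a ^ m \<le> exp ((a - 1) * s) - (\<Sum>i<m. poisson_weight s i * a ^ i)"
    using assms by (intro sums_le[OF _ sums_mult2[OF sums] sums_a] mult_left_mono poisson_weight_nonneg power_increasing) auto
  also have "\<dots> \<le> exp ((a - 1) * s)"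
    using assms by (auto intro!: sum_nonneg mult_nonneg_nonneg poisson_weight_nonneg)
  finally show ?thesis using assms(2) by (simp add: field_simps)
qed

locale jump_walk = walk_space M X for M :: "'a measure" and X :: "nat \<Rightarrow> 'a \<Rightarrow> int ^ 'd" +
  fixes T :: "nat \<Rightarrow> 'a \<Rightarrow> real"
  assumes times: "exp_holding_times M T" and steps_times: "steps_indep_times M X T"
begin

lemma time_measurable [measurable]: "T k \<in> borel_measurable M"
  using times by (auto simp: exp_holding_times_def indep_vars_def)

lemma time_distributed: "distributed M lborel (T k) (exponential_density 1)"
  using times by (simp add: exp_holding_times_def)

lemma times_indep: "indep_vars (\<lambda>_. borel) T J"
  using times indep_vars_subset[of "\<lambda>_. borel" T UNIV J] by (simp add: exp_holding_times_def)

lemma AE_times_nonneg: "AE \<omega> in M. \<forall>k. 0 \<le> T k \<omega>"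
proof (subst AE_all_countable, intro allI)
  fix k
  have "prob {\<omega> \<in> space M. T k \<omega> \<le> 0} = 0"
    using exponential_distributedD_le[OF time_distributed, of 0 k] by simp
  then have "AE \<omega> in M. \<omega> \<notin> {\<omega> \<in> space M. T k \<omega> \<le> 0}"
    by (subst AE_iff_measurable[OF _ refl]) (auto simp: emeasure_eq_measure)
  with AE_space show "AE \<omega> in M. 0 \<le> T k \<omega>" by eventually_elim auto
qed

lemma prob_path_times:
  assumes "B \<in> sets (PiM UNIV (\<lambda>_. borel))"
  shows "prob {\<omega> \<in> space M. path_of X n \<omega> = w \<and> (\<lambda>k. T k \<omega>) \<in> B}
    = prob {\<omega> \<in> space M. path_of X n \<omega> = w} * prob {\<omega> \<in> space M. (\<lambda>k. T k \<omega>) \<in> B}"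
proof -
  define A where "A = {x \<in> space (PiM UNIV (\<lambda>_. count_space UNIV)). length w = n \<and> (\<forall>k<n. x k = w ! k)}"
  have A: "A \<in> sets (PiM UNIV (\<lambda>_. count_space UNIV))" unfolding A_def by measurable
  have "path_of X n \<omega> = w \<longleftrightarrow> (\<lambda>k. X k \<omega>) \<in> A" for \<omega>
    by (simp add: path_of_eq_iff A_def space_PiM)
  then have eq: "{\<omega> \<in> space M. path_of X n \<omega> = w} = (\<lambda>\<omega> k. X k \<omega>) -` A \<inter> space M"
    "{\<omega> \<in> space M. path_of X n \<omega> = w \<and> (\<lambda>k. T k \<omega>) \<in> B} = ((\<lambda>\<omega> k. X k \<omega>) -` A \<inter> space M) \<inter> ((\<lambda>\<omega> k. T k \<omega>) -` B \<inter> space M)"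
    "{\<omega> \<in> space M. (\<lambda>k. T k \<omega>) \<in> B} = (\<lambda>\<omega> k. T k \<omega>) -` B \<inter> space M"
    by auto
  show ?thesis unfolding eq
    using steps_times A assms by (intro indep_setD) (auto simp: steps_indep_times_def)
qed

lemma prob_times_sum:
  assumes "finite J" "0 \<le> s"
  shows "prob {\<omega> \<in> space M. s < (\<Sum>j\<in>J. T j \<omega>)} = (\<Sum>i<card J. poisson_weight s i)"
proof (cases "J = {}")
  case False
  then have "card J - 1 < card J" using assms(1) by (simp add: card_gt_0_iff)
  then have "{..card J - 1} = {..<card J}" by auto
  \<comment> \<open>The shape parameter of the Erlang law is one less than the number of
    summands.\<close>
  moreover have "distributed M lborel (\<lambda>\<omega>. \<Sum>j\<in>J. T j \<omega>) (erlang_density (card J - 1) 1)"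
    using False assms by (intro exponential_distributed_sum time_distributed times_indep) auto
  ultimately show ?thesis
    using erlang_distributed_gt[of "\<lambda>\<omega>. \<Sum>j\<in>J. T j \<omega>" "card J - 1" 1 s] assms
    by (simp add: erlang_CDF_def poisson_weight_def mult.commute)
qed (use assms in auto)

lemma prob_times_pair:
  assumes "finite J" "finite K" "J \<inter> K = {}"
  shows "prob {\<omega> \<in> space M. s < (\<Sum>j\<in>J. T j \<omega>) \<and> s < (\<Sum>j\<in>K. T j \<omega>)}
    = prob {\<omega> \<in> space M. s < (\<Sum>j\<in>J. T j \<omega>)} * prob {\<omega> \<in> space M. s < (\<Sum>j\<in>K. T j \<omega>)}"
proof -
  define F where "F I = {t \<in> space (PiM I (\<lambda>_. borel)). s < (\<Sum>j\<in>I. t j :: real)}" for I :: "nat set"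
  have F: "F I \<in> sets (PiM I (\<lambda>_. borel))" for I unfolding F_def by measurable
  have mem: "(\<lambda>i\<in>I. T i \<omega>) \<in> F I \<longleftrightarrow> s < (\<Sum>j\<in>I. T j \<omega>)" for I \<omega>
    by (auto simp: F_def space_PiM)
  have "indep_var (PiM J (\<lambda>_. borel)) (\<lambda>\<omega>. \<lambda>i\<in>J. T i \<omega>) (PiM K (\<lambda>_. borel)) (\<lambda>\<omega>. \<lambda>i\<in>K. T i \<omega>)"
    using assms(3) by (intro indep_var_restrict[OF times_indep[of UNIV]]) auto
  from indep_varD[OF this F F] show ?thesis
    by (simp add: vimage_def mem Int_def conj_commute)
qed

lemma weighted_walk_exponential:
  assumes "0 \<le> s"
  shows "weighted_walk M X T s (poisson_weight s) (poisson_weight (2 * s))"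
proof
  show "AE \<omega> in M. 0 \<le> T k \<omega>" for k using AE_times_nonneg by eventually_elim auto
qed (use assms in \<open>auto simp: prob_path_times prob_times_sum prob_times_pair poisson_weight_nonneg\<close>)

subsection \<open>Local times of the continuous-time walk\<close>

abbreviation jump_time :: "nat \<Rightarrow> 'a \<Rightarrow> real" where
  "jump_time n \<omega> \<equiv> \<Sum>k<n. T k \<omega>"

lemma num_jumps_measurable [measurable]:
  "(\<lambda>(\<omega>, s). num_jumps T s \<omega>) \<in> M \<Otimes>\<^sub>M borel \<rightarrow>\<^sub>M count_space UNIV"
  unfolding num_jumps_def by measurable

lemma ct_walk_measurable [measurable]:
  "(\<lambda>(\<omega>, s). ct_walk X T s \<omega>) \<in> M \<Otimes>\<^sub>M borel \<rightarrow>\<^sub>M count_space UNIV"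
  unfolding ct_walk_def split_beta'
  by (rule measurable_compose_countable[where g = "\<lambda>p. num_jumps T (snd p) (fst p)"])
    (use num_jumps_measurable in \<open>simp_all add: split_beta'\<close>)

lemma ct_local_time_measurable [measurable]: "ct_local_time X T t x \<in> borel_measurable M"
  unfolding ct_local_time_def set_lebesgue_integral_def by measurable

lemma ct_local_time_le: "0 \<le> t \<Longrightarrow> ct_local_time X T t x \<omega> \<le> t"
proof -
  assume t: "0 \<le> t"
  have "ct_local_time X T t x \<omega> \<le> (\<integral>s. indicator {0..t} s \<partial>lborel)"
    unfolding ct_local_time_def set_lebesgue_integral_def
    using t by (intro integral_mono' integrable_real_indicator) (auto split: split_indicator)
  then show ?thesis using t by simp
qed

lemma less_max_ct_local_time_iff:
  "0 \<le> t \<Longrightarrow> c < max_ct_local_time X T t \<omega> \<longleftrightarrow> (\<exists>x. c < ct_local_time X T t x \<omega>)"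
  unfolding max_ct_local_time_def
  by (subst less_cSUP_iff) (auto intro!: bdd_aboveI2[of _ _ t] ct_local_time_le)

lemma max_ct_local_time_event:
  "0 \<le> t \<Longrightarrow> {\<omega> \<in> space M. c < max_ct_local_time X T t \<omega>} \<in> events"
  by (simp add: less_max_ct_local_time_iff) measurable

lemma jump_time_mono: "(\<And>k. 0 \<le> T k \<omega>) \<Longrightarrow> m \<le> n \<Longrightarrow> jump_time m \<omega> \<le> jump_time n \<omega>"
  by (intro sum_mono2) auto

lemma num_jumps_eq:
  assumes "\<And>k. 0 \<le> T k \<omega>" "jump_time j \<omega> \<le> s" "s < jump_time (Suc j) \<omega>"
  shows "num_jumps T s \<omega> = j"
proof -
  have iff: "jump_time n \<omega> \<le> s \<longleftrightarrow> n \<le> j" for n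
  proof (cases "n \<le> j")
    case True
    then show ?thesis using jump_time_mono[OF assms(1), of n j] assms(2) by linarith
  next
    case False
    then show ?thesis using jump_time_mono[OF assms(1), of "Suc j" n] assms(3) by linarith
  qed
  have "{n. n \<ge> 1 \<and> jump_time n \<omega> \<le> s} = {1..j}" unfolding iff by auto
  then show ?thesis by (simp add: num_jumps_def)
qed

text \<open>On the \<open>j\<close>-th holding interval the walk sits at \<open>walk X j\<close>.
  The hypothesis on \<open>N\<close> makes the first \<open>N\<close> intervals cover
  \<open>{0..t}\<close>; they are half-open because a jump at time \<open>s\<close> already counts
  at \<open>s\<close>.\<close>

lemma ct_local_time_eq:
  assumes nonneg: "\<And>k. 0 \<le> T k \<omega>" and "t < jump_time N \<omega>"
  shows "ct_local_time X T t x \<omega> =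
    (\<Sum>j<N. of_bool (walk X j \<omega> = x) * measure lborel ({0..t} \<inter> {jump_time j \<omega>..<jump_time (Suc j) \<omega>}))"
proof -
  let ?I = "\<lambda>j. {0..t} \<inter> {jump_time j \<omega>..<jump_time (Suc j) \<omega>}"
  have "indicator {0..t} s *\<^sub>R indicator {x} (ct_walk X T s \<omega>)
    = (\<Sum>j<N. of_bool (walk X j \<omega> = x) * indicator (?I j) s :: real)" for s
  proof (cases "s \<in> {0..t}")
    case True
    obtain j where j: "j < N" "jump_time j \<omega> \<le> s" "s < jump_time (Suc j) \<omega>"
      using ex_least_nat_less[of "\<lambda>k. s < jump_time k \<omega>" N] True assms(2) by (force simp: not_less)
    have num: "num_jumps T s \<omega> = j" using num_jumps_eq[OF nonneg j(2,3)] .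
    have "(\<Sum>i<N. of_bool (walk X i \<omega> = x) * indicator (?I i) s) = (\<Sum>i<N. if i = j then of_bool (walk X i \<omega> = x) else 0 :: real)"
    proof (intro sum.cong refl)
      fix i
      show "of_bool (walk X i \<omega> = x) * indicator (?I i) s = (if i = j then of_bool (walk X i \<omega> = x) else 0 :: real)"
      proof (cases "i = j")
        case False
        then have "s \<notin> ?I i"
          unfolding Int_iff atLeastLessThan_iff using num num_jumps_eq[OF nonneg, of i s] by blast
        then show ?thesis using False by (simp only: indicator_simps if_False mult_zero_right simp_thms)
      next
        case eq: True
        have "s \<in> ?I i" unfolding eq Int_iff atLeastLessThan_iff using j True by blast
        then show ?thesis using eq by (simp only: indicator_simps if_True mult_1_right simp_thms)
      qed
    qed
    then show ?thesis using True j(1) num by (simp add: ct_walk_def indicator_def)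
  next
    case False
    then have "s \<notin> ?I i" for i by blast
    then show ?thesis using False by (simp only: indicator_simps simp_thms mult_zero_right sum.neutral_const scaleR_zero_left)
  qed
  then have "ct_local_time X T t x \<omega> = (\<integral>s. (\<Sum>j<N. of_bool (walk X j \<omega> = x) * indicator (?I j) s) \<partial>lborel)"
    unfolding ct_local_time_def set_lebesgue_integral_def by (simp only:)
  also have "\<dots> = (\<Sum>j<N. \<integral>s. of_bool (walk X j \<omega> = x) * indicator (?I j) s \<partial>lborel)"
  proof (intro Bochner_Integration.integral_sum integrable_mult_right)
    fix j
    have "emeasure lborel (?I j) \<le> emeasure lborel {0..t}" by (intro emeasure_mono) auto
    then have "emeasure lborel (?I j) < \<infinity>"
      by (rule le_less_trans) (simp add: emeasure_lborel_Icc_eq)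
    then show "integrable lborel (indicator (?I j) :: real \<Rightarrow> real)"
      by (intro integrable_real_indicator) auto
  qed
  finally show ?thesis by simp
qed

lemma measure_holding_interval_le:
  assumes "0 \<le> T j \<omega>"
  shows "measure lborel ({0..t} \<inter> {jump_time j \<omega>..<jump_time (Suc j) \<omega>}) \<le> T j \<omega>"
proof -
  have "measure lborel ({0..t} \<inter> {jump_time j \<omega>..<jump_time (Suc j) \<omega>}) \<le> measure lborel {jump_time j \<omega>..<jump_time (Suc j) \<omega>}"
    using assms by (intro measure_mono_fmeasurable) (auto simp: fmeasurable_def emeasure_lborel_Ico)
  then show ?thesis using assms by simp
qed

lemma sum_of_bool_eq_path_sum:
  "(\<Sum>j\<le>n. of_bool (walk X j \<omega> = x) * f j) = (\<Sum>j\<in>{j \<in> {..n}. pos (path_of X n \<omega>) j = x}. f j :: real)"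
  by (rule sum.mono_neutral_cong_right) (auto simp: pos_path)

text \<open>When the first \<open>n + 1\<close> holding times outlast \<open>t\<close>, only visits
  up to index \<open>n\<close> contribute, each by at most its full holding time.\<close>

lemma ct_local_time_le_path_sum:
  assumes "\<And>k. 0 \<le> T k \<omega>" "t < jump_time (Suc n) \<omega>"
  shows "ct_local_time X T t x \<omega> \<le> (\<Sum>j\<in>{j \<in> {..n}. pos (path_of X n \<omega>) j = x}. T j \<omega>)"
proof -
  have "ct_local_time X T t x \<omega> \<le> (\<Sum>j<Suc n. of_bool (walk X j \<omega> = x) * T j \<omega>)"
    unfolding ct_local_time_eq[OF assms]
    by (intro sum_mono mult_left_mono measure_holding_interval_le assms) simp
  then show ?thesis by (simp only: sum_of_bool_eq_path_sum lessThan_Suc_atMost)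
qed

text \<open>When the first \<open>n + 1\<close> holding times are over by time \<open>t\<close>,
  each of them counts in full. The bound \<open>N\<close> makes the representation by finitely many
  intervals available.\<close>

lemma path_sum_le_ct_local_time:
  assumes nonneg: "\<And>k. 0 \<le> T k \<omega>" and "jump_time (Suc n) \<omega> \<le> t" "t < jump_time N \<omega>"
  shows "(\<Sum>j\<in>{j \<in> {..n}. pos (path_of X n \<omega>) j = x}. T j \<omega>) \<le> ct_local_time X T t x \<omega>"
proof -
  have N: "Suc n \<le> N" using jump_time_mono[OF nonneg, of N "Suc n"] assms(2,3) by (cases "Suc n \<le> N") auto
  have "T j \<omega> = measure lborel ({0..t} \<inter> {jump_time j \<omega>..<jump_time (Suc j) \<omega>})" if "j \<le> n" for j
  proof -
    have "jump_time 0 \<omega> \<le> jump_time j \<omega>" "jump_time (Suc j) \<omega> \<le> jump_time (Suc n) \<omega>"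
      using that by (intro jump_time_mono nonneg; simp)+
    then have "{0..t} \<inter> {jump_time j \<omega>..<jump_time (Suc j) \<omega>} = {jump_time j \<omega>..<jump_time (Suc j) \<omega>}"
      using assms(2) by auto
    then show ?thesis using nonneg[of j] by simp
  qed
  then have "(\<Sum>j\<le>n. of_bool (walk X j \<omega> = x) * T j \<omega>)
    = (\<Sum>j\<le>n. of_bool (walk X j \<omega> = x) * measure lborel ({0..t} \<inter> {jump_time j \<omega>..<jump_time (Suc j) \<omega>}))"
    by (intro sum.cong) auto
  also have "\<dots> \<le> ct_local_time X T t x \<omega>"
    unfolding ct_local_time_eq[OF nonneg assms(3)] using N by (intro sum_mono2) auto
  finally show ?thesis by (simp only: sum_of_bool_eq_path_sum)
qed

section \<open>From elapsed time to the number of jumps\<close>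

lemma prob_jump_time_gt: "0 \<le> t \<Longrightarrow> prob {\<omega> \<in> space M. t < jump_time m \<omega>} = (\<Sum>i<m. poisson_weight t i)"
  using prob_times_sum[of "{..<m}" t] by simp

lemma prob_jump_time_le: "0 \<le> t \<Longrightarrow> prob {\<omega> \<in> space M. jump_time m \<omega> \<le> t} = 1 - (\<Sum>i<m. poisson_weight t i)"
proof -
  assume t: "0 \<le> t"
  have "{\<omega> \<in> space M. jump_time m \<omega> \<le> t} = space M - {\<omega> \<in> space M. t < jump_time m \<omega>}" by auto
  moreover have "{\<omega> \<in> space M. t < jump_time m \<omega>} \<in> events" by measurable
  ultimately show ?thesis using prob_compl prob_jump_time_gt[OF t] by metis
qed

lemma AE_jump_time_unbounded:
  assumes "0 \<le> t"
  shows "AE \<omega> in M. \<exists>N. t < jump_time N \<omega>"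
proof -
  have "prob {\<omega> \<in> space M. \<forall>N. jump_time N \<omega> \<le> t} \<le> 1 - (\<Sum>i<m. poisson_weight t i)" for m
    unfolding prob_jump_time_le[OF assms, symmetric] by (intro finite_measure_mono) auto
  moreover have "(\<lambda>m. 1 - (\<Sum>i<m. poisson_weight t i)) \<longlonglongrightarrow> 1 - 1"
    using poisson_weight_sums[of t 1] by (intro tendsto_intros) (simp add: sums_def)
  ultimately have "prob {\<omega> \<in> space M. \<forall>N. jump_time N \<omega> \<le> t} \<le> 0"
    by (intro LIMSEQ_le_const[where x = "0 :: real"]) auto
  then have "AE \<omega> in M. \<omega> \<notin> {\<omega> \<in> space M. \<forall>N. jump_time N \<omega> \<le> t}"
    by (subst AE_iff_measurable[OF _ refl]) (auto simp: emeasure_eq_measure measure_le_0_iff)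
  with AE_space show ?thesis by eventually_elim (auto simp: not_le)
qed

text \<open>The subtracted Poisson sum is the probability that the first \<open>n + 1\<close>
  holding times outlast \<open>t\<close>, the only case, up to null sets, in which the comparison
  with the path sum may fail.\<close>

lemma prob_max_ct_local_time_ge:
  assumes "0 \<le> t" "0 \<le> c"
  shows "prob {\<omega> \<in> space M. heavy T c (path_of X n \<omega>) n \<omega>} - (\<Sum>i<Suc n. poisson_weight t i)
    \<le> prob {\<omega> \<in> space M. c < max_ct_local_time X T t \<omega>}"
proof -
  note [measurable] = max_ct_local_time_event[OF assms(1)]
  have "AE \<omega> in M. \<omega> \<in> {\<omega> \<in> space M. heavy T c (path_of X n \<omega>) n \<omega>} \<longrightarrow>
     \<omega> \<in> {\<omega> \<in> space M. c < max_ct_local_time X T t \<omega>} \<union> {\<omega> \<in> space M. t < jump_time (Suc n) \<omega>}"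
    using AE_times_nonneg AE_jump_time_unbounded[OF assms(1)]
  proof eventually_elim
    case (elim \<omega>)
    then obtain N where "t < jump_time N \<omega>" by blast
    then show ?case
      using path_sum_le_ct_local_time[of \<omega> n t N] elim(1) less_max_ct_local_time_iff[OF assms(1)]
      by (auto simp: heavy_def not_less simp del: sum.lessThan_Suc) (meson less_le_trans)
  qed
  then have "prob {\<omega> \<in> space M. heavy T c (path_of X n \<omega>) n \<omega>}
    \<le> prob ({\<omega> \<in> space M. c < max_ct_local_time X T t \<omega>} \<union> {\<omega> \<in> space M. t < jump_time (Suc n) \<omega>})"
    by (rule finite_measure_mono_AE) auto
  also have "\<dots> \<le> prob {\<omega> \<in> space M. c < max_ct_local_time X T t \<omega>} + prob {\<omega> \<in> space M. t < jump_time (Suc n) \<omega>}"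
    by (intro measure_Un_le) auto
  finally show ?thesis using prob_jump_time_gt[OF assms(1), of "Suc n"] by linarith
qed

lemma prob_max_ct_local_time_le:
  assumes "0 \<le> t" "0 \<le> c"
  shows "prob {\<omega> \<in> space M. c < max_ct_local_time X T t \<omega>}
    \<le> prob {\<omega> \<in> space M. heavy T c (path_of X n \<omega>) n \<omega>} + (1 - (\<Sum>i<Suc n. poisson_weight t i))"
proof -
  have ev: "{\<omega> \<in> space M. heavy T c (path_of X n \<omega>) n \<omega>} \<in> events"
    unfolding heavy_def by measurable
  have "AE \<omega> in M. \<omega> \<in> {\<omega> \<in> space M. c < max_ct_local_time X T t \<omega>} \<longrightarrow>
     \<omega> \<in> {\<omega> \<in> space M. heavy T c (path_of X n \<omega>) n \<omega>} \<union> {\<omega> \<in> space M. jump_time (Suc n) \<omega> \<le> t}"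
    using AE_times_nonneg
  proof eventually_elim
    case (elim \<omega>)
    then show ?case
      using ct_local_time_le_path_sum[of \<omega> t n] less_max_ct_local_time_iff[OF assms(1)]
      by (auto simp: heavy_def not_le simp del: sum.lessThan_Suc) (meson less_le_trans)
  qed
  then have "prob {\<omega> \<in> space M. c < max_ct_local_time X T t \<omega>}
    \<le> prob ({\<omega> \<in> space M. heavy T c (path_of X n \<omega>) n \<omega>} \<union> {\<omega> \<in> space M. jump_time (Suc n) \<omega> \<le> t})"
    using ev by (intro finite_measure_mono_AE) auto
  also have "\<dots> \<le> prob {\<omega> \<in> space M. heavy T c (path_of X n \<omega>) n \<omega>} + prob {\<omega> \<in> space M. jump_time (Suc n) \<omega> \<le> t}"
    using ev by (intro measure_Un_le) auto
  finally show ?thesis using prob_jump_time_le[OF assms(1), of "Suc n"] by linarith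
qed

end

subsection \<open>Asymptotics\<close>

lemma cesaro_limit:
  fixes a :: "nat \<Rightarrow> real"
  assumes "a \<longlonglongrightarrow> l"
  shows "(\<lambda>n. (\<Sum>k\<le>n. a k) / (real n + 1)) \<longlonglongrightarrow> l"
proof (rule LIMSEQ_I)
  fix e :: real assume e: "0 < e"
  then obtain N where N: "\<And>k. k \<ge> N \<Longrightarrow> \<bar>a k - l\<bar> < e / 2"
    using LIMSEQ_D[OF assms, of "e / 2"] by auto
  define C where "C = (\<Sum>k<N. \<bar>a k - l\<bar>)"
  obtain n0 :: nat where n0: "2 * C / e < real n0" using reals_Archimedean2 by blast
  show "\<exists>no. \<forall>n\<ge>no. norm ((\<Sum>k\<le>n. a k) / (real n + 1) - l) < e"
  proof (intro exI allI impI)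
    fix n assume n: "max n0 N \<le> n"
    have "(\<Sum>k\<le>n. a k) / (real n + 1) - l = (\<Sum>k\<le>n. a k - l) / (real n + 1)"
      by (simp add: sum_subtractf field_simps)
    also have "\<bar>\<dots>\<bar> \<le> (\<Sum>k\<le>n. \<bar>a k - l\<bar>) / (real n + 1)"
      by (simp add: abs_divide divide_right_mono)
    also have "(\<Sum>k\<le>n. \<bar>a k - l\<bar>) = C + (\<Sum>k\<in>{N..n}. \<bar>a k - l\<bar>)"
    proof -
      have "{..n} = {..<N} \<union> {N..n}" using n by auto
      then show ?thesis unfolding C_def by (simp only:) (intro sum.union_disjoint; auto)
    qed
    also have "(\<Sum>k\<in>{N..n}. \<bar>a k - l\<bar>) \<le> (\<Sum>k\<in>{N..n}. e / 2)"
      using N by (intro sum_mono less_imp_le) auto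
    also have "\<dots> \<le> (real n + 1) * (e / 2)" using e n by (simp add: of_nat_diff)
    finally have "\<bar>(\<Sum>k\<le>n. a k) / (real n + 1) - l\<bar> \<le> (C + (real n + 1) * (e / 2)) / (real n + 1)"
      by (simp add: divide_right_mono)
    also have "\<dots> < e"
    proof -
      have "2 * C < e * real n0" using n0 e by (simp add: field_simps)
      also have "\<dots> \<le> e * (real n + 1)" using n e by (intro mult_left_mono) auto
      finally show ?thesis by (simp add: field_simps)
    qed
    finally show "norm ((\<Sum>k\<le>n. a k) / (real n + 1) - l) < e" by simp
  qed
qed

text \<open>Here \<open>x\<close> is the time, \<open>H\<close> the chance that a first visit leads
  to a heavy site, \<open>R\<close> the same within a window, \<open>G\<close> the mean number of
  first visits, \<open>m\<close> the number of windows and \<open>W\<close> the overlap term;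
  \<open>E\<close> and \<open>E'\<close> are time-change errors. The quadratic term is harmless
  because \<open>x * H\<close> tends to 0, which is where \<beta> > 1 enters.\<close>

lemma asymp_equiv_of_moment_bounds:
  fixes P G H E m R W E' x :: "'b \<Rightarrow> real"
  assumes upper: "\<forall>\<^sub>F t in F. P t \<le> G t * H t + E t"
    and lower: "\<forall>\<^sub>F t in F. m t * \<gamma> * R t - (m t)\<^sup>2 * (H t)\<^sup>2 - m t * W t - E' t \<le> P t"
    and x: "\<forall>\<^sub>F t in F. 0 < x t" and H: "\<And>t. 0 < H t" and \<gamma>: "0 < \<gamma>"
    and G: "((\<lambda>t. G t / x t) \<longlongrightarrow> \<gamma>) F" and E: "((\<lambda>t. E t / (x t * H t)) \<longlongrightarrow> 0) F"
    and m: "((\<lambda>t. m t / x t) \<longlongrightarrow> 1) F" and R: "((\<lambda>t. R t / H t) \<longlongrightarrow> 1) F"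
    and xH: "((\<lambda>t. x t * H t) \<longlongrightarrow> 0) F" and W: "((\<lambda>t. W t / H t) \<longlongrightarrow> 0) F"
    and E': "((\<lambda>t. E' t / (x t * H t)) \<longlongrightarrow> 0) F"
  shows "P \<sim>[F] (\<lambda>t. \<gamma> * x t * H t)"
proof (rule asymp_equivI')
  define lo where "lo t = (m t / x t) * (R t / H t) - (m t / x t)\<^sup>2 * (x t * H t) / \<gamma> - (m t / x t) * (W t / H t) / \<gamma> - (E' t / (x t * H t)) / \<gamma>" for t
  define hi where "hi t = (G t / x t) / \<gamma> + (E t / (x t * H t)) / \<gamma>" for t
  show "((\<lambda>t. P t / (\<gamma> * x t * H t)) \<longlongrightarrow> 1) F"
  proof (rule tendsto_sandwich)
    show "\<forall>\<^sub>F t in F. lo t \<le> P t / (\<gamma> * x t * H t)" using lower x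
    proof eventually_elim
      case (elim t)
      have "lo t = (m t * \<gamma> * R t - (m t)\<^sup>2 * (H t)\<^sup>2 - m t * W t - E' t) / (\<gamma> * x t * H t)"
        using elim(2) H[of t] \<gamma> by (simp add: lo_def divide_simps power2_eq_square)
      also have "\<dots> \<le> P t / (\<gamma> * x t * H t)"
        using elim H[of t] \<gamma> by (intro divide_right_mono) auto
      finally show ?case .
    qed
    show "\<forall>\<^sub>F t in F. P t / (\<gamma> * x t * H t) \<le> hi t" using upper x
    proof eventually_elim
      case (elim t)
      have "P t / (\<gamma> * x t * H t) \<le> (G t * H t + E t) / (\<gamma> * x t * H t)"
        using elim H[of t] \<gamma> by (intro divide_right_mono) auto
      also have "\<dots> = hi t"
        using elim(2) H[of t] \<gamma> by (simp add: hi_def divide_simps)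
      finally show ?case .
    qed
    have "(lo \<longlongrightarrow> 1 * 1 - 1\<^sup>2 * 0 / \<gamma> - 1 * 0 / \<gamma> - 0 / \<gamma>) F"
      unfolding lo_def using \<gamma> by (intro tendsto_intros m R xH W E') auto
    then show "(lo \<longlongrightarrow> 1) F" by simp
    have "(hi \<longlongrightarrow> \<gamma> / \<gamma> + 0 / \<gamma>) F"
      unfolding hi_def using \<gamma> by (intro tendsto_intros G E) auto
    then show "(hi \<longlongrightarrow> 1) F" using \<gamma> by simp
  qed
qed

text \<open>A deviation of \<open>t powr (2/3)\<close> is the fraction \<open>t powr (-1/3)\<close>
  of \<open>t\<close>, whence the tilt. The terms of order \<open>t powr (2/3)\<close> in the
  exponent cancel, leaving \<open>- t powr (1/3) / 2\<close> to leading order, which beats every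
  power of \<open>t\<close>; the lower deviation behaves in the same way.\<close>

lemma chernoff_upper_small:
  fixes \<beta> :: real assumes "\<beta> > 1"
  shows "((\<lambda>t. exp (t powr (-1/3) * t) / (1 + t powr (-1/3)) powr (t + t powr (2/3)) * t powr (\<beta> - 1)) \<longlongrightarrow> 0) at_top"
  using assms by real_asymp

lemma chernoff_lower_small:
  fixes \<beta> :: real assumes "\<beta> > 1"
  shows "((\<lambda>t. exp (- (t powr (-1/3)) * t) / (1 - t powr (-1/3)) powr (t - t powr (2/3)) * t powr (\<beta> - 1)) \<longlongrightarrow> 0) at_top"
  using assms by real_asymp

lemma power_times_geometric_tendsto_0:
  assumes "0 \<le> c" "c < (1 :: real)"
  shows "(\<lambda>n. real n ^ k * c ^ n) \<longlonglongrightarrow> 0"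
proof (cases "c = 0")
  case True
  have "\<forall>\<^sub>F n in sequentially. real n ^ k * c ^ n = 0"
    using eventually_gt_at_top[of 0] by eventually_elim (simp add: True)
  then show ?thesis by (rule tendsto_eventually)
next
  case False
  define \<delta> where "\<delta> = - ln c"
  have \<delta>: "0 < \<delta>" "c = exp (- \<delta>)" using assms False by (simp_all add: \<delta>_def)
  define a where "a = real k"
  have "(\<lambda>n. real n powr a * exp (- \<delta> * real n)) \<longlonglongrightarrow> 0" using \<delta>(1) by real_asymp
  moreover have "\<forall>\<^sub>F n in sequentially. real n powr a * exp (- \<delta> * real n) = real n ^ k * c ^ n"
    using eventually_gt_at_top[of 0]
    by eventually_elim (simp add: a_def \<delta>(2) powr_realpow exp_of_nat_mult[symmetric] mult.commute)
  ultimately show ?thesis by (rule Lim_transform_eventually)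
qed

lemma box_times_geometric_tendsto_0:
  assumes "0 \<le> c" "c < (1 :: real)"
  shows "(\<lambda>n. real (n ^ k) * (2 * real (n ^ k) + 1) ^ d * c ^ n) \<longlonglongrightarrow> 0"
proof (rule tendsto_sandwich)
  show "\<forall>\<^sub>F n in sequentially. 0 \<le> real (n ^ k) * (2 * real (n ^ k) + 1) ^ d * c ^ n" using assms by simp
  have "(\<lambda>n. 3 ^ d * (real n ^ (k * (d + 1)) * c ^ n)) \<longlonglongrightarrow> 3 ^ d * 0"
    by (intro tendsto_intros power_times_geometric_tendsto_0 assms)
  then show "(\<lambda>n. 3 ^ d * (real n ^ (k * (d + 1)) * c ^ n)) \<longlonglongrightarrow> 0" by simp
  show "\<forall>\<^sub>F n in sequentially. real (n ^ k) * (2 * real (n ^ k) + 1) ^ d * c ^ n \<le> 3 ^ d * (real n ^ (k * (d + 1)) * c ^ n)"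
    using eventually_gt_at_top[of 0]
  proof eventually_elim
    case (elim n)
    have "1 \<le> real (n ^ k)" using elim by (simp add: one_le_power)
    then have "(2 * real (n ^ k) + 1) ^ d \<le> (3 * real (n ^ k)) ^ d" by (intro power_mono) auto
    then have "real (n ^ k) * (2 * real (n ^ k) + 1) ^ d * c ^ n \<le> real (n ^ k) * (3 * real (n ^ k)) ^ d * c ^ n"
      using assms by (intro mult_left_mono mult_right_mono) auto
    also have "\<dots> = 3 ^ d * (real n ^ (k * (d + 1)) * c ^ n)"
    proof -
      have "(real n ^ k) ^ d = real n ^ (k * d)" by (rule power_mult[symmetric])
      then show ?thesis by (simp add: power_mult_distrib power_add)
    qed
    finally show ?case .
  qed
qed simp

text \<open>Since \<open>q \<le> 1\<close>, truncating the generating function at \<open>m\<close>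
  loses at most the Poisson mass from \<open>m\<close> on.\<close>

lemma poisson_generating_le:
  assumes "0 \<le> s" "0 \<le> q" "q \<le> 1"
  shows "exp ((q - 1) * s) \<le> (\<Sum>i<m. poisson_weight s i * q ^ i) + (1 - (\<Sum>i<m. poisson_weight s i))"
proof -
  have a: "(\<lambda>i. poisson_weight s (i + m)) sums (1 - (\<Sum>i<m. poisson_weight s i))"
    using poisson_weight_sums[of s 1] by (subst sums_iff_shift) simp
  have b: "(\<lambda>i. poisson_weight s (i + m) * q ^ (i + m)) sums (exp ((q - 1) * s) - (\<Sum>i<m. poisson_weight s i * q ^ i))"
    using poisson_weight_sums[of s q] by (subst sums_iff_shift[of "\<lambda>i. poisson_weight s i * q ^ i"]) simp
  have "poisson_weight s (i + m) * q ^ (i + m) \<le> poisson_weight s (i + m)" for i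
    using assms poisson_weight_nonneg[of s "i + m"] by (simp add: mult_left_le power_le_one)
  from sums_le[OF this b a] show ?thesis by simp
qed

text \<open>The last two bounds make overlapping pairs negligible: in discrete time
  \<open>q ^ (2 * N)\<close> competes with \<open>\<rho> ^ N\<close>, in continuous time
  \<open>exp (- 2 * (1 - q) * s)\<close> with \<open>exp (- (1 - \<rho>) * s)\<close>. Both amount
  to \<open>\<rho> < 1\<close>, the former through \<open>(1 - \<rho>)^2 > 0\<close>.\<close>

lemma pair_rate_less:
  assumes "0 < \<rho>" "\<rho> < (1 :: real)"
  shows "2 * \<rho> / (1 + \<rho>) < 1" "(2 * \<rho> / (1 + \<rho>))\<^sup>2 < \<rho>" "1 - \<rho> < 2 * (1 - 2 * \<rho> / (1 + \<rho>))"
proof -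
  show "2 * \<rho> / (1 + \<rho>) < 1" using assms by (simp add: field_simps)
  have "0 < (1 - \<rho>)\<^sup>2" using assms by simp
  then have "4 * \<rho> < (1 + \<rho>)\<^sup>2" by (simp add: power2_eq_square algebra_simps)
  then have "\<rho> * (4 * \<rho>) < \<rho> * (1 + \<rho>)\<^sup>2" using assms(1) by (rule mult_strict_left_mono)
  then have "4 * \<rho>\<^sup>2 < \<rho> * (1 + \<rho>)\<^sup>2" by (simp add: power2_eq_square mult_ac)
  then show "(2 * \<rho> / (1 + \<rho>))\<^sup>2 < \<rho>"
    using assms by (simp add: power_divide power_mult_distrib pos_divide_less_eq)
  have "1 - 2 * \<rho> / (1 + \<rho>) = (1 - \<rho>) / (1 + \<rho>)" using assms by (simp add: field_simps)
  moreover have "1 - \<rho> < 2 * ((1 - \<rho>) / (1 + \<rho>))"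
    using mult_strict_left_mono[of "1 + \<rho>" 2 "1 - \<rho>"] assms by (simp add: field_simps)
  ultimately show "1 - \<rho> < 2 * (1 - 2 * \<rho> / (1 + \<rho>))" by simp
qed

section \<open>Limiting escape probability and loss from finite windows\<close>

context walk_space
begin

abbreviation "esc \<equiv> escape_prob M X"

lemma return_prob_le: "return_prob TYPE('d) k \<le> 1 - esc"
  by (rule return_prob_le_limit[OF return_prob_tendsto])

lemma escape_prob_less_1: "esc < 1"
  using return_prob_limit_pos[OF return_prob_tendsto] by simp

lemma mean_fresh_tendsto: "(\<lambda>n. (\<Sum>k\<le>n. 1 - return_prob TYPE('d) k) / (real n + 1)) \<longlonglongrightarrow> esc"
  using tendsto_diff[OF tendsto_const[of 1] return_prob_tendsto] by (intro cesaro_limit) simp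

lemma escape_prob_pos: "CARD('d) \<ge> 3 \<Longrightarrow> 0 < esc"
  using return_prob_limit_less_1[OF _ return_prob_tendsto] by simp

text \<open>The tail decays like an inverse square root, so \<open>N ^ 4\<close> steps leave a gap
  of order \<open>N ^ (-2)\<close>, small enough to be multiplied by \<open>N\<close>
  returns.\<close>

lemma return_prob_gap_le:
  assumes "CARD('d) \<ge> 3" "0 < N"
  shows "1 - esc - return_prob TYPE('d) (N ^ 4) \<le> 2 * sqrt (real CARD('d) ^ 3) / (real N)\<^sup>2"
proof -
  have "1 - esc - return_prob TYPE('d) (N ^ 4) \<le> 2 * sqrt (real CARD('d) ^ 3) / sqrt (real (N ^ 4) + 1)"
    using return_prob_tail_le[OF assms(1) return_prob_tendsto, of "N ^ 4"] by simp
  also have "\<dots> \<le> 2 * sqrt (real CARD('d) ^ 3) / (real N)\<^sup>2"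
  proof (intro divide_left_mono)
    have "real (N ^ 4) = ((real N)\<^sup>2)\<^sup>2" by simp
    then have "(real N)\<^sup>2 = sqrt (real (N ^ 4))" by (simp only: real_sqrt_abs) simp
    also have "\<dots> \<le> sqrt (real (N ^ 4) + 1)" by simp
    finally show "(real N)\<^sup>2 \<le> sqrt (real (N ^ 4) + 1)" .
    have "0 < sqrt (real (N ^ 4) + 1)" by (simp add: add_nonneg_pos)
    then show "0 < sqrt (real (N ^ 4) + 1) * (real N)\<^sup>2" using assms(2) by simp
  qed simp
  finally show ?thesis .
qed

text \<open>Restricting the returns to windows of length \<open>N ^ 4\<close> changes the probability of
  exceeding a level of order \<open>N\<close> only by a factor \<open>1 + o(1)\<close>.\<close>

lemma gap_times_level_tendsto:
  assumes "CARD('d) \<ge> 3"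
  shows "(\<lambda>N. (1 - esc - return_prob TYPE('d) (N ^ 4)) * real N) \<longlonglongrightarrow> 0"
proof (rule tendsto_sandwich)
  show "\<forall>\<^sub>F N in sequentially. 0 \<le> (1 - esc - return_prob TYPE('d) (N ^ 4)) * real N"
    using return_prob_le by simp
  show "\<forall>\<^sub>F N in sequentially. (1 - esc - return_prob TYPE('d) (N ^ 4)) * real N \<le> 2 * sqrt (real CARD('d) ^ 3) / real N"
    using eventually_gt_at_top[of 0]
  proof eventually_elim
    case (elim N)
    have "(1 - esc - return_prob TYPE('d) (N ^ 4)) * real N \<le> 2 * sqrt (real CARD('d) ^ 3) / (real N)\<^sup>2 * real N"
      by (intro mult_right_mono return_prob_gap_le assms elim) simp
    then show ?case using elim by (simp add: power2_eq_square)
  qed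
  show "(\<lambda>N. 2 * sqrt (real CARD('d) ^ 3) / real N) \<longlonglongrightarrow> 0" by (rule lim_const_over_n)
qed simp

end

section \<open>Limits of the indices and error terms\<close>

lemma filterlim_nat_floor: "filterlim (\<lambda>x :: real. nat \<lfloor>x\<rfloor>) sequentially at_top"
  by (rule filterlim_compose[OF filterlim_nat_sequentially filterlim_floor_sequentially])

lemma filterlim_nat_ceiling: "filterlim (\<lambda>x :: real. nat \<lceil>x\<rceil>) sequentially at_top"
  by (rule filterlim_at_top_mono[OF filterlim_nat_floor]) (simp add: nat_mono floor_le_ceiling)

lemma exp_minus_square_tendsto_0: "(c :: real) > 0 \<Longrightarrow> (\<lambda>N :: nat. exp (c * real N - real N ^ 2)) \<longlonglongrightarrow> 0"
  by real_asymp

lemma upper_index_asymp: "((\<lambda>t. (real (nat \<lceil>t + t powr (2/3)\<rceil>) + 1) / t) \<longlongrightarrow> 1) at_top"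
  by real_asymp

lemma lower_index_asymp: "((\<lambda>t. real (nat \<lfloor>t - t powr (2/3)\<rfloor>) / t) \<longlongrightarrow> 1) at_top"
  by real_asymp

lemma lower_index_at_top: "filterlim (\<lambda>t :: real. t - t powr (2/3)) at_top at_top" by real_asymp
lemma upper_index_at_top: "filterlim (\<lambda>t :: real. t + t powr (2/3)) at_top at_top" by real_asymp
lemma ln_power_over_tendsto_0: "a > 0 \<Longrightarrow> ((\<lambda>t :: real. (a * ln t + b) ^ 6 / t) \<longlongrightarrow> 0) at_top"
  by real_asymp
lemma ln_affine_at_top: "c > 0 \<Longrightarrow> filterlim (\<lambda>t :: real. c * ln t + u) at_top at_top" by real_asymp
lemma times_powr_tendsto_0: "\<beta> > 1 \<Longrightarrow> ((\<lambda>t::real. t * (t powr - \<beta> * c)) \<longlongrightarrow> 0) at_top" by real_asymp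

lemma sum_of_bool_eq_times:
  fixes f :: "nat \<Rightarrow> real"
  shows "(\<Sum>i\<le>k. of_bool (i = j) * f i) = of_bool (j \<le> k) * f j"
proof -
  have "(\<Sum>i\<le>k. of_bool (i = j) * f i) = (\<Sum>i\<le>k. if i = j then f i else 0)"
    by (intro sum.cong) auto
  then show ?thesis by simp
qed

section \<open>Explicit bounds for the discrete maximal local time\<close>

context walk_space
begin

text \<open>A count exceeds \<open>s\<close> exactly when it exceeds the integer part of
  \<open>s\<close>, so the whole increment sits at that index; the floor in the discrete asymptotics
  originates here.\<close>

lemma weighted_walk_unit:
  assumes "0 \<le> s"
  shows "weighted_walk M X (\<lambda>_ _. 1) s (\<lambda>i. of_bool (i = nat \<lfloor>s\<rfloor>)) (\<lambda>i. of_bool (i = nat \<lfloor>2 * s\<rfloor>))"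
proof -
  have iff: "r < real c \<longleftrightarrow> nat \<lfloor>r\<rfloor> < c" if "0 \<le> r" for r and c :: nat
    using that by (simp add: nat_less_iff floor_less_iff)
  have sum: "(\<Sum>i<c. of_bool (i = k)) = (of_bool (k < c) :: real)" for c k :: nat
    by (simp add: of_bool_def)
  have const: "prob {\<omega> \<in> space M. Q} = of_bool Q" for Q by (simp add: prob_space)
  show ?thesis
  proof
    show "prob {\<omega> \<in> space M. path_of X n \<omega> = w \<and> (\<lambda>k. 1) \<in> B} = prob {\<omega> \<in> space M. path_of X n \<omega> = w} * prob {\<omega> \<in> space M. (\<lambda>k. 1 :: real) \<in> B}"
      for n w and B :: "(nat \<Rightarrow> real) set" unfolding const by (cases "(\<lambda>k. 1 :: real) \<in> B") simp_all
  qed (use assms in \<open>auto simp: iff sum const\<close>)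
qed

lemma max_local_time_gt_iff:
  "c < real (max_local_time X n \<omega>) \<longleftrightarrow> heavy (\<lambda>_ _. 1) c (path_of X n \<omega>) n \<omega>"
proof -
  have eq: "real (local_time X n x \<omega>) = (\<Sum>j\<in>{j \<in> {..n}. pos (path_of X n \<omega>) j = x}. 1)" for x
  proof -
    have "{j \<in> {..n}. pos (path_of X n \<omega>) j = x} = {..n} \<inter> {j. walk X j \<omega> = x}" by (auto simp: pos_path)
    then show ?thesis by (simp add: local_time_def sum.If_cases)
  qed
  have "local_time X n x \<omega> \<le> Suc n" for x
  proof -
    have "local_time X n x \<omega> \<le> (\<Sum>k\<le>n. 1)" unfolding local_time_def by (intro sum_mono) auto
    then show ?thesis by simp
  qed
  then have "range (\<lambda>x. local_time X n x \<omega>) \<subseteq> {..Suc n}" by blast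
  then have fin: "finite (range (\<lambda>x. local_time X n x \<omega>))" by (rule finite_subset) simp
  have "\<exists>x. max_local_time X n \<omega> = local_time X n x \<omega>"
    using Max_in[OF fin] unfolding max_local_time_def by auto
  moreover have "local_time X n x \<omega> \<le> max_local_time X n \<omega>" for x
    unfolding max_local_time_def by (intro Max_ge fin) auto
  ultimately have "c < real (max_local_time X n \<omega>) \<longleftrightarrow> (\<exists>x. c < real (local_time X n x \<omega>))"
    by (metis less_le_trans of_nat_le_iff)
  then show ?thesis unfolding heavy_def eq .
qed

lemma prob_max_local_time_le:
  assumes "0 \<le> s"
  shows "prob {\<omega> \<in> space M. s < real (max_local_time X n \<omega>)}
    \<le> (\<Sum>k\<le>n. 1 - return_prob TYPE('d) k) * (1 - esc) ^ nat \<lfloor>s\<rfloor>"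
proof -
  interpret weighted_walk M X "\<lambda>_ _. 1" s "\<lambda>i. of_bool (i = nat \<lfloor>s\<rfloor>)" "\<lambda>i. of_bool (i = nat \<lfloor>2 * s\<rfloor>)"
    by (rule weighted_walk_unit[OF assms])
  have "(\<Sum>i\<le>n. of_bool (i = nat \<lfloor>s\<rfloor>) * (1 - esc) ^ i) \<le> (1 - esc) ^ nat \<lfloor>s\<rfloor>"
    unfolding sum_of_bool_eq_times using escape_prob_less_1 by simp
  then show ?thesis
    unfolding max_local_time_gt_iff
    by (intro order_trans[OF prob_heavy_upper[OF return_prob_le]] mult_left_mono sum_nonneg) auto
qed

text \<open>The window \<open>N ^ 5\<close> gives each of the \<open>N\<close> required returns its
  own \<open>N ^ 4\<close> steps.\<close>

lemma prob_max_local_time_ge: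
  assumes "0 \<le> s" and N: "N = nat \<lfloor>s\<rfloor>" and "m + N ^ 5 \<le> Suc n"
  defines "\<rho> \<equiv> 1 - esc"
  shows "real m * esc * return_prob TYPE('d) (N ^ 4) ^ N - (real m)\<^sup>2 * (\<rho> ^ N)\<^sup>2
      - real m * (real (N ^ 5) * (2 * real (N ^ 5) + 1) ^ CARD('d) * ((2 * \<rho> / (1 + \<rho>))\<^sup>2) ^ N)
    \<le> prob {\<omega> \<in> space M. s < real (max_local_time X n \<omega>)}"
proof -
  interpret weighted_walk M X "\<lambda>_ _. 1" s "\<lambda>i. of_bool (i = nat \<lfloor>s\<rfloor>)" "\<lambda>i. of_bool (i = nat \<lfloor>2 * s\<rfloor>)"
    by (rule weighted_walk_unit[OF assms(1)])
  let ?q = "2 * \<rho> / (1 + \<rho>)"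
  have \<rho>: "0 < \<rho>" "\<rho> \<le> 1" using escape_prob_less_1 by (auto simp: \<rho>_def escape_prob_def)
  have q: "0 \<le> ?q" "?q \<le> 1" using \<rho> by (auto simp: field_simps)
  have N5: "N \<le> N ^ 5" "N * N ^ 4 = N ^ 5" by (cases "N = 0", simp_all add: self_le_power flip: power_Suc)
  have "return_prob TYPE('d) (N ^ 4) ^ N \<le> visit_prob {0} (N ^ 5) (0 :: int ^ 'd) N"
    using power_le_visit_prob[of "0 :: int ^ 'd" "N ^ 4" N] by (simp add: N5)
  also have "\<dots> = (\<Sum>i\<le>N ^ 5. of_bool (i = N) * visit_prob {0} (N ^ 5) (0 :: int ^ 'd) i)"
    by (simp only: sum_of_bool_eq_times) (simp add: N5)
  finally have 1: "real m * esc * return_prob TYPE('d) (N ^ 4) ^ N \<le> real m * esc * (\<Sum>i\<le>N ^ 5. of_bool (i = N) * visit_prob {0} (N ^ 5) (0 :: int ^ 'd) i)"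
    by (intro mult_left_mono) (auto simp: escape_prob_def)
  have "(\<Sum>i\<le>N ^ 5. of_bool (i = N) * \<rho> ^ i) = \<rho> ^ N"
    by (simp only: sum_of_bool_eq_times) (simp add: N5)
  then have 2: "(real m)\<^sup>2 * (\<Sum>i\<le>N ^ 5. of_bool (i = N) * \<rho> ^ i)\<^sup>2 = (real m)\<^sup>2 * (\<rho> ^ N)\<^sup>2" by simp
  \<comment> \<open>The level \<open>2 * s\<close> for a pair of sites requires at least
    \<open>2 * N\<close> returns to the pair, which produces \<open>(?q ^ 2) ^ N\<close>.\<close>
  have "2 * \<lfloor>s\<rfloor> \<le> \<lfloor>2 * s\<rfloor>" by (simp add: le_floor_iff) 
  then have "2 * N \<le> nat \<lfloor>2 * s\<rfloor>" using N assms(1) by linarith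
  have "(\<Sum>i\<le>n. of_bool (i = nat \<lfloor>2 * s\<rfloor>) * ?q ^ i) \<le> ?q ^ nat \<lfloor>2 * s\<rfloor>"
    unfolding sum_of_bool_eq_times using q by simp
  also have "\<dots> \<le> ?q ^ (2 * N)" using q \<open>2 * N \<le> nat \<lfloor>2 * s\<rfloor>\<close> by (intro power_decreasing)
  also have "\<dots> = (?q\<^sup>2) ^ N" by (rule power_mult)
  finally have 3: "real m * real (N ^ 5) * (2 * real (N ^ 5) + 1) ^ CARD('d) * (\<Sum>i\<le>n. of_bool (i = nat \<lfloor>2 * s\<rfloor>) * ?q ^ i)
    \<le> real m * real (N ^ 5) * (2 * real (N ^ 5) + 1) ^ CARD('d) * (?q\<^sup>2) ^ N"
    by (intro mult_left_mono) auto
  have "1 - \<rho> = esc" by (simp add: \<rho>_def)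
  moreover have "return_prob TYPE('d) k \<le> \<rho>" for k using return_prob_le by (simp add: \<rho>_def)
  ultimately have "real m * esc * (\<Sum>i\<le>N ^ 5. of_bool (i = N) * visit_prob {0} (N ^ 5) (0 :: int ^ 'd) i)
      - (real m)\<^sup>2 * (\<Sum>i\<le>N ^ 5. of_bool (i = N) * \<rho> ^ i)\<^sup>2
      - real m * real (N ^ 5) * (2 * real (N ^ 5) + 1) ^ CARD('d) * (\<Sum>i\<le>n. of_bool (i = nat \<lfloor>2 * s\<rfloor>) * ?q ^ i)
    \<le> prob {\<omega> \<in> space M. heavy (\<lambda>_ _. 1) s (path_of X n \<omega>) n \<omega>}"
    using prob_heavy_lower[of \<rho> m "N ^ 5" n, OF _ \<rho>(2) assms(3)] by (simp only: N)
  then show ?thesis using 1 2 3 unfolding max_local_time_gt_iff mult.assoc by linarith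
qed

end

section \<open>Explicit bounds for exponential weights\<close>

context jump_walk
begin

lemma prob_heavy_exponential_le:
  assumes "0 \<le> s"
  shows "prob {\<omega> \<in> space M. heavy T s (path_of X n \<omega>) n \<omega>}
    \<le> (\<Sum>k\<le>n. 1 - return_prob TYPE('d) k) * exp (- esc * s)"
proof -
  interpret weighted_walk M X T s "poisson_weight s" "poisson_weight (2 * s)"
    by (rule weighted_walk_exponential[OF assms])
  have "(\<Sum>i\<le>n. poisson_weight s i * (1 - esc) ^ i) \<le> exp (- esc * s)"
    using sum_poisson_weight_le[of s "1 - esc" "{..n}"] assms escape_prob_less_1 by simp
  then show ?thesis
    by (intro order_trans[OF prob_heavy_upper[OF return_prob_le]] mult_left_mono sum_nonneg) auto
qed

text \<open>The number of returns is weighted by a Poisson law of mean \<open>s\<close>, which is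
  cut off at \<open>N ^ 2\<close>; the window \<open>N ^ 6\<close> gives each of these returns
  \<open>N ^ 4\<close> steps. The mass beyond the cutoff is estimated by the Chernoff bound with
  tilt \<open>exp 1\<close>, and for \<open>s \<le> N\<close> the square in the exponent
  dominates.\<close>

lemma prob_heavy_exponential_ge:
  assumes "0 \<le> s" "m + N ^ 6 \<le> Suc n"
  defines "\<rho> \<equiv> 1 - esc"
  shows "real m * esc * (exp ((return_prob TYPE('d) (N ^ 4) - 1) * s) - exp ((exp 1 - 1) * s) / exp 1 ^ Suc (N ^ 2))
      - (real m)\<^sup>2 * (exp (- esc * s))\<^sup>2
      - real m * (real (N ^ 6) * (2 * real (N ^ 6) + 1) ^ CARD('d) * exp ((2 * \<rho> / (1 + \<rho>) - 1) * (2 * s)))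
    \<le> prob {\<omega> \<in> space M. heavy T s (path_of X n \<omega>) n \<omega>}"
proof -
  interpret weighted_walk M X T s "poisson_weight s" "poisson_weight (2 * s)"
    by (rule weighted_walk_exponential[OF assms(1)])
  let ?q = "2 * \<rho> / (1 + \<rho>)" and ?r = "return_prob TYPE('d) (N ^ 4)"
  have \<rho>: "0 < \<rho>" "\<rho> \<le> 1" using escape_prob_less_1 by (auto simp: \<rho>_def escape_prob_def)
  have "exp ((?r - 1) * s) - exp ((exp 1 - 1) * s) / exp 1 ^ Suc (N ^ 2) \<le> (\<Sum>i<Suc (N ^ 2). poisson_weight s i * ?r ^ i)"
    using poisson_generating_le[OF assms(1), of ?r "Suc (N ^ 2)"] sum_poisson_weight_upper_tail[OF assms(1), of "exp 1" "Suc (N ^ 2)"]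
    by simp
  also have "\<dots> \<le> (\<Sum>i<Suc (N ^ 2). poisson_weight s i * visit_prob {0} (N ^ 6) (0 :: int ^ 'd) i)"
  proof (intro sum_mono mult_left_mono poisson_weight_nonneg assms(1))
    fix i assume i: "i \<in> {..<Suc (N ^ 2)}"
    have "i * N ^ 4 \<le> N ^ 2 * N ^ 4" using i by (intro mult_right_mono) auto
    then have "i * N ^ 4 \<le> N ^ 6" by (simp flip: power_add)
    then have "visit_prob {0} (i * N ^ 4) (0 :: int ^ 'd) i \<le> visit_prob {0} (N ^ 6) (0 :: int ^ 'd) i"
      by (rule visit_prob_mono)
    then show "?r ^ i \<le> visit_prob {0} (N ^ 6) (0 :: int ^ 'd) i"
      using power_le_visit_prob[of "0 :: int ^ 'd" "N ^ 4" i] by linarith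
  qed
  also have "\<dots> \<le> (\<Sum>i\<le>N ^ 6. poisson_weight s i * visit_prob {0} (N ^ 6) (0 :: int ^ 'd) i)"
  proof (intro sum_mono2)
    have "N ^ 2 \<le> N ^ 6" by (cases "N = 0") (auto intro: power_increasing)
    then show "{..<Suc (N ^ 2)} \<subseteq> {..N ^ 6}" by auto
  qed (auto intro!: mult_nonneg_nonneg poisson_weight_nonneg assms(1))
  finally have 1: "real m * esc * (exp ((?r - 1) * s) - exp ((exp 1 - 1) * s) / exp 1 ^ Suc (N ^ 2))
    \<le> real m * esc * (\<Sum>i\<le>N ^ 6. poisson_weight s i * visit_prob {0} (N ^ 6) (0 :: int ^ 'd) i)"
    by (intro mult_left_mono) (auto simp: escape_prob_def)
  have "(\<Sum>i\<le>N ^ 6. poisson_weight s i * \<rho> ^ i) \<le> exp (- esc * s)"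
    using sum_poisson_weight_le[of s \<rho> "{..N ^ 6}"] assms(1) \<rho> by (simp add: \<rho>_def)
  then have 2: "(real m)\<^sup>2 * (\<Sum>i\<le>N ^ 6. poisson_weight s i * \<rho> ^ i)\<^sup>2 \<le> (real m)\<^sup>2 * (exp (- esc * s))\<^sup>2"
    using assms(1) \<rho> by (intro mult_left_mono power_mono sum_nonneg mult_nonneg_nonneg poisson_weight_nonneg) auto
  have "(\<Sum>i\<le>n. poisson_weight (2 * s) i * ?q ^ i) \<le> exp ((?q - 1) * (2 * s))"
    using assms(1) \<rho> by (intro sum_poisson_weight_le) auto
  then have 3: "real m * real (N ^ 6) * (2 * real (N ^ 6) + 1) ^ CARD('d) * (\<Sum>i\<le>n. poisson_weight (2 * s) i * ?q ^ i)
    \<le> real m * real (N ^ 6) * (2 * real (N ^ 6) + 1) ^ CARD('d) * exp ((?q - 1) * (2 * s))"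
    by (intro mult_left_mono) auto
  have "1 - \<rho> = esc" by (simp add: \<rho>_def)
  moreover have "return_prob TYPE('d) k \<le> \<rho>" for k using return_prob_le by (simp add: \<rho>_def)
  ultimately have "real m * esc * (\<Sum>i\<le>N ^ 6. poisson_weight s i * visit_prob {0} (N ^ 6) (0 :: int ^ 'd) i)
      - (real m)\<^sup>2 * (\<Sum>i\<le>N ^ 6. poisson_weight s i * \<rho> ^ i)\<^sup>2
      - real m * real (N ^ 6) * (2 * real (N ^ 6) + 1) ^ CARD('d) * (\<Sum>i\<le>n. poisson_weight (2 * s) i * ?q ^ i)
    \<le> prob {\<omega> \<in> space M. heavy T s (path_of X n \<omega>) n \<omega>}"
    using prob_heavy_lower[of \<rho> m "N ^ 6" n, OF _ \<rho>(2) assms(2)] by (simp only:)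
  then show ?thesis using 1 2 3 unfolding mult.assoc by linarith
qed

end

section \<open>The discrete asymptotics\<close>

context walk_space
begin

lemma prob_max_local_time_asymp:
  fixes \<beta> u :: real
  assumes dim: "CARD('d) \<ge> 3" and \<beta>: "\<beta> > 1"
  defines "s \<equiv> \<lambda>n :: nat. \<beta> * alpha_const M X * ln (real n) + u"
  shows "(\<lambda>n. prob {\<omega> \<in> space M. s n < real (max_local_time X n \<omega>)})
    \<sim>[at_top] (\<lambda>n. esc * real n * (1 - esc) ^ nat \<lfloor>s n\<rfloor>)"
proof -
  define \<rho> where "\<rho> = 1 - esc"
  have \<rho>: "0 < \<rho>" "\<rho> < 1" "1 - \<rho> = esc"
    using escape_prob_pos[OF dim] escape_prob_less_1 by (simp_all add: \<rho>_def)
  define a where "a = \<beta> * alpha_const M X"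
  \<comment> \<open>The choice of \<alpha> makes \<open>\<rho> powr (a * ln n)\<close> equal to
    \<open>n powr (- \<beta>)\<close>.\<close>
  have a: "0 < a" "a * ln \<rho> = - \<beta>"
    using \<rho> \<beta> by (simp_all add: a_def alpha_const_def \<rho>_def divide_less_0_iff mult_pos_neg)
  have s_eq: "s = (\<lambda>n. a * ln (real n) + u)" by (simp add: s_def a_def)
  have s_top: "filterlim s at_top sequentially"
    unfolding s_eq by (rule filterlim_compose[OF ln_affine_at_top[OF a(1)] filterlim_real_sequentially])
  have s_nonneg: "\<forall>\<^sub>F n in sequentially. 0 \<le> s n"
    using s_top by (simp add: filterlim_at_top)
  define N where "N n = nat \<lfloor>s n\<rfloor>" for n
  have N_top: "filterlim N sequentially sequentially"
    unfolding N_def by (rule filterlim_compose[OF filterlim_nat_floor s_top])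
  define r where "r N = return_prob TYPE('d) (N ^ 4)" for N
  define b where "b = (2 * \<rho> / (1 + \<rho>))\<^sup>2"
  have L_small: "(\<lambda>n. real (N n ^ 5) / real n) \<longlonglongrightarrow> 0"
  proof (rule tendsto_sandwich)
    show "\<forall>\<^sub>F n in sequentially. 0 \<le> real (N n ^ 5) / real n" by simp
    show "\<forall>\<^sub>F n in sequentially. real (N n ^ 5) / real n \<le> (a * ln (real n) + (u + 1)) ^ 6 / real n"
      using s_nonneg eventually_gt_at_top[of 0]
    proof eventually_elim
      case (elim n)
      have "real (N n) \<le> s n" using elim(1) by (simp add: N_def)
      then have "real (N n) ^ 5 \<le> (s n + 1) ^ 5" using elim(1) by (intro power_mono) auto
      also have "\<dots> \<le> (s n + 1) ^ 6" using elim(1) by (intro power_increasing) auto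
      finally show ?case using elim(2) by (intro divide_right_mono) (simp_all add: s_eq add.assoc)
    qed
    show "(\<lambda>n. (a * ln (real n) + (u + 1)) ^ 6 / real n) \<longlonglongrightarrow> 0"
      by (rule filterlim_compose[OF ln_power_over_tendsto_0[OF a(1)] filterlim_real_sequentially])
  qed simp
  have enough: "\<forall>\<^sub>F n in sequentially. N n ^ 5 \<le> n"
    using order_tendstoD(2)[OF L_small zero_less_one] eventually_gt_at_top[of 0]
    by eventually_elim (simp add: field_simps flip: of_nat_power)
  have n1: "(\<lambda>n. (real n + 1) / real n) \<longlonglongrightarrow> 1" by real_asymp
  show ?thesis unfolding \<rho>_def[symmetric] N_def[symmetric]
  proof (rule asymp_equiv_of_moment_bounds)
    show "\<forall>\<^sub>F n in sequentially. prob {\<omega> \<in> space M. s n < real (max_local_time X n \<omega>)}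
      \<le> (\<Sum>k\<le>n. 1 - return_prob TYPE('d) k) * \<rho> ^ N n + 0"
      using s_nonneg unfolding N_def \<rho>_def add_0_right by eventually_elim (rule prob_max_local_time_le)
    show "\<forall>\<^sub>F n in sequentially. real (Suc n - N n ^ 5) * esc * r (N n) ^ N n - (real (Suc n - N n ^ 5))\<^sup>2 * (\<rho> ^ N n)\<^sup>2
        - real (Suc n - N n ^ 5) * (real (N n ^ 5) * (2 * real (N n ^ 5) + 1) ^ CARD('d) * b ^ N n) - 0
      \<le> prob {\<omega> \<in> space M. s n < real (max_local_time X n \<omega>)}"
      using s_nonneg enough
    proof eventually_elim
      case (elim n)
      then show ?case
        using prob_max_local_time_ge[of "s n" "N n" "Suc n - N n ^ 5" n]
        by (simp only: N_def b_def \<rho>_def r_def diff_0_right)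
    qed
    show "\<forall>\<^sub>F n in sequentially. 0 < real n" using eventually_gt_at_top[of 0] by eventually_elim simp
    show "0 < \<rho> ^ N n" for n using \<rho> by simp
    show "0 < esc" by (rule escape_prob_pos[OF dim])
    show "(\<lambda>n. (\<Sum>k\<le>n. 1 - return_prob TYPE('d) k) / real n) \<longlonglongrightarrow> esc"
    proof (rule Lim_transform_eventually)
      show "(\<lambda>n. ((\<Sum>k\<le>n. 1 - return_prob TYPE('d) k) / (real n + 1)) * ((real n + 1) / real n)) \<longlonglongrightarrow> esc"
        using tendsto_mult[OF mean_fresh_tendsto n1] by simp
    qed (simp add: add_nonneg_eq_0_iff)
    show "(\<lambda>n. 0 / (real n * \<rho> ^ N n)) \<longlonglongrightarrow> 0" "(\<lambda>n. 0 / (real n * \<rho> ^ N n)) \<longlonglongrightarrow> 0" by simp_all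
    show "(\<lambda>n. real (Suc n - N n ^ 5) / real n) \<longlonglongrightarrow> 1"
    proof (rule Lim_transform_eventually)
      show "(\<lambda>n. (real n + 1) / real n - real (N n ^ 5) / real n) \<longlonglongrightarrow> 1"
        using tendsto_diff[OF n1 L_small] by simp
      show "\<forall>\<^sub>F n in sequentially. (real n + 1) / real n - real (N n ^ 5) / real n = real (Suc n - N n ^ 5) / real n"
        using enough by eventually_elim (simp add: of_nat_diff diff_divide_distrib add.commute del: of_nat_power)
    qed
    \<comment> \<open>By Bernoulli's inequality \<open>(r / \<rho>) ^ N\<close> is at least
      \<open>1 - N * (\<rho> - r) / \<rho>\<close>, so a gap of smaller order than
      \<open>1 / N\<close> suffices.\<close>
    have "(\<lambda>N. r N ^ N / \<rho> ^ N) \<longlonglongrightarrow> 1"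
    proof (rule tendsto_sandwich)
      have "(\<lambda>N. 1 - ((1 - esc - r N) * real N) / \<rho>) \<longlonglongrightarrow> 1 - 0 / \<rho>"
        unfolding r_def using \<rho> by (intro tendsto_intros gap_times_level_tendsto dim) auto
      then show "(\<lambda>N. 1 - ((1 - esc - r N) * real N) / \<rho>) \<longlonglongrightarrow> 1" by simp
      show "\<forall>\<^sub>F N in sequentially. 1 - ((1 - esc - r N) * real N) / \<rho> \<le> r N ^ N / \<rho> ^ N"
      proof (intro always_eventually allI)
        fix N
        have "1 + real N * (r N / \<rho> - 1) \<le> (1 + (r N / \<rho> - 1)) ^ N"
          using \<rho> by (intro Bernoulli_inequality) (simp add: r_def)
        moreover have "1 - ((1 - esc - r N) * real N) / \<rho> = 1 + real N * (r N / \<rho> - 1)"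
          using \<rho> by (simp add: \<rho>_def field_simps)
        ultimately show "1 - ((1 - esc - r N) * real N) / \<rho> \<le> r N ^ N / \<rho> ^ N"
          by (simp add: power_divide)
      qed
      show "\<forall>\<^sub>F N in sequentially. r N ^ N / \<rho> ^ N \<le> 1"
        using \<rho> return_prob_le by (intro always_eventually allI) (simp add: r_def \<rho>_def power_mono)
    qed simp
    then show "(\<lambda>n. r (N n) ^ N n / \<rho> ^ N n) \<longlonglongrightarrow> 1" by (rule filterlim_compose[OF _ N_top])
    show "(\<lambda>n. real n * \<rho> ^ N n) \<longlonglongrightarrow> 0"
    proof (rule tendsto_sandwich)
      show "\<forall>\<^sub>F n in sequentially. 0 \<le> real n * \<rho> ^ N n" using \<rho> by simp
      \<comment> \<open>The shift \<open>u - 1\<close> absorbs the rounding of \<open>s n\<close>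
        down to \<open>N n\<close>.\<close>
      show "(\<lambda>n. real n * (real n powr - \<beta> * \<rho> powr (u - 1))) \<longlonglongrightarrow> 0"
        by (rule filterlim_compose[OF times_powr_tendsto_0[OF \<beta>] filterlim_real_sequentially])
      show "\<forall>\<^sub>F n in sequentially. real n * \<rho> ^ N n \<le> real n * (real n powr - \<beta> * \<rho> powr (u - 1))"
        using s_nonneg eventually_gt_at_top[of 0]
      proof eventually_elim
        case (elim n)
        have "\<rho> ^ N n = \<rho> powr real (N n)" using \<rho> by (simp add: powr_realpow)
        also have "\<dots> \<le> \<rho> powr (s n - 1)"
        proof (rule powr_mono')
          show "s n - 1 \<le> real (N n)" using elim(1) unfolding N_def by linarith
        qed (use \<rho> in auto)
        also have "\<dots> = \<rho> powr (a * ln (real n)) * \<rho> powr (u - 1)"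
          by (simp add: s_eq powr_add[symmetric] algebra_simps)
        also have "\<rho> powr (a * ln (real n)) = exp ((a * ln \<rho>) * ln (real n))"
          using \<rho> by (simp add: powr_def mult_ac)
        also have "\<dots> = real n powr - \<beta>" using elim(2) unfolding a(2) by (simp add: powr_def)
        finally show ?case by (intro mult_left_mono) auto
      qed
    qed simp
    have b: "0 \<le> b / \<rho>" "b / \<rho> < 1"
      using pair_rate_less[OF \<rho>(1,2)] \<rho> by (simp_all add: b_def)
    have "(\<lambda>n. real (N n ^ 5) * (2 * real (N n ^ 5) + 1) ^ CARD('d) * (b / \<rho>) ^ N n) \<longlonglongrightarrow> 0"
      by (rule filterlim_compose[OF box_times_geometric_tendsto_0[OF b] N_top])
    then show "(\<lambda>n. real (N n ^ 5) * (2 * real (N n ^ 5) + 1) ^ CARD('d) * b ^ N n / \<rho> ^ N n) \<longlonglongrightarrow> 0"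
      by (simp add: power_divide)
  qed
qed

end

section \<open>The continuous asymptotics\<close>

context jump_walk
begin

lemma prob_max_ct_local_time_asymp:
  fixes \<beta> u :: real
  assumes dim: "CARD('d) \<ge> 3" and \<beta>: "\<beta> > 1"
  defines "s \<equiv> \<lambda>t :: real. \<beta> * inverse esc * ln t + u"
  shows "(\<lambda>t. prob {\<omega> \<in> space M. s t < max_ct_local_time X T t \<omega>})
    \<sim>[at_top] (\<lambda>t. esc * t * exp (- esc * s t))"
proof -
  define \<rho> where "\<rho> = 1 - esc"
  have esc: "0 < esc" by (rule escape_prob_pos[OF dim])
  have \<rho>: "0 < \<rho>" "\<rho> < 1" using esc escape_prob_less_1 by (simp_all add: \<rho>_def)
  define a where "a = \<beta> * inverse esc"
  have a: "0 < a" "esc * a = \<beta>" using esc \<beta> by (simp_all add: a_def)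
  have s_eq: "s = (\<lambda>t. a * ln t + u)" by (simp add: s_def a_def)
  have s_top: "filterlim s at_top at_top" unfolding s_eq by (rule ln_affine_at_top[OF a(1)])
  have s_nonneg: "\<forall>\<^sub>F t in at_top. 0 \<le> s t" using s_top by (simp add: filterlim_at_top)
  \<comment> \<open>Rounded up, because here \<open>N\<close> is only a length scale and has to
    dominate \<open>s t\<close>.\<close>
  define N where "N t = nat \<lceil>s t\<rceil>" for t
  have N_bounds: "s t \<le> real (N t)" "real (N t) \<le> s t + 1" if "0 \<le> s t" for t
    using that by (simp_all add: N_def of_nat_ceiling)
  have N_top: "filterlim N sequentially at_top"
    unfolding N_def by (rule filterlim_compose[OF filterlim_nat_ceiling s_top])
  define r where "r N = return_prob TYPE('d) (N ^ 4)" for N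
  \<comment> \<open>The exponential rate, per unit of \<open>s\<close>, by which overlapping pairs
    are rarer than single heavy sites.\<close>
  define \<delta> where "\<delta> = 2 * (1 - 2 * \<rho> / (1 + \<rho>)) - esc"
  have \<delta>: "0 < \<delta>" using pair_rate_less(3)[OF \<rho>] by (simp add: \<delta>_def \<rho>_def)
  define H where "H t = exp (- esc * s t)" for t
  have H_eq: "H t = t powr (- \<beta>) * exp (- esc * u)" if "0 < t" for t
  proof -
    have "H t = exp (- (esc * a) * ln t) * exp (- esc * u)"
      by (simp add: H_def s_eq exp_add[symmetric] algebra_simps)
    then show ?thesis using that by (simp add: a(2) powr_def)
  qed
  define n\<^sub>1 where "n\<^sub>1 t = nat \<lceil>t + t powr (2/3)\<rceil>" for t :: real
  \<comment> \<open>One is subtracted so that the number \<open>Suc (n\<^sub>2 t)\<close> of holding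
    times involved is the rounded value itself, for large \<open>t\<close>.\<close>
  define n\<^sub>2 where "n\<^sub>2 t = nat \<lfloor>t - t powr (2/3)\<rfloor> - 1" for t :: real
  define E where "E t = exp (t powr (-1/3) * t) / (1 + t powr (-1/3)) powr (t + t powr (2/3))" for t :: real
  define E' where "E' t = exp (- (t powr (-1/3)) * t) / (1 - t powr (-1/3)) powr (t - t powr (2/3))" for t :: real
  have n1_top: "filterlim n\<^sub>1 sequentially at_top"
    unfolding n\<^sub>1_def by (rule filterlim_compose[OF filterlim_nat_ceiling upper_index_at_top])
  have n2: "\<forall>\<^sub>F t in at_top. Suc (n\<^sub>2 t) = nat \<lfloor>t - t powr (2/3)\<rfloor>"
  proof -
    have "\<forall>\<^sub>F t :: real in at_top. 1 \<le> t - t powr (2/3)" using lower_index_at_top by (simp add: filterlim_at_top)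
    then show ?thesis by eventually_elim (simp add: n\<^sub>2_def Suc_diff_1 le_floor_iff zero_less_nat_eq)
  qed
  have n2_lim: "((\<lambda>t. real (Suc (n\<^sub>2 t)) / t) \<longlongrightarrow> 1) at_top"
    by (rule Lim_transform_eventually[OF lower_index_asymp]) (use n2 in \<open>eventually_elim, simp\<close>)
  have L_small: "((\<lambda>t. real (N t ^ 6) / t) \<longlongrightarrow> 0) at_top"
  proof (rule tendsto_sandwich)
    show "\<forall>\<^sub>F t in at_top. 0 \<le> real (N t ^ 6) / t"
      using eventually_gt_at_top[of 0] by eventually_elim simp
    show "\<forall>\<^sub>F t in at_top. real (N t ^ 6) / t \<le> (a * ln t + (u + 1)) ^ 6 / t"
      using s_nonneg eventually_gt_at_top[of 0]
    proof eventually_elim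
      case (elim t)
      have "real (N t) ^ 6 \<le> (s t + 1) ^ 6" using N_bounds[OF elim(1)] by (intro power_mono) auto
      then show ?case using elim(2) by (intro divide_right_mono) (simp_all add: s_eq add.assoc)
    qed
    show "((\<lambda>t. (a * ln t + (u + 1)) ^ 6 / t) \<longlongrightarrow> 0) at_top" by (rule ln_power_over_tendsto_0[OF a(1)])
  qed simp
  have enough: "\<forall>\<^sub>F t in at_top. N t ^ 6 \<le> Suc (n\<^sub>2 t)"
  proof -
    have "\<forall>\<^sub>F t in at_top. real (N t ^ 6) / t < 1 / 2" "\<forall>\<^sub>F t in at_top. 1 / 2 < real (Suc (n\<^sub>2 t)) / t"
      by (rule order_tendstoD[OF L_small] order_tendstoD[OF n2_lim]; simp)+
    then show ?thesis using eventually_gt_at_top[of 0]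
    proof eventually_elim
      case (elim t)
      have "real (N t ^ 6) / t < real (Suc (n\<^sub>2 t)) / t" using elim(1,2) by linarith
      then have "real (N t ^ 6) < real (Suc (n\<^sub>2 t))" using elim(3) by (simp only: divide_less_cancel)
      then show ?case by linarith
    qed
  qed
  have small: "\<forall>\<^sub>F t :: real in at_top. 0 < t powr (-1/3) \<and> t powr (-1/3) < 1"
    using eventually_gt_at_top[of 1]
  proof eventually_elim
    case (elim t)
    then have "t powr (-1/3) < t powr 0" by (intro powr_less_mono) auto
    then show ?case using elim by simp
  qed
  show ?thesis unfolding H_def[symmetric]
  proof (rule asymp_equiv_of_moment_bounds)
    show "\<forall>\<^sub>F t in at_top. prob {\<omega> \<in> space M. s t < max_ct_local_time X T t \<omega>}
      \<le> (\<Sum>k\<le>n\<^sub>1 t. 1 - return_prob TYPE('d) k) * H t + E t"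
      using s_nonneg small eventually_gt_at_top[of 0]
    proof eventually_elim
      case (elim t)
      let ?a = "1 + t powr (-1/3)"
      have "prob {\<omega> \<in> space M. s t < max_ct_local_time X T t \<omega>}
        \<le> prob {\<omega> \<in> space M. heavy T (s t) (path_of X (n\<^sub>1 t) \<omega>) (n\<^sub>1 t) \<omega>} + (1 - (\<Sum>i<Suc (n\<^sub>1 t). poisson_weight t i))"
        using elim by (intro prob_max_ct_local_time_le) auto
      also have "1 - (\<Sum>i<Suc (n\<^sub>1 t). poisson_weight t i) \<le> exp ((?a - 1) * t) / ?a ^ Suc (n\<^sub>1 t)"
        using elim by (intro sum_poisson_weight_upper_tail) auto
      also have "\<dots> \<le> E t"
      proof -
        have "t + t powr (2/3) \<le> real (Suc (n\<^sub>1 t))" unfolding n\<^sub>1_def by linarith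
        then have "?a powr (t + t powr (2/3)) \<le> ?a powr real (Suc (n\<^sub>1 t))"
          using elim by (intro powr_mono) auto
        also have "\<dots> = ?a ^ Suc (n\<^sub>1 t)" using elim by (intro powr_realpow add_pos_nonneg) auto
        finally show ?thesis unfolding E_def using elim add_pos_nonneg[of 1 "t powr (-1/3)"] by (intro frac_le) auto
      qed
      finally show ?case using prob_heavy_exponential_le[OF elim(1), of "n\<^sub>1 t"] unfolding H_def by linarith
    qed
    show "\<forall>\<^sub>F t in at_top. real (Suc (n\<^sub>2 t) - N t ^ 6) * esc *
          (exp ((r (N t) - 1) * s t) - exp ((exp 1 - 1) * s t) / exp 1 ^ Suc (N t ^ 2))
        - (real (Suc (n\<^sub>2 t) - N t ^ 6))\<^sup>2 * (H t)\<^sup>2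
        - real (Suc (n\<^sub>2 t) - N t ^ 6) * (real (N t ^ 6) * (2 * real (N t ^ 6) + 1) ^ CARD('d) * exp ((2 * \<rho> / (1 + \<rho>) - 1) * (2 * s t))) - E' t
      \<le> prob {\<omega> \<in> space M. s t < max_ct_local_time X T t \<omega>}"
      using s_nonneg small eventually_gt_at_top[of 0] enough n2
    proof eventually_elim
      case (elim t)
      let ?a = "1 - t powr (-1/3)"
      have pos: "0 < nat \<lfloor>t - t powr (2/3)\<rfloor>" using elim(5) by (metis zero_less_Suc)
      have "(\<Sum>i<Suc (n\<^sub>2 t). poisson_weight t i) \<le> exp ((?a - 1) * t) / ?a ^ Suc (n\<^sub>2 t)"
        using elim by (intro sum_poisson_weight_lower_tail) auto
      also have "\<dots> \<le> E' t"
      proof -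
        have "real (Suc (n\<^sub>2 t)) \<le> t - t powr (2/3)" unfolding elim(5) using pos by linarith
        then have "?a powr (t - t powr (2/3)) \<le> ?a powr real (Suc (n\<^sub>2 t))"
          using elim by (intro powr_mono') auto
        also have "\<dots> = ?a ^ Suc (n\<^sub>2 t)" using elim by (intro powr_realpow) auto
        finally show ?thesis unfolding E'_def using elim by (intro frac_le) auto
      qed
      finally have tail: "(\<Sum>i<Suc (n\<^sub>2 t). poisson_weight t i) \<le> E' t" .
      have "prob {\<omega> \<in> space M. heavy T (s t) (path_of X (n\<^sub>2 t) \<omega>) (n\<^sub>2 t) \<omega>} - (\<Sum>i<Suc (n\<^sub>2 t). poisson_weight t i)
        \<le> prob {\<omega> \<in> space M. s t < max_ct_local_time X T t \<omega>}"
        using elim by (intro prob_max_ct_local_time_ge) auto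
      moreover have "Suc (n\<^sub>2 t) - N t ^ 6 + N t ^ 6 \<le> Suc (n\<^sub>2 t)" using elim(4) by simp
      ultimately show ?case
        using tail prob_heavy_exponential_ge[OF elim(1), of "Suc (n\<^sub>2 t) - N t ^ 6" "N t" "n\<^sub>2 t"]
        unfolding H_def \<rho>_def r_def by linarith
    qed
    show "\<forall>\<^sub>F t :: real in at_top. 0 < t" by (rule eventually_gt_at_top)
    show "0 < H t" for t by (simp add: H_def)
    show "0 < esc" by (rule esc)
    show "((\<lambda>t. (\<Sum>k\<le>n\<^sub>1 t. 1 - return_prob TYPE('d) k) / t) \<longlongrightarrow> esc) at_top"
    proof (rule Lim_transform_eventually)
      have "((\<lambda>t. (\<Sum>k\<le>n\<^sub>1 t. 1 - return_prob TYPE('d) k) / (real (n\<^sub>1 t) + 1)) \<longlongrightarrow> esc) at_top"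
        by (rule filterlim_compose[OF mean_fresh_tendsto n1_top])
      from tendsto_mult[OF this upper_index_asymp]
      show "((\<lambda>t. ((\<Sum>k\<le>n\<^sub>1 t. 1 - return_prob TYPE('d) k) / (real (n\<^sub>1 t) + 1)) * ((real (n\<^sub>1 t) + 1) / t)) \<longlongrightarrow> esc) at_top"
        by (simp add: n\<^sub>1_def)
    qed (simp add: add_nonneg_eq_0_iff)
    \<comment> \<open>Up to a constant \<open>t * H t\<close> is
      \<open>t powr (1 - \<beta>)\<close>, so the Chernoff errors only have to beat a power of
      \<open>t\<close>.\<close>
    have E_eq: "F / (t * H t) = F * t powr (\<beta> - 1) * exp (esc * u)" if "0 < t" for t F
      using that by (simp add: H_eq powr_minus powr_diff exp_minus field_simps)
    show "((\<lambda>t. E t / (t * H t)) \<longlongrightarrow> 0) at_top"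
    proof (rule Lim_transform_eventually)
      show "((\<lambda>t. E t * t powr (\<beta> - 1) * exp (esc * u)) \<longlongrightarrow> 0) at_top"
        unfolding E_def by (rule tendsto_mult_left_zero[OF chernoff_upper_small[OF \<beta>]])
      show "\<forall>\<^sub>F t in at_top. E t * t powr (\<beta> - 1) * exp (esc * u) = E t / (t * H t)"
        using eventually_gt_at_top[of 0] by eventually_elim (simp only: E_eq)
    qed
    show "((\<lambda>t. E' t / (t * H t)) \<longlongrightarrow> 0) at_top"
    proof (rule Lim_transform_eventually)
      show "((\<lambda>t. E' t * t powr (\<beta> - 1) * exp (esc * u)) \<longlongrightarrow> 0) at_top"
        unfolding E'_def by (rule tendsto_mult_left_zero[OF chernoff_lower_small[OF \<beta>]])
      show "\<forall>\<^sub>F t in at_top. E' t * t powr (\<beta> - 1) * exp (esc * u) = E' t / (t * H t)"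
        using eventually_gt_at_top[of 0] by eventually_elim (simp only: E_eq)
    qed
    show "((\<lambda>t. real (Suc (n\<^sub>2 t) - N t ^ 6) / t) \<longlongrightarrow> 1) at_top"
    proof (rule Lim_transform_eventually)
      show "((\<lambda>t. real (Suc (n\<^sub>2 t)) / t - real (N t ^ 6) / t) \<longlongrightarrow> 1) at_top"
        using tendsto_diff[OF n2_lim L_small] by simp
      show "\<forall>\<^sub>F t in at_top. real (Suc (n\<^sub>2 t)) / t - real (N t ^ 6) / t = real (Suc (n\<^sub>2 t) - N t ^ 6) / t"
        using enough by eventually_elim (simp only: of_nat_diff diff_divide_distrib)
    qed
    have r_le: "r N \<le> 1 - esc" for N by (simp only: r_def return_prob_le)
    show "((\<lambda>t. (exp ((r (N t) - 1) * s t) - exp ((exp 1 - 1) * s t) / exp 1 ^ Suc (N t ^ 2)) / H t) \<longlongrightarrow> 1) at_top"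
    proof (rule Lim_transform_eventually)
      \<comment> \<open>Dividing by \<open>H t\<close> leaves the gap \<open>r - \<rho>\<close>
        times \<open>s t\<close> in the exponent; since \<open>s t \<le> N t\<close>, the window
        estimate sends it to 0.\<close>
      have "((\<lambda>t. (r (N t) - (1 - esc)) * s t) \<longlongrightarrow> 0) at_top"
      proof (rule tendsto_sandwich)
        show "((\<lambda>t. - ((1 - esc - r (N t)) * real (N t))) \<longlongrightarrow> 0) at_top"
          using tendsto_minus[OF filterlim_compose[OF gap_times_level_tendsto[OF dim] N_top]] by (simp add: r_def)
        show "\<forall>\<^sub>F t in at_top. - ((1 - esc - r (N t)) * real (N t)) \<le> (r (N t) - (1 - esc)) * s t"
          using s_nonneg
        proof eventually_elim
          case (elim t)
          have "(1 - esc - r (N t)) * s t \<le> (1 - esc - r (N t)) * real (N t)"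
            using N_bounds[OF elim] r_le by (intro mult_left_mono) auto
          then show ?case by (simp add: algebra_simps)
        qed
        show "\<forall>\<^sub>F t in at_top. (r (N t) - (1 - esc)) * s t \<le> 0"
          using s_nonneg by eventually_elim (use r_le in \<open>simp add: mult_nonpos_nonneg\<close>)
      qed simp
      from tendsto_exp[OF this] have 1: "((\<lambda>t. exp ((r (N t) - (1 - esc)) * s t)) \<longlongrightarrow> 1) at_top" by simp
      \<comment> \<open>The Poisson mass cut off at \<open>N ^ 2\<close>, relative to
        \<open>H\<close>: a linear term in \<open>N\<close> against a quadratic one.\<close>
      have 2: "((\<lambda>t. exp ((exp 1 - 1 + esc) * s t - real (Suc (N t ^ 2)))) \<longlongrightarrow> 0) at_top"
      proof (rule tendsto_sandwich)
        show "\<forall>\<^sub>F t in at_top. 0 \<le> exp ((exp 1 - 1 + esc) * s t - real (Suc (N t ^ 2)))" by simp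
        have "(\<lambda>N :: nat. exp ((exp 1 - 1 + esc) * real N - real N ^ 2)) \<longlonglongrightarrow> 0"
          using esc exp_gt_one[of "1 :: real"] by (intro exp_minus_square_tendsto_0) linarith
        from filterlim_compose[OF this N_top]
        show "((\<lambda>t. exp ((exp 1 - 1 + esc) * real (N t) - real (N t) ^ 2)) \<longlongrightarrow> 0) at_top" .
        show "\<forall>\<^sub>F t in at_top. exp ((exp 1 - 1 + esc) * s t - real (Suc (N t ^ 2))) \<le> exp ((exp 1 - 1 + esc) * real (N t) - real (N t) ^ 2)"
          using s_nonneg
        proof eventually_elim
          case (elim t)
          have "(exp 1 - 1 + esc) * s t \<le> (exp 1 - 1 + esc) * real (N t)"
            using N_bounds[OF elim] esc exp_ge_add_one_self[of 1] by (intro mult_left_mono) auto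
          then show ?case by simp
        qed
      qed simp
      show "((\<lambda>t. exp ((r (N t) - (1 - esc)) * s t) - exp ((exp 1 - 1 + esc) * s t - real (Suc (N t ^ 2)))) \<longlongrightarrow> 1) at_top"
        using tendsto_diff[OF 1 2] by simp
      show "\<forall>\<^sub>F t in at_top. exp ((r (N t) - (1 - esc)) * s t) - exp ((exp 1 - 1 + esc) * s t - real (Suc (N t ^ 2)))
        = (exp ((r (N t) - 1) * s t) - exp ((exp 1 - 1) * s t) / exp 1 ^ Suc (N t ^ 2)) / H t"
      proof (intro always_eventually allI)
        fix t
        have "exp 1 ^ Suc (N t ^ 2) = exp (real (Suc (N t ^ 2)))" by (simp only: exp_of_nat_mult[symmetric] mult_1_right)
        moreover have "exp ((r (N t) - (1 - esc)) * s t) = exp ((r (N t) - 1) * s t) / H t"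
          by (simp add: H_def exp_diff[symmetric] algebra_simps)
        moreover have "exp ((exp 1 - 1 + esc) * s t - real (Suc (N t ^ 2))) = exp ((exp 1 - 1) * s t) / exp (real (Suc (N t ^ 2))) / H t"
          by (simp only: H_def exp_diff[symmetric]) (simp add: algebra_simps)
        ultimately show "exp ((r (N t) - (1 - esc)) * s t) - exp ((exp 1 - 1 + esc) * s t - real (Suc (N t ^ 2)))
          = (exp ((r (N t) - 1) * s t) - exp ((exp 1 - 1) * s t) / exp 1 ^ Suc (N t ^ 2)) / H t"
          by (simp only: diff_divide_distrib)
      qed
    qed
    have "((\<lambda>t. t * (t powr - \<beta> * exp (- esc * u))) \<longlongrightarrow> 0) at_top" by (rule times_powr_tendsto_0[OF \<beta>])
    then show "((\<lambda>t. t * H t) \<longlongrightarrow> 0) at_top"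
      by (rule Lim_transform_eventually) (use eventually_gt_at_top[of 0] in \<open>eventually_elim, simp add: H_eq\<close>)
    show "((\<lambda>t. real (N t ^ 6) * (2 * real (N t ^ 6) + 1) ^ CARD('d) * exp ((2 * \<rho> / (1 + \<rho>) - 1) * (2 * s t)) / H t) \<longlongrightarrow> 0) at_top"
    proof (rule tendsto_sandwich)
      show "\<forall>\<^sub>F t in at_top. 0 \<le> real (N t ^ 6) * (2 * real (N t ^ 6) + 1) ^ CARD('d) * exp ((2 * \<rho> / (1 + \<rho>) - 1) * (2 * s t)) / H t"
        by (simp add: H_def)
      show "\<forall>\<^sub>F t in at_top. real (N t ^ 6) * (2 * real (N t ^ 6) + 1) ^ CARD('d) * exp ((2 * \<rho> / (1 + \<rho>) - 1) * (2 * s t)) / H t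
        \<le> exp \<delta> * (real (N t ^ 6) * (2 * real (N t ^ 6) + 1) ^ CARD('d) * exp (- \<delta>) ^ N t)"
        using s_nonneg
      proof eventually_elim
        case (elim t)
        have "exp ((2 * \<rho> / (1 + \<rho>) - 1) * (2 * s t)) / H t = exp (- \<delta> * s t)"
          unfolding H_def exp_diff[symmetric] \<delta>_def by (intro arg_cong[where f = exp]) (simp add: algebra_simps)
        also have "\<dots> \<le> exp (\<delta> - \<delta> * real (N t))"
          using N_bounds[OF elim] mult_left_mono[of "real (N t)" "s t + 1" \<delta>] \<delta> by (simp add: algebra_simps)
        also have "\<dots> = exp \<delta> * exp (- \<delta>) ^ N t"
          by (simp add: exp_of_nat_mult[symmetric] exp_add[symmetric] algebra_simps)
        finally have "real (N t ^ 6) * (2 * real (N t ^ 6) + 1) ^ CARD('d) * (exp ((2 * \<rho> / (1 + \<rho>) - 1) * (2 * s t)) / H t)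
          \<le> real (N t ^ 6) * (2 * real (N t ^ 6) + 1) ^ CARD('d) * (exp \<delta> * exp (- \<delta>) ^ N t)"
          by (intro mult_left_mono) auto
        then show ?case by (simp only: times_divide_eq_right mult_ac)
      qed
      have "((\<lambda>t. exp \<delta> * (real (N t ^ 6) * (2 * real (N t ^ 6) + 1) ^ CARD('d) * exp (- \<delta>) ^ N t)) \<longlongrightarrow> exp \<delta> * 0) at_top"
        using \<delta> by (intro tendsto_mult tendsto_const filterlim_compose[OF box_times_geometric_tendsto_0 N_top]) auto
      then show "((\<lambda>t. exp \<delta> * (real (N t ^ 6) * (2 * real (N t ^ 6) + 1) ^ CARD('d) * exp (- \<delta>) ^ N t)) \<longlongrightarrow> 0) at_top"
        by simp
    qed simp
  qed
qed

end

theorem theorem1p1: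
  fixes M :: "'a measure"
    and X :: "nat \<Rightarrow> 'a \<Rightarrow> int ^ 'd"
    and T :: "nat \<Rightarrow> 'a \<Rightarrow> real"
    and \<beta> u :: real
  defines "\<gamma> \<equiv> escape_prob M X"
    and "\<alpha> \<equiv> alpha_const M X"
  assumes "prob_space M"
    and "CARD('d) \<ge> 3"
    and "simple_walk_steps M X"
    and "exp_holding_times M T"
    and "steps_indep_times M X T"
    and "\<beta> > 1"
  shows "((\<lambda>t::real. measure M {\<omega> \<in> space M.
              max_ct_local_time X T t \<omega> > \<beta> * inverse \<gamma> * ln t + u})
            \<sim>[at_top] (\<lambda>t. \<gamma> * exp (- \<gamma> * u) * t powr (- (\<beta> - 1))))
       \<and> ((\<lambda>n::nat. measure M {\<omega> \<in> space M.
              real (max_local_time X n \<omega>) > \<beta> * \<alpha> * ln (real n) + u})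
            \<sim>[at_top] (\<lambda>n. \<gamma> * real n * (1 - \<gamma>) powi \<lfloor>\<beta> * \<alpha> * ln (real n) + u\<rfloor>))"
proof
  interpret prob_space M by fact
  interpret jump_walk M X T using assms by unfold_locales
  have \<gamma>: "0 < \<gamma>" "\<gamma> < 1"
    unfolding \<gamma>_def using escape_prob_pos escape_prob_less_1 assms(4) by auto
  \<comment> \<open>The factor \<open>inverse \<gamma>\<close> in the level cancels \<gamma> in the
    exponent and leaves \<open>t powr (- \<beta>)\<close>; the number of first visits contributes
    one further factor \<open>t\<close>.\<close>
  have "\<forall>\<^sub>F t in at_top. \<gamma> * t * exp (- \<gamma> * (\<beta> * inverse \<gamma> * ln t + u)) = \<gamma> * exp (- \<gamma> * u) * t powr (- (\<beta> - 1))"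
    using eventually_gt_at_top[of 0]
  proof eventually_elim
    case (elim t)
    have "exp (- \<gamma> * (\<beta> * inverse \<gamma> * ln t + u)) = t powr (- \<beta>) * exp (- \<gamma> * u)"
      using \<gamma> elim by (simp add: powr_def exp_add[symmetric] field_simps)
    moreover have "t * t powr (- \<beta>) = t powr (- (\<beta> - 1))"
      using elim powr_add[of t 1 "- \<beta>"] by simp
    ultimately show ?case by (simp add: mult_ac)
  qed
  then show "(\<lambda>t::real. measure M {\<omega> \<in> space M. max_ct_local_time X T t \<omega> > \<beta> * inverse \<gamma> * ln t + u})
            \<sim>[at_top] (\<lambda>t. \<gamma> * exp (- \<gamma> * u) * t powr (- (\<beta> - 1)))"
    using prob_max_ct_local_time_asymp[OF assms(4,8), of u] unfolding \<gamma>_def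
    by (rule asymp_equiv_trans[OF _ asymp_equiv_refl_ev, rotated])
  have "0 < \<alpha>" using \<gamma> by (simp add: \<alpha>_def alpha_const_def \<gamma>_def[symmetric] divide_less_0_iff)
  then have "filterlim (\<lambda>n :: nat. \<beta> * \<alpha> * ln (real n) + u) at_top at_top"
    using assms(8) by (intro filterlim_compose[OF ln_affine_at_top filterlim_real_sequentially]) simp
  then have "\<forall>\<^sub>F n :: nat in at_top. 0 \<le> \<beta> * \<alpha> * ln (real n) + u" by (simp add: filterlim_at_top)
  \<comment> \<open>Once the level is nonnegative, the integer power of the statement agrees with
    the natural power of the bounds.\<close>
  then have "\<forall>\<^sub>F n :: nat in at_top. \<gamma> * real n * (1 - \<gamma>) ^ nat \<lfloor>\<beta> * \<alpha> * ln (real n) + u\<rfloor>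
     = \<gamma> * real n * (1 - \<gamma>) powi \<lfloor>\<beta> * \<alpha> * ln (real n) + u\<rfloor>"
    by eventually_elim (simp add: power_int_def)
  then show "(\<lambda>n::nat. measure M {\<omega> \<in> space M. real (max_local_time X n \<omega>) > \<beta> * \<alpha> * ln (real n) + u})
            \<sim>[at_top] (\<lambda>n. \<gamma> * real n * (1 - \<gamma>) powi \<lfloor>\<beta> * \<alpha> * ln (real n) + u\<rfloor>)"
    using prob_max_local_time_asymp[OF assms(4,8), of u] unfolding \<gamma>_def \<alpha>_def
    by (rule asymp_equiv_trans[OF _ asymp_equiv_refl_ev, rotated])
qed

end
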